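(* Let $h/k$ be a field extension and $(h_n)_{n\in\mathbb{N}}$ an increasing sequence of subfields of $h$ containing $k$ with $h=\bigcup_nh_n$, such that for every $n$, $h_n/k$ is an outer Galois extension of finite degree $d_n$ with $\mathrm{Gal}(h_n/k)$ cyclic, generated by $\sigma_n$, and $\sigma_n|_{h_m}=\sigma_m$ for $m\le n$. Suppose that for all $n$, $d_{n+1}/d_n$ and $d_n$ are coprime. Let $\mathbf{k}\subset Z(k)$ be a commutative subfield. Then there exists a sequence $(l_n)_{n\in\mathbb{N}}$ of positive integers with $l_n\mid l_{n+1}$, $d_n\mid \frac{l_{n+1}}{l_n}-1$ and $d_n\mid l_n$ for all $n$. Moreover, for any such sequence, letting $H=\varinjlim h_n(t,\sigma_n)$ with transition morphisms $h_n(t,\sigma_n)\to h_{n+1}(t,\sigma_{n+1})$, $P(t)\mapsto P(t^{l_{n+1}/l_n})$ (identity on $h_n$): if $\mathrm{SIGP}_{\mathbf{k}}$ holds, then $\mathrm{IGP}_H$ holds.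
   Context: "Field" means a not necessarily commutative division ring; $Z(A)$ is the center of $A$. For a field $h$ and automorphism $\sigma$, $h(t,\sigma)$ is the field of fractions of the ring $h[t,\sigma]$ of polynomials $\sum a_it^i$ with $ta=\sigma(a)t$. $h/k$ is outer if the only inner automorphism of $h$ fixing $k$ pointwise is the identity; $\mathrm{Gal}(h/k)$ is the group of automorphisms of $h$ fixing $k$ pointwise and $h/k$ is Galois if its fixed field is $k$. $\mathrm{SIGP}_{\mathbf{k}}$ (for a commutative field $\mathbf{k}$): for every finite group $G$ there is a field $L$ with $\mathbf{k}(t)\subset L\subset\mathbf{k}((t))$ such that $L/\mathbf{k}(t)$ is Galois with group $G$. $\mathrm{IGP}_H$: every finite group is the Galois group of an outer Galois extension of $H$. *)

theory Defs
  imports "HOL-Algebra.Algebra"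
begin

(* "Field" = not necessarily commutative division ring, as an HOL-Algebra ring record *)
definition division_ring :: "('a,'m) ring_scheme \<Rightarrow> bool" where
  "division_ring R \<longleftrightarrow> ring R \<and> \<one>\<^bsub>R\<^esub> \<noteq> \<zero>\<^bsub>R\<^esub> \<and>
     (\<forall>x\<in>carrier R - {\<zero>\<^bsub>R\<^esub>}. x \<in> Units R)"

definition subdivring :: "'a set \<Rightarrow> ('a,'m) ring_scheme \<Rightarrow> bool" where
  "subdivring K R \<longleftrightarrow> subring K R \<and> (\<forall>x\<in>K. x \<noteq> \<zero>\<^bsub>R\<^esub> \<longrightarrow> inv\<^bsub>R\<^esub> x \<in> K)"

definition gen_divring :: "('a,'m) ring_scheme \<Rightarrow> 'a set \<Rightarrow> 'a set" where
  "gen_divring R S = \<Inter>{K. subdivring K R \<and> S \<subseteq> K}"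

definition ring_center :: "('a,'m) ring_scheme \<Rightarrow> 'a set" where
  "ring_center R = {z\<in>carrier R. \<forall>x\<in>carrier R. z \<otimes>\<^bsub>R\<^esub> x = x \<otimes>\<^bsub>R\<^esub> z}"

definition Gal :: "('a,'m) ring_scheme \<Rightarrow> 'a set \<Rightarrow> ('a \<Rightarrow> 'a) monoid" where
  "Gal R K = \<lparr>carrier = {g. g \<in> ring_iso R R \<and> g \<in> extensional (carrier R) \<and> (\<forall>x\<in>K. g x = x)},
              monoid.mult = (\<lambda>g f. compose (carrier R) g f),
              one = restrict id (carrier R)\<rparr>"

definition galois :: "('a,'m) ring_scheme \<Rightarrow> 'a set \<Rightarrow> bool" where
  "galois R K \<longleftrightarrow> {x\<in>carrier R. \<forall>g\<in>carrier (Gal R K). g x = x} = K"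

definition outer :: "('a,'m) ring_scheme \<Rightarrow> 'a set \<Rightarrow> bool" where
  "outer R K \<longleftrightarrow> (\<forall>u\<in>Units R.
      (\<forall>x\<in>K. u \<otimes>\<^bsub>R\<^esub> x \<otimes>\<^bsub>R\<^esub> inv\<^bsub>R\<^esub> u = x) \<longrightarrow>
      (\<forall>x\<in>carrier R. u \<otimes>\<^bsub>R\<^esub> x \<otimes>\<^bsub>R\<^esub> inv\<^bsub>R\<^esub> u = x))"

definition left_degree :: "('a,'m) ring_scheme \<Rightarrow> 'a set \<Rightarrow> 'a set \<Rightarrow> nat \<Rightarrow> bool" where
  "left_degree R K E d \<longleftrightarrow> (\<exists>B. finite B \<and> card B = d \<and> B \<subseteq> E \<and>
     (\<forall>a \<in> B \<rightarrow> K. (\<Oplus>\<^bsub>R\<^esub> b\<in>B. a b \<otimes>\<^bsub>R\<^esub> b) = \<zero>\<^bsub>R\<^esub> \<longrightarrow> (\<forall>b\<in>B. a b = \<zero>\<^bsub>R\<^esub>)) \<and>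
     (\<forall>x\<in>E. \<exists>a \<in> B \<rightarrow> K. x = (\<Oplus>\<^bsub>R\<^esub> b\<in>B. a b \<otimes>\<^bsub>R\<^esub> b)))"

(* skew polynomial ring K[t,s]: sum a_i t^i with t a = s(a) t; p i = coefficient of t^i *)
definition skewpoly :: "('a,'m) ring_scheme \<Rightarrow> 'a set \<Rightarrow> ('a \<Rightarrow> 'a) \<Rightarrow> (nat \<Rightarrow> 'a) ring" where
  "skewpoly R K s = \<lparr>carrier = {p. (\<forall>i. p i \<in> K) \<and> finite {i. p i \<noteq> \<zero>\<^bsub>R\<^esub>}},
     monoid.mult = (\<lambda>p q n. \<Oplus>\<^bsub>R\<^esub> i\<in>{..n}. p i \<otimes>\<^bsub>R\<^esub> (s ^^ i) (q (n - i))),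
     one = (\<lambda>i. if i = 0 then \<one>\<^bsub>R\<^esub> else \<zero>\<^bsub>R\<^esub>),
     ring.zero = (\<lambda>i. \<zero>\<^bsub>R\<^esub>),
     ring.add = (\<lambda>p q i. p i \<oplus>\<^bsub>R\<^esub> q i)\<rparr>"

definition stretch :: "('a,'m) ring_scheme \<Rightarrow> nat \<Rightarrow> (nat \<Rightarrow> 'a) \<Rightarrow> (nat \<Rightarrow> 'a)" where
  "stretch R r p = (\<lambda>n. if r dvd n then p (n div r) else \<zero>\<^bsub>R\<^esub>)"

(* H is (isomorphic to) the direct limit of the skew fields of fractions h_n(t,sigma_n)
   with transition maps P(t) |-> P(t^(l(n+1)/l n)):
   psi n embeds h_n[t,sigma_n] into H; the subfield of H generated by its image is
   (a copy of) the skew field of fractions h_n(t,sigma_n); the embeddings are compatible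
   with the transition maps, and H is the union of these copies. *)
definition is_skew_limit ::
  "('a,'m) ring_scheme \<Rightarrow> (nat \<Rightarrow> 'a set) \<Rightarrow> (nat \<Rightarrow> 'a \<Rightarrow> 'a) \<Rightarrow> (nat \<Rightarrow> nat)
    \<Rightarrow> ('b,'c) ring_scheme \<Rightarrow> (nat \<Rightarrow> (nat \<Rightarrow> 'a) \<Rightarrow> 'b) \<Rightarrow> bool" where
  "is_skew_limit h hs \<sigma> l H \<psi> \<longleftrightarrow> division_ring H \<and>
     (\<forall>n. \<psi> n \<in> ring_hom (skewpoly h (hs n) (\<sigma> n)) H \<and>
          inj_on (\<psi> n) (carrier (skewpoly h (hs n) (\<sigma> n)))) \<and>
     (\<forall>n. \<forall>p\<in>carrier (skewpoly h (hs n) (\<sigma> n)).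
          \<psi> (Suc n) (stretch h (l (Suc n) div l n) p) = \<psi> n p) \<and>
     (\<Union>n. gen_divring H (\<psi> n ` carrier (skewpoly h (hs n) (\<sigma> n)))) = carrier H"

definition laurent :: "('a,'m) ring_scheme \<Rightarrow> 'a set \<Rightarrow> (int \<Rightarrow> 'a) ring" where
  "laurent R K = \<lparr>carrier = {f. (\<forall>i. f i \<in> K) \<and> (\<exists>N. \<forall>i<N. f i = \<zero>\<^bsub>R\<^esub>)},
     monoid.mult = (\<lambda>f g n. \<Oplus>\<^bsub>R\<^esub> i\<in>{i. f i \<noteq> \<zero>\<^bsub>R\<^esub> \<and> g (n - i) \<noteq> \<zero>\<^bsub>R\<^esub>}. f i \<otimes>\<^bsub>R\<^esub> g (n - i)),
     one = (\<lambda>i. if i = 0 then \<one>\<^bsub>R\<^esub> else \<zero>\<^bsub>R\<^esub>),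
     ring.zero = (\<lambda>i. \<zero>\<^bsub>R\<^esub>),
     ring.add = (\<lambda>f g i. f i \<oplus>\<^bsub>R\<^esub> g i)\<rparr>"

definition rat_funs :: "('a,'m) ring_scheme \<Rightarrow> 'a set \<Rightarrow> (int \<Rightarrow> 'a) set" where
  "rat_funs R K = gen_divring (laurent R K)
     ((\<lambda>c i. if i = 0 then c else \<zero>\<^bsub>R\<^esub>) ` K \<union> {\<lambda>i. if i = 1 then \<one>\<^bsub>R\<^esub> else \<zero>\<^bsub>R\<^esub>})"

(* SIGP_K; finite groups are represented (up to isomorphism) with carrier in nat *)
definition SIGP :: "('a,'m) ring_scheme \<Rightarrow> 'a set \<Rightarrow> bool" where
  "SIGP R K \<longleftrightarrow> (\<forall>G :: nat monoid. group G \<and> finite (carrier G) \<longrightarrow>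
     (\<exists>L. subdivring L (laurent R K) \<and> rat_funs R K \<subseteq> L \<and>
          galois ((laurent R K)\<lparr>carrier := L\<rparr>) (rat_funs R K) \<and>
          Gal ((laurent R K)\<lparr>carrier := L\<rparr>) (rat_funs R K) \<cong> G))"

definition IGP :: "('b,'c) ring_scheme \<Rightarrow> bool" where
  "IGP H \<longleftrightarrow> (\<forall>G :: nat monoid. group G \<and> finite (carrier G) \<longrightarrow>
     (\<exists>(L :: 'b ring) f. division_ring L \<and> f \<in> ring_hom H L \<and> inj_on f (carrier H) \<and>
          outer L (f ` carrier H) \<and> galois L (f ` carrier H) \<and> Gal L (f ` carrier H) \<cong> G))"

end

theory Submission
  imports Defs "HOL-Library.Equipollence"
begin

text \<open>
  By Dedekind independence and Artin's lemma, valid over division rings because \<open>h\<^sub>n/k\<close> is outer, the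
  order of \<open>\<sigma>\<^sub>n\<close> is exactly \<open>d\<^sub>n\<close>; hence \<open>d\<^sub>n\<close> divides \<open>d\<^sub>n\<^sub>+\<^sub>1\<close> and \<open>l\<close> is found by the Chinese remainder
  theorem.

  In \<open>H\<close> the element \<open>T = t\<^sub>n^l\<^sub>n\<close> does not depend on \<open>n\<close> and is central. Writing \<open>t\<^sub>n = T^(1/l\<^sub>n)\<close>, the
  field \<open>H\<close> embeds into a division ring \<open>S\<close> of series \<open>\<Sum> a\<^sub>s T^s\<close> with rational exponents and
  left-finite support, where \<open>T^s a = \<tau>\<^sub>s(a) T^s\<close>, and \<open>kk((T))\<close> is central in \<open>S\<close>. Families in
  \<open>kk((T))\<close> that are independent over \<open>kk(T)\<close> stay independent over \<open>H\<close>: clear denominators and apply a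
  \<open>kk\<close>-linear functional to the coefficients of a relation. So for a Galois extension \<open>L/kk(T)\<close> inside
  \<open>kk((T))\<close> with group \<open>G\<close>, the compositum \<open>H L\<close> in \<open>S\<close> is \<open>H \<otimes> L\<close>; it is a division ring, outer because
  it is generated over \<open>H\<close> by central elements, and Galois over \<open>H\<close> with group \<open>G\<close>. As \<open>H\<close> is infinite,
  \<open>H L\<close> has the cardinality of \<open>H\<close> and can be copied onto the same type.
\<close>

section \<open>Sums in rings and division rings\<close>

context ring
begin

lemma finsum_swap:
  assumes "finite A" "finite B" "\<And>i j. i \<in> A \<Longrightarrow> j \<in> B \<Longrightarrow> f i j \<in> carrier R"
  shows "(\<Oplus>i\<in>A. \<Oplus>j\<in>B. f i j) = (\<Oplus>j\<in>B. \<Oplus>i\<in>A. f i j)"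
  using assms(1,3)
proof (induction A rule: finite_induct)
  case empty then show ?case by simp
next
  case (insert a A)
  have "(\<Oplus>j\<in>B. \<Oplus>i\<in>insert a A. f i j) = (\<Oplus>j\<in>B. f a j \<oplus> (\<Oplus>i\<in>A. f i j))"
    using insert by (intro finsum_cong') auto
  also have "\<dots> = (\<Oplus>j\<in>B. f a j) \<oplus> (\<Oplus>j\<in>B. \<Oplus>i\<in>A. f i j)"
    using insert by (intro finsum_addf) auto
  also have "\<dots> = (\<Oplus>i\<in>insert a A. \<Oplus>j\<in>B. f i j)"
    using insert by (subst finsum_insert) auto
  finally show ?case by simp
qed

lemma finsum_mem:
  assumes "finite A" "f \<in> A \<rightarrow> D" "D \<subseteq> carrier R" "\<zero> \<in> D"
    and "\<And>x y. x \<in> D \<Longrightarrow> y \<in> D \<Longrightarrow> x \<oplus> y \<in> D"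
  shows "(\<Oplus>i\<in>A. f i) \<in> D"
  using assms(1,2)
proof (induction A rule: finite_induct)
  case empty then show ?case using assms by simp
next
  case (insert a A)
  then show ?case using assms(3,5) by (subst finsum_insert) auto
qed

lemma finsum_mem_subring:
  assumes "subring K R" "finite A" "f \<in> A \<rightarrow> K"
  shows "(\<Oplus>i\<in>A. f i) \<in> K"
  using finsum_mem[OF assms(2,3)] subringE[OF assms(1)] by blast

lemma finsum_eq_single:
  assumes "finite A" "a \<in> A" "f a \<in> carrier R" "\<And>i. i \<in> A \<Longrightarrow> i \<noteq> a \<Longrightarrow> f i = \<zero>"
  shows "(\<Oplus>i\<in>A. f i) = f a"
proof -
  have "(\<Oplus>i\<in>{a}. f i) = (\<Oplus>i\<in>A. f i)"
    by (rule add.finprod_mono_neutral_cong_left) (use assms in \<open>auto, metis zero_closed\<close>)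
  then show ?thesis using assms(3) by (simp add: finsum_insert)
qed

lemma finsum_uminus:
  assumes "finite A" "f \<in> A \<rightarrow> carrier R"
  shows "(\<Oplus>i\<in>A. \<ominus> f i) = \<ominus> (\<Oplus>i\<in>A. f i)"
  using assms
proof (induction A rule: finite_induct)
  case empty then show ?case by simp
next
  case (insert a A)
  then show ?case by (subst (1 2) finsum_insert) (auto simp: minus_add)
qed

lemma finsum_minus:
  assumes "finite A" "f \<in> A \<rightarrow> carrier R" "g \<in> A \<rightarrow> carrier R"
  shows "(\<Oplus>i\<in>A. f i \<ominus> g i) = (\<Oplus>i\<in>A. f i) \<ominus> (\<Oplus>i\<in>A. g i)"
proof -
  have "(\<Oplus>i\<in>A. f i \<ominus> g i) = (\<Oplus>i\<in>A. f i) \<oplus> (\<Oplus>i\<in>A. \<ominus> g i)"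
    unfolding a_minus_def using assms by (intro finsum_addf) auto
  then show ?thesis using assms by (simp add: finsum_uminus a_minus_def)
qed

lemma additive_finsum:
  fixes S (structure)
  assumes "ring S" "finite A" "f \<in> A \<rightarrow> D" "D \<subseteq> carrier R" "\<zero> \<in> D"
    and "\<And>x y. x \<in> D \<Longrightarrow> y \<in> D \<Longrightarrow> x \<oplus> y \<in> D"
    and closed: "\<And>x. x \<in> D \<Longrightarrow> \<phi> x \<in> carrier S"
    and add: "\<And>x y. x \<in> D \<Longrightarrow> y \<in> D \<Longrightarrow> \<phi> (x \<oplus> y) = \<phi> x \<oplus>\<^bsub>S\<^esub> \<phi> y"
  shows "\<phi> (\<Oplus>i\<in>A. f i) = (\<Oplus>\<^bsub>S\<^esub>i\<in>A. \<phi> (f i))"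
proof -
  interpret S: ring S by fact
  have zero: "\<phi> \<zero> = \<zero>\<^bsub>S\<^esub>"
    using add[OF assms(5,5)] closed[OF assms(5)] by simp
  show ?thesis using assms(2,3)
  proof (induction A rule: finite_induct)
    case empty then show ?case by (simp add: zero)
  next
    case (insert a A)
    have "(\<Oplus>i\<in>A. f i) \<in> D" by (rule finsum_mem) (use insert assms in auto)
    then have "\<phi> (f a \<oplus> (\<Oplus>i\<in>A. f i)) = \<phi> (f a) \<oplus>\<^bsub>S\<^esub> (\<Oplus>\<^bsub>S\<^esub>i\<in>A. \<phi> (f i))"
      using insert add by auto
    then show ?case using insert.hyps insert.prems assms(4) closed
      by (subst finsum_insert; (subst S.finsum_insert)?) (auto simp: Pi_def)
  qed
qed

lemma finsum_carrier_update:
  assumes "subring K R" "finite A" "f \<in> A \<rightarrow> K"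
  shows "(\<Oplus>\<^bsub>R\<lparr>carrier := K\<rparr>\<^esub>i\<in>A. f i) = (\<Oplus>i\<in>A. f i)"
proof -
  interpret K: ring "R\<lparr>carrier := K\<rparr>" by (rule subring_is_ring) fact
  show ?thesis
    using K.additive_finsum[OF ring_axioms assms(2), of f K "\<lambda>x. x"] assms(1,3) K.zero_closed
    by (auto simp: subringE(1,7)[OF assms(1)] subsetD[OF subringE(1)[OF assms(1)]])
qed

lemma finsum_coeff_add:
  assumes "a \<in> J \<rightarrow> carrier R" "b \<in> J \<rightarrow> carrier R" "v \<in> J \<rightarrow> carrier R"
  shows "(\<Oplus>j\<in>J. (a j \<oplus> b j) \<otimes> v j) = (\<Oplus>j\<in>J. a j \<otimes> v j) \<oplus> (\<Oplus>j\<in>J. b j \<otimes> v j)"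
proof -
  have "(\<Oplus>j\<in>J. (a j \<oplus> b j) \<otimes> v j) = (\<Oplus>j\<in>J. a j \<otimes> v j \<oplus> b j \<otimes> v j)"
    using assms by (intro finsum_cong') (auto simp: l_distr Pi_iff)
  also have "\<dots> = (\<Oplus>j\<in>J. a j \<otimes> v j) \<oplus> (\<Oplus>j\<in>J. b j \<otimes> v j)"
    using assms by (intro finsum_addf) auto
  finally show ?thesis .
qed

lemma finsum_coeff_minus:
  assumes "finite J" "a \<in> J \<rightarrow> carrier R" "b \<in> J \<rightarrow> carrier R" "v \<in> J \<rightarrow> carrier R"
  shows "(\<Oplus>j\<in>J. (a j \<ominus> b j) \<otimes> v j) = (\<Oplus>j\<in>J. a j \<otimes> v j) \<ominus> (\<Oplus>j\<in>J. b j \<otimes> v j)"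
proof -
  have "(\<Oplus>j\<in>J. (a j \<ominus> b j) \<otimes> v j) = (\<Oplus>j\<in>J. a j \<otimes> v j \<ominus> b j \<otimes> v j)"
    using assms by (intro finsum_cong') (auto simp: l_distr l_minus a_minus_def Pi_iff)
  also have "\<dots> = (\<Oplus>j\<in>J. a j \<otimes> v j) \<ominus> (\<Oplus>j\<in>J. b j \<otimes> v j)"
    using assms by (intro finsum_minus) auto
  finally show ?thesis .
qed

lemma finsum_coeff_lmult:
  assumes "finite J" "c \<in> carrier R" "a \<in> J \<rightarrow> carrier R" "v \<in> J \<rightarrow> carrier R"
  shows "(\<Oplus>j\<in>J. (c \<otimes> a j) \<otimes> v j) = c \<otimes> (\<Oplus>j\<in>J. a j \<otimes> v j)"
proof -
  have "(\<Oplus>j\<in>J. (c \<otimes> a j) \<otimes> v j) = (\<Oplus>j\<in>J. c \<otimes> (a j \<otimes> v j))"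
    using assms by (intro finsum_cong') (auto simp: m_assoc Pi_iff)
  also have "\<dots> = c \<otimes> (\<Oplus>j\<in>J. a j \<otimes> v j)"
    using assms by (intro finsum_rdistr[symmetric]) auto
  finally show ?thesis .
qed

end

lemma ring_hom_finsum:
  assumes "ring R" "ring S" "\<phi> \<in> ring_hom R S" "finite A" "f \<in> A \<rightarrow> carrier R"
  shows "\<phi> (\<Oplus>\<^bsub>R\<^esub>i\<in>A. f i) = (\<Oplus>\<^bsub>S\<^esub>i\<in>A. \<phi> (f i))"
proof -
  interpret R: ring R by fact
  show ?thesis
    by (rule R.additive_finsum[OF assms(2,4,5)])
       (auto intro: ring_hom_closed[OF assms(3)] ring_hom_add[OF assms(3)])
qed

locale divring = ring R for R (structure) +
  assumes one_not_zero [simp]: "\<one> \<noteq> \<zero>"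
    and nonzero_Units: "\<And>x. x \<in> carrier R \<Longrightarrow> x \<noteq> \<zero> \<Longrightarrow> x \<in> Units R"

lemma division_ring_iff_divring: "division_ring R \<longleftrightarrow> divring R"
  unfolding division_ring_def divring_def divring_axioms_def by auto

context divring
begin

lemma zero_not_one [simp]: "\<zero> \<noteq> \<one>"
  using one_not_zero by metis

lemma nonzero_inv [simp]:
  assumes "x \<in> carrier R" "x \<noteq> \<zero>"
  shows "inv x \<in> carrier R" "inv x \<otimes> x = \<one>" "x \<otimes> inv x = \<one>" "inv x \<noteq> \<zero>"
proof -
  have unit: "x \<in> Units R" using assms nonzero_Units by auto
  show "inv x \<in> carrier R" "inv x \<otimes> x = \<one>" "x \<otimes> inv x = \<one>" using unit by auto
  then show "inv x \<noteq> \<zero>" using assms by auto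
qed

lemma mult_eq_zero_iff [simp]:
  assumes "x \<in> carrier R" "y \<in> carrier R"
  shows "x \<otimes> y = \<zero> \<longleftrightarrow> x = \<zero> \<or> y = \<zero>"
proof (cases "x = \<zero>")
  case False
  then have "inv x \<otimes> (x \<otimes> y) = y" using assms by (simp add: m_assoc[symmetric])
  then show ?thesis using False assms by auto
qed (use assms in simp)

lemma mult_left_cancel:
  assumes "x \<in> carrier R" "y \<in> carrier R" "z \<in> carrier R" "z \<noteq> \<zero>"
  shows "z \<otimes> x = z \<otimes> y \<longleftrightarrow> x = y"
proof
  assume "z \<otimes> x = z \<otimes> y"
  then have "inv z \<otimes> (z \<otimes> x) = inv z \<otimes> (z \<otimes> y)" by simp
  then show "x = y" using assms by (simp add: m_assoc[symmetric])
qed simp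

lemma inv_eqI:
  assumes "x \<in> carrier R" "y \<in> carrier R" "x \<otimes> y = \<one>"
  shows "inv x = y"
proof -
  have "x \<noteq> \<zero>" using assms by auto
  then show ?thesis using assms mult_left_cancel[of "inv x" y x] by simp
qed

lemma inv_eqI_left:
  assumes "x \<in> carrier R" "y \<in> carrier R" "y \<otimes> x = \<one>"
  shows "inv x = y"
proof -
  have "x \<noteq> \<zero>" using assms by auto
  then have "y = (y \<otimes> x) \<otimes> inv x" using assms(1,2) by (simp add: m_assoc)
  then show ?thesis using \<open>x \<noteq> \<zero>\<close> assms by simp
qed

lemma commute_iff_conjugate:
  assumes "u \<in> carrier R" "u \<noteq> \<zero>" "x \<in> carrier R"
  shows "u \<otimes> x \<otimes> inv u = x \<longleftrightarrow> u \<otimes> x = x \<otimes> u"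
proof
  assume "u \<otimes> x \<otimes> inv u = x"
  then have "x \<otimes> u = (u \<otimes> x \<otimes> inv u) \<otimes> u" by simp
  then show "u \<otimes> x = x \<otimes> u" using assms by (simp add: m_assoc)
qed (use assms in \<open>simp add: m_assoc\<close>)

lemma outer_iff_commute:
  assumes K: "K \<subseteq> carrier R"
  shows "outer R K \<longleftrightarrow> (\<forall>u\<in>carrier R. (\<forall>y\<in>K. u \<otimes> y = y \<otimes> u) \<longrightarrow> (\<forall>x\<in>carrier R. u \<otimes> x = x \<otimes> u))"
proof (intro iffI ballI impI)
  fix u x assume outer: "outer R K" and u: "u \<in> carrier R" "\<forall>y\<in>K. u \<otimes> y = y \<otimes> u" and x: "x \<in> carrier R"
  show "u \<otimes> x = x \<otimes> u"
  proof (cases "u = \<zero>")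
    case False
    then have "\<forall>y\<in>K. u \<otimes> y \<otimes> inv u = y" using u K commute_iff_conjugate by blast
    moreover have "u \<in> Units R" using False u nonzero_Units by blast
    ultimately have "u \<otimes> x \<otimes> inv u = x" using outer x unfolding outer_def by blast
    then show ?thesis using commute_iff_conjugate False u x by blast
  qed (use x in simp)
next
  assume commute: "\<forall>u\<in>carrier R. (\<forall>y\<in>K. u \<otimes> y = y \<otimes> u) \<longrightarrow> (\<forall>x\<in>carrier R. u \<otimes> x = x \<otimes> u)"
  show "outer R K" unfolding outer_def
  proof (intro ballI impI)
    fix u x assume unit: "u \<in> Units R" and fixed: "\<forall>y\<in>K. u \<otimes> y \<otimes> inv u = y" and x: "x \<in> carrier R"
    have u: "u \<in> carrier R" "u \<noteq> \<zero>" using unit by (auto simp: Units_def)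
    then have "\<forall>y\<in>K. u \<otimes> y = y \<otimes> u" using fixed K commute_iff_conjugate by blast
    then have "u \<otimes> x = x \<otimes> u" using commute u(1) x by blast
    then show "u \<otimes> x \<otimes> inv u = x" using commute_iff_conjugate u x by blast
  qed
qed

end

lemma
  assumes "subdivring K R"
  shows subdivring_imp_subring: "subring K R"
    and subdivring_subset: "K \<subseteq> carrier R"
    and subdivring_carrier: "\<And>x. x \<in> K \<Longrightarrow> x \<in> carrier R"
    and subdivring_zero: "\<zero>\<^bsub>R\<^esub> \<in> K"
    and subdivring_one: "\<one>\<^bsub>R\<^esub> \<in> K"
    and subdivring_uminus: "\<And>x. x \<in> K \<Longrightarrow> \<ominus>\<^bsub>R\<^esub> x \<in> K"
    and subdivring_mult: "\<And>x y. x \<in> K \<Longrightarrow> y \<in> K \<Longrightarrow> x \<otimes>\<^bsub>R\<^esub> y \<in> K"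
    and subdivring_add: "\<And>x y. x \<in> K \<Longrightarrow> y \<in> K \<Longrightarrow> x \<oplus>\<^bsub>R\<^esub> y \<in> K"
    and subdivring_minus: "\<And>x y. x \<in> K \<Longrightarrow> y \<in> K \<Longrightarrow> x \<ominus>\<^bsub>R\<^esub> y \<in> K"
    and subdivring_inv: "\<And>x. x \<in> K \<Longrightarrow> x \<noteq> \<zero>\<^bsub>R\<^esub> \<Longrightarrow> inv\<^bsub>R\<^esub> x \<in> K"
  using assms subringE[of K R] unfolding subdivring_def a_minus_def by auto

lemmas subdivring_closed = subdivring_zero subdivring_one subdivring_uminus subdivring_mult
  subdivring_add subdivring_minus subdivring_inv

context divring
begin

lemma subdivringI:
  assumes "subring K R" "\<And>x. x \<in> K \<Longrightarrow> x \<noteq> \<zero> \<Longrightarrow> inv x \<in> K"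
  shows "subdivring K R"
  using assms unfolding subdivring_def by auto

lemma subdivring_divring:
  assumes K: "subdivring K R" shows "divring (R\<lparr>carrier := K\<rparr>)"
proof -
  interpret K: ring "R\<lparr>carrier := K\<rparr>" by (rule subring_is_ring[OF subdivring_imp_subring[OF K]])
  show ?thesis
  proof unfold_locales
    fix x assume "x \<in> carrier (R\<lparr>carrier := K\<rparr>)" "x \<noteq> \<zero>\<^bsub>R\<lparr>carrier := K\<rparr>\<^esub>"
    then show "x \<in> Units (R\<lparr>carrier := K\<rparr>)"
      using subdivring_carrier[OF K] subdivring_inv[OF K]
      unfolding Units_def by (auto intro!: bexI[of _ "inv x"])
  qed simp
qed

lemma carrier_subdivring: "subdivring (carrier R) R"
  using carrier_is_subring by (intro subdivringI) auto

lemma gen_divring_subdivring: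
  assumes "Y \<subseteq> carrier R" shows "subdivring (gen_divring R Y) R"
proof -
  have nonempty: "{K. subdivring K R \<and> Y \<subseteq> K} \<noteq> {}"
    using assms carrier_subdivring by auto
  have "subring (gen_divring R Y) R" unfolding gen_divring_def
    by (rule subring_Inter[OF _ nonempty]) (auto simp: subdivring_def)
  then show ?thesis by (rule subdivringI) (auto simp: gen_divring_def subdivring_def)
qed

end

lemma gen_divring_superset: "Y \<subseteq> gen_divring R Y"
  and gen_divring_least: "subdivring K R \<Longrightarrow> Y \<subseteq> K \<Longrightarrow> gen_divring R Y \<subseteq> K"
  unfolding gen_divring_def by blast+

locale divring_hom = R: divring R + S: divring S for R (structure) and S (structure) +
  fixes \<phi> assumes hom: "\<phi> \<in> ring_hom R S"
begin

sublocale ring_hom_ring R S \<phi>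
  by (rule ring_hom_ringI2[OF R.ring_axioms S.ring_axioms hom])

lemma hom_eq_zero_iff: "x \<in> carrier R \<Longrightarrow> \<phi> x = \<zero>\<^bsub>S\<^esub> \<longleftrightarrow> x = \<zero>\<^bsub>R\<^esub>"
proof
  assume x: "x \<in> carrier R" "\<phi> x = \<zero>\<^bsub>S\<^esub>"
  show "x = \<zero>\<^bsub>R\<^esub>"
  proof (rule ccontr)
    assume "x \<noteq> \<zero>\<^bsub>R\<^esub>"
    then have "\<phi> x \<otimes>\<^bsub>S\<^esub> \<phi> (inv\<^bsub>R\<^esub> x) = \<one>\<^bsub>S\<^esub>" using x hom_mult[of x "inv\<^bsub>R\<^esub> x"] by simp
    then show False using x \<open>x \<noteq> \<zero>\<^bsub>R\<^esub>\<close> by simp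
  qed
qed simp

lemma hom_inj: "inj_on \<phi> (carrier R)"
proof (rule inj_onI)
  fix x y assume "x \<in> carrier R" "y \<in> carrier R" "\<phi> x = \<phi> y"
  then have "\<phi> (x \<ominus>\<^bsub>R\<^esub> y) = \<zero>\<^bsub>S\<^esub>" by (simp add: a_minus_def S.r_neg)
  then show "x = y" using hom_eq_zero_iff[of "x \<ominus>\<^bsub>R\<^esub> y"] \<open>x \<in> _\<close> \<open>y \<in> _\<close> by simp
qed

lemma hom_inv: "x \<in> carrier R \<Longrightarrow> x \<noteq> \<zero>\<^bsub>R\<^esub> \<Longrightarrow> \<phi> (inv\<^bsub>R\<^esub> x) = inv\<^bsub>S\<^esub> \<phi> x"
  using hom_mult[of x "inv\<^bsub>R\<^esub> x"] by (intro S.inv_eqI[symmetric]) auto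

lemma image_subdivring:
  assumes K: "subdivring K R" shows "subdivring (\<phi> ` K) S"
proof (rule S.subdivringI[OF img_is_subring[OF subdivring_imp_subring[OF K]]])
  fix y assume "y \<in> \<phi> ` K" "y \<noteq> \<zero>\<^bsub>S\<^esub>"
  then obtain x where "x \<in> K" "y = \<phi> x" by blast
  moreover have "x \<noteq> \<zero>\<^bsub>R\<^esub>" using \<open>y = \<phi> x\<close> \<open>y \<noteq> \<zero>\<^bsub>S\<^esub>\<close> by auto
  ultimately show "inv\<^bsub>S\<^esub> y \<in> \<phi> ` K"
    using hom_inv[of x] subdivring_carrier[OF K] subdivring_inv[OF K] by (metis imageI)
qed

lemma vimage_subdivring:
  assumes D: "subdivring D S" shows "subdivring {x \<in> carrier R. \<phi> x \<in> D} R"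
proof (rule R.subdivringI)
  show "subring {x \<in> carrier R. \<phi> x \<in> D} R"
    by (rule R.subringI) (use subdivring_closed[OF D] in auto)
  fix x assume "x \<in> {x \<in> carrier R. \<phi> x \<in> D}" "x \<noteq> \<zero>\<^bsub>R\<^esub>"
  then show "inv\<^bsub>R\<^esub> x \<in> {x \<in> carrier R. \<phi> x \<in> D}"
    using subdivring_inv[OF D] hom_eq_zero_iff by (auto simp: hom_inv)
qed

lemma image_gen_divring_subset:
  assumes "subdivring D S" "Y \<subseteq> carrier R" "\<phi> ` Y \<subseteq> D"
  shows "\<phi> ` gen_divring R Y \<subseteq> D"
  using gen_divring_least[OF vimage_subdivring[OF assms(1)], of Y] assms(2,3) by auto

end

section \<open>Homogeneous linear systems\<close>

definition opp_ring :: "('a,'m) ring_scheme \<Rightarrow> ('a,'m) ring_scheme" where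
  "opp_ring R = R\<lparr>monoid.mult := \<lambda>x y. y \<otimes>\<^bsub>R\<^esub> x\<rparr>"

lemma opp_ring_simps [simp]:
  "carrier (opp_ring R) = carrier R" "\<zero>\<^bsub>opp_ring R\<^esub> = \<zero>\<^bsub>R\<^esub>" "\<one>\<^bsub>opp_ring R\<^esub> = \<one>\<^bsub>R\<^esub>"
  "x \<oplus>\<^bsub>opp_ring R\<^esub> y = x \<oplus>\<^bsub>R\<^esub> y" "x \<otimes>\<^bsub>opp_ring R\<^esub> y = y \<otimes>\<^bsub>R\<^esub> x"
  by (auto simp: opp_ring_def)

lemma finsum_opp_ring [simp]: "finsum (opp_ring R) = finsum R"
  by (rule ext)+ (simp add: finsum_def opp_ring_def)

lemma (in divring) opp_ring_divring: "divring (opp_ring R)"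
proof -
  interpret O: ring "opp_ring R"
  proof (intro ringI)
    show "abelian_group (opp_ring R)"
      by (intro abelian_groupI) (auto simp: a_ac intro: bexI[of _ "\<ominus> _"] l_neg)
    show "monoid (opp_ring R)" by (intro monoidI) (auto simp: m_assoc)
  qed (auto simp: l_distr r_distr)
  show ?thesis
  proof unfold_locales
    fix x assume "x \<in> carrier (opp_ring R)" "x \<noteq> \<zero>\<^bsub>opp_ring R\<^esub>"
    then show "x \<in> Units (opp_ring R)"
      unfolding Units_def by (auto intro!: bexI[of _ "inv x"])
  qed simp
qed

context divring
begin

lemma finsum_eliminate:
  assumes J: "finite J" "j\<^sub>0 \<notin> J" and x: "x \<in> J \<rightarrow> carrier R" and u: "u \<in> J \<rightarrow> carrier R"
    and v: "v \<in> insert j\<^sub>0 J \<rightarrow> carrier R" and p: "p \<in> carrier R"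
  shows "(\<Oplus>j\<in>insert j\<^sub>0 J. (x(j\<^sub>0 := \<ominus> ((\<Oplus>j\<in>J. x j \<otimes> u j) \<otimes> p))) j \<otimes> v j) =
         (\<Oplus>j\<in>J. x j \<otimes> (v j \<ominus> u j \<otimes> p \<otimes> v j\<^sub>0))"
proof -
  define s where "s = (\<Oplus>j\<in>J. x j \<otimes> u j)"
  define y where "y = x(j\<^sub>0 := \<ominus> (s \<otimes> p))"
  have closed: "x j \<in> carrier R" "u j \<in> carrier R" "v j \<in> carrier R" if "j \<in> J" for j
    using x u v that by auto
  have s: "s \<in> carrier R" using closed by (auto simp: s_def)
  have v\<^sub>0: "v j\<^sub>0 \<in> carrier R" using v by auto
  have "(\<Oplus>j\<in>J. x j \<otimes> (v j \<ominus> u j \<otimes> p \<otimes> v j\<^sub>0)) = (\<Oplus>j\<in>J. x j \<otimes> v j \<ominus> x j \<otimes> u j \<otimes> (p \<otimes> v j\<^sub>0))"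
    using closed p v\<^sub>0 by (intro finsum_cong') (auto simp: a_minus_def r_distr r_minus m_assoc)
  also have "\<dots> = (\<Oplus>j\<in>J. x j \<otimes> v j) \<ominus> (\<Oplus>j\<in>J. x j \<otimes> u j \<otimes> (p \<otimes> v j\<^sub>0))"
    using J closed p v\<^sub>0 by (intro finsum_minus) auto
  also have "(\<Oplus>j\<in>J. x j \<otimes> u j \<otimes> (p \<otimes> v j\<^sub>0)) = s \<otimes> (p \<otimes> v j\<^sub>0)"
    unfolding s_def using J closed p v\<^sub>0 by (intro finsum_ldistr[symmetric]) auto
  also have "(\<Oplus>j\<in>J. x j \<otimes> v j) \<ominus> s \<otimes> (p \<otimes> v j\<^sub>0) = y j\<^sub>0 \<otimes> v j\<^sub>0 \<oplus> (\<Oplus>j\<in>J. x j \<otimes> v j)"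
    using s p v\<^sub>0 closed by (simp add: y_def a_minus_def l_minus m_assoc a_comm)
  also have "(\<Oplus>j\<in>J. x j \<otimes> v j) = (\<Oplus>j\<in>J. y j \<otimes> v j)"
    using J closed by (intro finsum_cong') (auto simp: y_def)
  also have "y j\<^sub>0 \<otimes> v j\<^sub>0 \<oplus> (\<Oplus>j\<in>J. y j \<otimes> v j) = (\<Oplus>j\<in>insert j\<^sub>0 J. y j \<otimes> v j)"
    using J closed s p v\<^sub>0 by (intro finsum_insert[symmetric]) (auto simp: y_def)
  finally show ?thesis by (simp add: y_def s_def)
qed

lemma homogeneous_system:
  assumes "finite I" "finite J" "card I < card J"
    and "\<And>i j. i \<in> I \<Longrightarrow> j \<in> J \<Longrightarrow> a i j \<in> carrier R"
  shows "\<exists>x \<in> J \<rightarrow> carrier R. (\<exists>j\<in>J. x j \<noteq> \<zero>) \<and> (\<forall>i\<in>I. (\<Oplus>j\<in>J. x j \<otimes> a i j) = \<zero>)"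
  using assms
proof (induction I arbitrary: J a rule: finite_induct)
  case empty
  then obtain j where "j \<in> J" by (metis card_gt_0_iff ex_in_conv card.empty)
  then show ?case by (intro bexI[of _ "\<lambda>_. \<one>"]) auto
next
  case (insert i\<^sub>0 I)
  show ?case
  proof (cases "\<forall>j\<in>J. a i\<^sub>0 j = \<zero>")
    case True
    obtain x where x: "x \<in> J \<rightarrow> carrier R" "\<exists>j\<in>J. x j \<noteq> \<zero>" "\<forall>i\<in>I. (\<Oplus>j\<in>J. x j \<otimes> a i j) = \<zero>"
      using insert.IH[of J a] insert.prems insert.hyps by auto
    moreover have "(\<Oplus>j\<in>J. x j \<otimes> a i\<^sub>0 j) = \<zero>"
      using True x(1) by (intro add.finprod_one_eqI) (auto simp: Pi_iff)
    ultimately show ?thesis by blast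
  next
    case False
    then obtain j\<^sub>0 where j\<^sub>0: "j\<^sub>0 \<in> J" "a i\<^sub>0 j\<^sub>0 \<noteq> \<zero>" by blast
    define J' where "J' = J - {j\<^sub>0}"
    have J': "J = insert j\<^sub>0 J'" "finite J'" "j\<^sub>0 \<notin> J'" using j\<^sub>0 insert.prems by (auto simp: J'_def)
    define p where "p = inv (a i\<^sub>0 j\<^sub>0)"
    have a: "a i j \<in> carrier R" if "i \<in> insert i\<^sub>0 I" "j \<in> J" for i j using insert.prems that by blast
    have p: "p \<in> carrier R" "p \<otimes> a i\<^sub>0 j\<^sub>0 = \<one>" using a[of i\<^sub>0 j\<^sub>0] j\<^sub>0 by (auto simp: p_def)
    define a' where "a' i j = a i j \<ominus> a i\<^sub>0 j \<otimes> p \<otimes> a i j\<^sub>0" for i j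
    have "card I < card J'" using insert.prems(2) insert.hyps J' by simp
    moreover have "a' i j \<in> carrier R" if "i \<in> I" "j \<in> J'" for i j
      using a[of i] a[of i\<^sub>0] p(1) that J'(1) by (auto simp: a'_def)
    ultimately obtain x where x: "x \<in> J' \<rightarrow> carrier R" "\<exists>j\<in>J'. x j \<noteq> \<zero>"
      and sol: "\<And>i. i \<in> I \<Longrightarrow> (\<Oplus>j\<in>J'. x j \<otimes> a' i j) = \<zero>"
      using insert.IH[of J' a'] J'(2) by blast
    have "(\<Oplus>j\<in>J'. x j \<otimes> a' i\<^sub>0 j) = \<zero>"
      using x(1) a p J' by (intro add.finprod_one_eqI) (auto simp: a'_def m_assoc a_minus_def r_neg Pi_iff)
    then have sol': "(\<Oplus>j\<in>J'. x j \<otimes> a' i j) = \<zero>" if "i \<in> insert i\<^sub>0 I" for i using sol that by blast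
    define y where "y = x(j\<^sub>0 := \<ominus> ((\<Oplus>j\<in>J'. x j \<otimes> a i\<^sub>0 j) \<otimes> p))"
    have "(\<Oplus>j\<in>J. y j \<otimes> a i j) = \<zero>" if "i \<in> insert i\<^sub>0 I" for i
      using finsum_eliminate[OF J'(2,3) x(1) _ _ p(1), of "a i\<^sub>0" "a i"] a that sol'[OF that] J'(1)
      by (auto simp: y_def a'_def)
    moreover have "y \<in> J \<rightarrow> carrier R" using x(1) a p J' by (auto simp: y_def Pi_iff)
    moreover have "\<exists>j\<in>J. y j \<noteq> \<zero>" using x(2) J' by (auto simp: y_def)
    ultimately show ?thesis by blast
  qed
qed

lemma homogeneous_system_right:
  assumes "finite I" "finite J" "card I < card J"
    and "\<And>i j. i \<in> I \<Longrightarrow> j \<in> J \<Longrightarrow> a i j \<in> carrier R"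
  shows "\<exists>x \<in> J \<rightarrow> carrier R. (\<exists>j\<in>J. x j \<noteq> \<zero>) \<and> (\<forall>i\<in>I. (\<Oplus>j\<in>J. a i j \<otimes> x j) = \<zero>)"
  using divring.homogeneous_system[OF opp_ring_divring, of I J a] assms by simp

lemma homogeneous_system_subdivring:
  assumes K: "subdivring K R" and fin: "finite I" "finite J" "card I < card J"
    and a: "\<And>i j. i \<in> I \<Longrightarrow> j \<in> J \<Longrightarrow> a i j \<in> K"
  shows "\<exists>x \<in> J \<rightarrow> K. (\<exists>j\<in>J. x j \<noteq> \<zero>) \<and> (\<forall>i\<in>I. (\<Oplus>j\<in>J. x j \<otimes> a i j) = \<zero>)"
proof -
  interpret K: divring "R\<lparr>carrier := K\<rparr>" by (rule subdivring_divring[OF K])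
  have "\<exists>x \<in> J \<rightarrow> K. (\<exists>j\<in>J. x j \<noteq> \<zero>) \<and>
      (\<forall>i\<in>I. (\<Oplus>\<^bsub>R\<lparr>carrier := K\<rparr>\<^esub>j\<in>J. x j \<otimes> a i j) = \<zero>)"
    using K.homogeneous_system[OF fin, of a] a by simp
  then obtain x where x: "x \<in> J \<rightarrow> K" "\<exists>j\<in>J. x j \<noteq> \<zero>"
    and sol: "\<And>i. i \<in> I \<Longrightarrow> (\<Oplus>\<^bsub>R\<lparr>carrier := K\<rparr>\<^esub>j\<in>J. x j \<otimes> a i j) = \<zero>"
    by blast
  have "(\<Oplus>j\<in>J. x j \<otimes> a i j) = \<zero>" if "i \<in> I" for i
    using sol[OF that] finsum_carrier_update[OF subdivring_imp_subring[OF K] fin(2), of "\<lambda>j. x j \<otimes> a i j"]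
      x(1) a that subdivring_mult[OF K] by (auto simp: Pi_iff)
  then show ?thesis using x by blast
qed

lemma equal_combinations_exist:
  fixes e f :: "'i \<Rightarrow> 'j \<Rightarrow> 'a"
  assumes K: "subdivring K R" and fin: "finite I" "finite J" and card: "card I < 2 * card J"
    and e: "\<And>i j. i \<in> I \<Longrightarrow> j \<in> J \<Longrightarrow> e i j \<in> K" and f: "\<And>i j. i \<in> I \<Longrightarrow> j \<in> J \<Longrightarrow> f i j \<in> K"
  shows "\<exists>a\<in>J \<rightarrow> K. \<exists>b\<in>J \<rightarrow> K. (\<exists>j\<in>J. a j \<noteq> \<zero> \<or> b j \<noteq> \<zero>) \<and>
    (\<forall>i\<in>I. (\<Oplus>j\<in>J. a j \<otimes> e i j) = (\<Oplus>j\<in>J. b j \<otimes> f i j))"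
proof -
  define m where "m i j = (case j of Inl j \<Rightarrow> e i j | Inr j \<Rightarrow> \<ominus> f i j)" for i and j :: "'j + 'j"
  have m: "m i j \<in> K" if "i \<in> I" "j \<in> J <+> J" for i j
    using that e f subdivring_uminus[OF K] by (auto simp: m_def)
  have "card I < card (J <+> J)" using card fin by (simp add: card_Plus)
  then have "\<exists>x\<in>J <+> J \<rightarrow> K. (\<exists>j\<in>J <+> J. x j \<noteq> \<zero>) \<and> (\<forall>i\<in>I. (\<Oplus>j\<in>J <+> J. x j \<otimes> m i j) = \<zero>)"
    by (intro homogeneous_system_subdivring[OF K fin(1) _ _ m]) (use fin in auto)
  then obtain x where x: "x \<in> J <+> J \<rightarrow> K" "\<exists>j\<in>J <+> J. x j \<noteq> \<zero>"
    and sol: "\<And>i. i \<in> I \<Longrightarrow> (\<Oplus>j\<in>J <+> J. x j \<otimes> m i j) = \<zero>" by blast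
  define a b where "a j = x (Inl j)" and "b j = x (Inr j)" for j
  have ab: "a \<in> J \<rightarrow> K" "b \<in> J \<rightarrow> K" using x(1) by (auto simp: a_def b_def)
  have carrier: "a j \<in> carrier R" "b j \<in> carrier R" "e i j \<in> carrier R" "f i j \<in> carrier R"
    if "i \<in> I" "j \<in> J" for i j using that ab e f subdivring_carrier[OF K] by (auto simp: Pi_iff)
  have "(\<Oplus>j\<in>J. a j \<otimes> e i j) = (\<Oplus>j\<in>J. b j \<otimes> f i j)" if i: "i \<in> I" for i
  proof -
    note closed = carrier[OF i]
    have "\<zero> = (\<Oplus>j\<in>Inl ` J \<union> Inr ` J. x j \<otimes> m i j)" using sol[OF i] by (simp add: Plus_def)
    also have "\<dots> = (\<Oplus>j\<in>Inl ` J. x j \<otimes> m i j) \<oplus> (\<Oplus>j\<in>Inr ` J. x j \<otimes> m i j)"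
      using closed fin(2) by (intro finsum_Un_disjoint) (auto simp: m_def a_def b_def)
    also have "(\<Oplus>j\<in>Inl ` J. x j \<otimes> m i j) = (\<Oplus>j\<in>J. a j \<otimes> e i j)"
      using closed by (subst finsum_reindex) (auto simp: a_def m_def)
    also have "(\<Oplus>j\<in>Inr ` J. x j \<otimes> m i j) = (\<Oplus>j\<in>J. \<ominus> (b j \<otimes> f i j))"
      using closed by (subst finsum_reindex) (auto simp: b_def m_def r_minus intro!: finsum_cong')
    also have "\<dots> = \<ominus> (\<Oplus>j\<in>J. b j \<otimes> f i j)" using closed fin(2) by (intro finsum_uminus) auto
    finally have "(\<Oplus>j\<in>J. a j \<otimes> e i j) \<ominus> (\<Oplus>j\<in>J. b j \<otimes> f i j) = \<zero>" by (simp add: a_minus_def)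
    then show ?thesis using closed by (subst (asm) r_right_minus_eq) auto
  qed
  moreover have "\<exists>j\<in>J. a j \<noteq> \<zero> \<or> b j \<noteq> \<zero>" using x(2) by (auto simp: a_def b_def)
  ultimately show ?thesis using ab by blast
qed

lemma minimal_support_vector:
  assumes J: "finite J" and W: "W \<subseteq> J \<rightarrow> carrier R"
    and scale: "\<And>x c. x \<in> W \<Longrightarrow> c \<in> carrier R \<Longrightarrow> (\<lambda>j. c \<otimes> x j) \<in> W"
    and nonzero: "x \<in> W" "\<exists>j\<in>J. x j \<noteq> \<zero>"
  obtains y j\<^sub>0 where "y \<in> W" "j\<^sub>0 \<in> J" "y j\<^sub>0 = \<one>"
    "\<And>z. z \<in> W \<Longrightarrow> z j\<^sub>0 = \<zero> \<Longrightarrow> (\<And>j. j \<in> J \<Longrightarrow> y j = \<zero> \<Longrightarrow> z j = \<zero>) \<Longrightarrow> \<forall>j\<in>J. z j = \<zero>"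
proof -
  define supp where "supp z = {j \<in> J. z j \<noteq> \<zero>}" for z
  have "x \<in> W \<and> supp x \<noteq> {}" using nonzero by (auto simp: supp_def)
  then obtain x where x: "x \<in> W" "supp x \<noteq> {}"
    and least: "\<And>z. z \<in> W \<Longrightarrow> supp z \<noteq> {} \<Longrightarrow> card (supp x) \<le> card (supp z)"
    using ex_has_least_nat[of "\<lambda>x. x \<in> W \<and> supp x \<noteq> {}" x "\<lambda>x. card (supp x)"] by blast
  obtain j\<^sub>0 where j\<^sub>0: "j\<^sub>0 \<in> J" "x j\<^sub>0 \<noteq> \<zero>" using x(2) by (auto simp: supp_def)
  have xc: "x j \<in> carrier R" if "j \<in> J" for j using x(1) W that by auto
  define y where "y j = inv (x j\<^sub>0) \<otimes> x j" for j
  have supp_y: "y j = \<zero> \<longleftrightarrow> x j = \<zero>" if "j \<in> J" for j using xc that j\<^sub>0 by (simp add: y_def)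
  show thesis
  proof (rule that)
    show "y \<in> W" using scale[OF x(1), of "inv (x j\<^sub>0)"] xc j\<^sub>0 by (simp add: y_def[abs_def])
    show "j\<^sub>0 \<in> J" "y j\<^sub>0 = \<one>" using xc j\<^sub>0 by (simp_all add: y_def)
    fix z assume z: "z \<in> W" "z j\<^sub>0 = \<zero>" "\<And>j. j \<in> J \<Longrightarrow> y j = \<zero> \<Longrightarrow> z j = \<zero>"
    have "supp z \<subset> supp x" using z(2,3) supp_y j\<^sub>0 by (auto simp: supp_def)
    then have "card (supp z) < card (supp x)" using J by (intro psubset_card_mono) (auto simp: supp_def)
    then have "supp z = {}" using least[OF z(1)] by fastforce
    then show "\<forall>j\<in>J. z j = \<zero>" by (auto simp: supp_def)
  qed
qed

end

section \<open>Independence, spans and coordinates\<close>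

definition lin_indep :: "('a,'m) ring_scheme \<Rightarrow> 'a set \<Rightarrow> 'a set \<Rightarrow> bool" where
  "lin_indep R K B \<longleftrightarrow> (\<forall>a \<in> B \<rightarrow> K. (\<Oplus>\<^bsub>R\<^esub>b\<in>B. a b \<otimes>\<^bsub>R\<^esub> b) = \<zero>\<^bsub>R\<^esub> \<longrightarrow> (\<forall>b\<in>B. a b = \<zero>\<^bsub>R\<^esub>))"

definition lin_span :: "('a,'m) ring_scheme \<Rightarrow> 'a set \<Rightarrow> 'a set \<Rightarrow> 'a set" where
  "lin_span R K B = {(\<Oplus>\<^bsub>R\<^esub>b\<in>B. a b \<otimes>\<^bsub>R\<^esub> b) | a. a \<in> B \<rightarrow> K}"

lemma left_degree_iff:
  "left_degree R K E d \<longleftrightarrow>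
     (\<exists>B. finite B \<and> card B = d \<and> B \<subseteq> E \<and> lin_indep R K B \<and> E \<subseteq> lin_span R K B)"
  unfolding left_degree_def lin_indep_def lin_span_def subset_iff by (auto simp: Bex_def conj_commute)

lemma lin_span_mono: "K \<subseteq> K' \<Longrightarrow> lin_span R K B \<subseteq> lin_span R K' B"
  unfolding lin_span_def by fastforce

lemma
  fixes R (structure)
  assumes "ring R" "subring S R" "finite B" "B \<subseteq> S" "K \<subseteq> S"
  shows lin_indep_carrier_update: "lin_indep (R\<lparr>carrier := S\<rparr>) K B \<longleftrightarrow> lin_indep R K B"
    and lin_span_carrier_update: "lin_span (R\<lparr>carrier := S\<rparr>) K B = lin_span R K B"
proof -
  interpret ring R by fact
  have "(\<Oplus>\<^bsub>R\<lparr>carrier := S\<rparr>\<^esub>b\<in>B. a b \<otimes> b) = (\<Oplus>b\<in>B. a b \<otimes> b)" if "a \<in> B \<rightarrow> K" for a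
    by (rule finsum_carrier_update[OF assms(2,3)])
       (use that assms(4,5) subringE(6)[OF assms(2)] in \<open>auto simp: Pi_iff subset_eq\<close>)
  then show "lin_indep (R\<lparr>carrier := S\<rparr>) K B \<longleftrightarrow> lin_indep R K B"
    "lin_span (R\<lparr>carrier := S\<rparr>) K B = lin_span R K B"
    unfolding lin_indep_def lin_span_def by (auto, metis+)
qed

lemma lin_span_insert:
  assumes "ring R" "finite B" "b \<notin> B" "insert b B \<subseteq> carrier R" "K \<subseteq> carrier R"
  shows "lin_span R K (insert b B) = (\<lambda>(c,x). c \<otimes>\<^bsub>R\<^esub> b \<oplus>\<^bsub>R\<^esub> x) ` (K \<times> lin_span R K B)"
proof -
  interpret ring R by fact
  have split: "(\<Oplus>\<^bsub>R\<^esub>i\<in>insert b B. a i \<otimes>\<^bsub>R\<^esub> i) = a b \<otimes>\<^bsub>R\<^esub> b \<oplus>\<^bsub>R\<^esub> (\<Oplus>\<^bsub>R\<^esub>i\<in>B. a i \<otimes>\<^bsub>R\<^esub> i)"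
    if "a \<in> insert b B \<rightarrow> K" for a
    using that assms(2-5) by (intro finsum_insert) (auto simp: Pi_iff subset_eq)
  show ?thesis
  proof (intro equalityI subsetI)
    fix x assume "x \<in> lin_span R K (insert b B)"
    then obtain a where "a \<in> insert b B \<rightarrow> K" "x = (\<Oplus>\<^bsub>R\<^esub>i\<in>insert b B. a i \<otimes>\<^bsub>R\<^esub> i)"
      by (auto simp: lin_span_def)
    then show "x \<in> (\<lambda>(c,x). c \<otimes>\<^bsub>R\<^esub> b \<oplus>\<^bsub>R\<^esub> x) ` (K \<times> lin_span R K B)"
      using split by (intro image_eqI[of _ _ "(a b, \<Oplus>\<^bsub>R\<^esub>i\<in>B. a i \<otimes>\<^bsub>R\<^esub> i)"]) (auto simp: lin_span_def)
  next
    fix x assume "x \<in> (\<lambda>(c,x). c \<otimes>\<^bsub>R\<^esub> b \<oplus>\<^bsub>R\<^esub> x) ` (K \<times> lin_span R K B)"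
    then obtain c a where c: "c \<in> K" and a: "a \<in> B \<rightarrow> K"
      and x: "x = c \<otimes>\<^bsub>R\<^esub> b \<oplus>\<^bsub>R\<^esub> (\<Oplus>\<^bsub>R\<^esub>i\<in>B. a i \<otimes>\<^bsub>R\<^esub> i)"
      by (auto simp: lin_span_def)
    have "(\<Oplus>\<^bsub>R\<^esub>i\<in>B. a i \<otimes>\<^bsub>R\<^esub> i) = (\<Oplus>\<^bsub>R\<^esub>i\<in>B. (a(b := c)) i \<otimes>\<^bsub>R\<^esub> i)"
      using a assms(3-5) by (intro finsum_cong') (auto simp: Pi_iff subset_eq)
    then have "x = (\<Oplus>\<^bsub>R\<^esub>i\<in>insert b B. (a(b := c)) i \<otimes>\<^bsub>R\<^esub> i)"
      using split[of "a(b := c)"] a c x by (simp add: Pi_iff)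
    then show "x \<in> lin_span R K (insert b B)"
      unfolding lin_span_def using a c by (auto intro!: exI[of _ "a(b := c)"])
  qed
qed

lemma lin_span_lepoll:
  assumes "ring R" "infinite K" "finite B" "B \<subseteq> carrier R" "K \<subseteq> carrier R"
  shows "lin_span R K B \<lesssim> K"
  using assms(3,4)
proof (induction B rule: finite_induct)
  case empty
  have "lin_span R K {} = {\<zero>\<^bsub>R\<^esub>}"
    using abelian_monoid.finsum_empty[OF abelian_group.axioms(1)[OF ring.is_abelian_group[OF assms(1)]]]
    by (auto simp: lin_span_def)
  then show ?case using assms(2) by (simp add: finite_lepoll_infinite)
next
  case (insert b B)
  have "|K \<times> K| =o |K|" by (rule card_of_Times_same_infinite[OF assms(2)])
  then have square: "K \<times> K \<approx> K" by (simp add: eqpoll_iff_card_of_ordIso)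
  have "lin_span R K (insert b B) \<lesssim> K \<times> lin_span R K B"
    using lin_span_insert[OF assms(1) insert.hyps insert.prems assms(5)] by (simp add: image_lepoll)
  also have "\<dots> \<lesssim> K \<times> K" using insert by (intro times_lepoll_mono) auto
  also note square
  finally show ?case .
qed

definition coords :: "('a,'m) ring_scheme \<Rightarrow> 'a set \<Rightarrow> 'a set \<Rightarrow> 'a \<Rightarrow> 'a \<Rightarrow> 'a" where
  "coords R K B x = (SOME a. a \<in> B \<rightarrow> K \<and> x = (\<Oplus>\<^bsub>R\<^esub>b\<in>B. a b \<otimes>\<^bsub>R\<^esub> b))"

locale finite_family = divring R for R (structure) +
  fixes K B :: "'a set"
  assumes K: "subdivring K R" and finite_B: "finite B" and B_subset: "B \<subseteq> carrier R"
begin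

lemma K_carrier [simp]: "x \<in> K \<Longrightarrow> x \<in> carrier R" and B_carrier [simp]: "b \<in> B \<Longrightarrow> b \<in> carrier R"
  using subdivring_carrier[OF K] B_subset by auto

lemma coeffs_carrier: "a \<in> B \<rightarrow> K \<Longrightarrow> a \<in> B \<rightarrow> carrier R"
  by (simp add: Pi_iff)

lemma lin_span_carrier [simp]: "x \<in> lin_span R K B \<Longrightarrow> x \<in> carrier R"
  by (auto simp: lin_span_def Pi_iff)

lemma lin_span_add:
  assumes "x \<in> lin_span R K B" "y \<in> lin_span R K B" shows "x \<oplus> y \<in> lin_span R K B"
proof -
  obtain a a' where a: "a \<in> B \<rightarrow> K" "x = (\<Oplus>b\<in>B. a b \<otimes> b)" "a' \<in> B \<rightarrow> K" "y = (\<Oplus>b\<in>B. a' b \<otimes> b)"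
    using assms by (auto simp: lin_span_def)
  then have "x \<oplus> y = (\<Oplus>b\<in>B. (a b \<oplus> a' b) \<otimes> b)"
    using finsum_coeff_add[OF coeffs_carrier coeffs_carrier, of a a' "\<lambda>b. b"] by simp
  then show ?thesis unfolding lin_span_def
    using a(1,3) subdivring_add[OF K] by (auto simp: Pi_iff intro!: exI[of _ "\<lambda>b. a b \<oplus> a' b"])
qed

lemma lin_span_lmult:
  assumes "c \<in> K" "x \<in> lin_span R K B" shows "c \<otimes> x \<in> lin_span R K B"
proof -
  obtain a where a: "a \<in> B \<rightarrow> K" "x = (\<Oplus>b\<in>B. a b \<otimes> b)" using assms by (auto simp: lin_span_def)
  then have "c \<otimes> x = (\<Oplus>b\<in>B. (c \<otimes> a b) \<otimes> b)"
    using finsum_coeff_lmult[OF finite_B _ coeffs_carrier, of c a "\<lambda>b. b"] assms by simp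
  then show ?thesis unfolding lin_span_def
    using a(1) assms(1) subdivring_mult[OF K] by (auto simp: Pi_iff intro!: exI[of _ "\<lambda>b. c \<otimes> a b"])
qed

lemma finsum_single_coeff: "b \<in> B \<Longrightarrow> (\<Oplus>i\<in>B. (if i = b then \<one> else \<zero>) \<otimes> i) = b"
  using finsum_eq_single[OF finite_B, of b "\<lambda>i. (if i = b then \<one> else \<zero>) \<otimes> i"] by simp

lemma single_coeff: "(\<lambda>i. if i = b then \<one> else \<zero>) \<in> B \<rightarrow> K"
  using subdivring_zero[OF K] subdivring_one[OF K] by auto

lemma lin_span_superset: "B \<subseteq> lin_span R K B"
proof
  fix b assume "b \<in> B"
  then show "b \<in> lin_span R K B"
    unfolding lin_span_def using finsum_single_coeff[of b, symmetric] single_coeff[of b] by auto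
qed

lemma lin_span_zero: "\<zero> \<in> lin_span R K B"
proof -
  have "(\<Oplus>b\<in>B. \<zero> \<otimes> b) = \<zero>" by (intro add.finprod_one_eqI) auto
  then show ?thesis unfolding lin_span_def
    using subdivring_zero[OF K] by (auto intro!: exI[of _ "\<lambda>_. \<zero>"])
qed

lemma lin_span_if_dependent:
  assumes e: "e \<in> carrier R" "e \<notin> B" and indep: "lin_indep R K B" "\<not> lin_indep R K (insert e B)"
  shows "e \<in> lin_span R K B"
proof -
  obtain a where a: "a \<in> insert e B \<rightarrow> K" "(\<Oplus>b\<in>insert e B. a b \<otimes> b) = \<zero>" "\<exists>b\<in>insert e B. a b \<noteq> \<zero>"
    using indep(2) unfolding lin_indep_def by blast
  have ae: "a e \<in> K" and aB: "a \<in> B \<rightarrow> K" using a(1) by auto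
  define s where "s = (\<Oplus>b\<in>B. a b \<otimes> b)"
  have s: "s \<in> lin_span R K B" using aB by (auto simp: s_def lin_span_def)
  have "(\<Oplus>b\<in>insert e B. a b \<otimes> b) = a e \<otimes> e \<oplus> s" unfolding s_def
    using e aB ae finite_B by (intro finsum_insert) (auto simp: Pi_iff)
  then have sum: "a e \<otimes> e \<oplus> s = \<zero>" using a(2) by simp
  have nonzero: "a e \<noteq> \<zero>"
  proof
    assume "a e = \<zero>"
    then have "s = \<zero>" using sum s e by simp
    then have "\<forall>b\<in>B. a b = \<zero>" using indep(1) aB unfolding lin_indep_def s_def by blast
    then show False using a(3) \<open>a e = \<zero>\<close> by auto
  qed
  have "\<ominus> s = a e \<otimes> e" using sum s e ae by (metis K_carrier a_comm lin_span_carrier m_closed minus_equality)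
  then have "inv (a e) \<otimes> (\<ominus> s) = e" using nonzero e ae by (simp add: m_assoc[symmetric])
  then have "e = (\<ominus> (inv (a e))) \<otimes> s" using nonzero s ae by (simp add: l_minus r_minus)
  moreover have "\<ominus> (inv (a e)) \<in> K" using subdivring_inv[OF K] subdivring_uminus[OF K] nonzero ae by blast
  ultimately show ?thesis using lin_span_lmult[OF _ s] by metis
qed

lemma
  assumes "x \<in> lin_span R K B"
  shows coords_mem: "coords R K B x \<in> B \<rightarrow> K"
    and coords_sum: "(\<Oplus>b\<in>B. coords R K B x b \<otimes> b) = x"
proof -
  have "\<exists>a. a \<in> B \<rightarrow> K \<and> x = (\<Oplus>b\<in>B. a b \<otimes> b)" using assms by (auto simp: lin_span_def)
  from someI_ex[OF this] show "coords R K B x \<in> B \<rightarrow> K" "(\<Oplus>b\<in>B. coords R K B x b \<otimes> b) = x"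
    by (auto simp: coords_def)
qed

lemma coords_in_K: "x \<in> lin_span R K B \<Longrightarrow> b \<in> B \<Longrightarrow> coords R K B x b \<in> K"
  using coords_mem by auto

lemma dependent_if_card_gt:
  assumes J: "finite J" "card B < card J" and v: "v \<in> J \<rightarrow> lin_span R K B"
  shows "\<exists>c \<in> J \<rightarrow> K. (\<exists>j\<in>J. c j \<noteq> \<zero>) \<and> (\<Oplus>j\<in>J. c j \<otimes> v j) = \<zero>"
proof -
  let ?a = "\<lambda>b j. coords R K B (v j) b"
  have a: "?a b j \<in> K" if "b \<in> B" "j \<in> J" for b j using coords_in_K v that by auto
  obtain c where c: "c \<in> J \<rightarrow> K" "\<exists>j\<in>J. c j \<noteq> \<zero>" and sol: "\<And>b. b \<in> B \<Longrightarrow> (\<Oplus>j\<in>J. c j \<otimes> ?a b j) = \<zero>"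
    using homogeneous_system_subdivring[OF K finite_B J, of ?a] a by blast
  have cK: "c j \<in> K" if "j \<in> J" for j using c(1) that by auto
  have "(\<Oplus>j\<in>J. c j \<otimes> v j) = (\<Oplus>j\<in>J. \<Oplus>b\<in>B. (c j \<otimes> ?a b j) \<otimes> b)"
  proof (rule finsum_cong')
    fix j assume j: "j \<in> J"
    then have "(\<Oplus>b\<in>B. (c j \<otimes> ?a b j) \<otimes> b) = c j \<otimes> (\<Oplus>b\<in>B. ?a b j \<otimes> b)"
      using cK a by (intro finsum_coeff_lmult finite_B) auto
    then show "c j \<otimes> v j = (\<Oplus>b\<in>B. (c j \<otimes> ?a b j) \<otimes> b)" using coords_sum[OF funcset_mem[OF v j]] by simp
  qed (use cK a in auto)
  also have "\<dots> = (\<Oplus>b\<in>B. \<Oplus>j\<in>J. (c j \<otimes> ?a b j) \<otimes> b)"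
    using cK a J finite_B by (intro finsum_swap) auto
  also have "\<dots> = (\<Oplus>b\<in>B. (\<Oplus>j\<in>J. c j \<otimes> ?a b j) \<otimes> b)"
    using cK a J by (intro finsum_cong') (auto simp: finsum_ldistr Pi_def)
  also have "\<dots> = \<zero>" using sol by (intro add.finprod_one_eqI) auto
  finally show ?thesis using c by blast
qed

end

lemma (in divring) maximal_lin_indep:
  assumes K: "subdivring K R" and V: "V \<subseteq> carrier R"
    and B\<^sub>0: "finite B\<^sub>0" "B\<^sub>0 \<subseteq> V" "lin_indep R K B\<^sub>0"
    and bound: "\<And>B. finite B \<Longrightarrow> B \<subseteq> V \<Longrightarrow> lin_indep R K B \<Longrightarrow> card B \<le> N"
  obtains B where "finite B" "B\<^sub>0 \<subseteq> B" "B \<subseteq> V" "lin_indep R K B" "V \<subseteq> lin_span R K B"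
proof -
  let ?P = "\<lambda>B. finite B \<and> B\<^sub>0 \<subseteq> B \<and> B \<subseteq> V \<and> lin_indep R K B"
  have "\<forall>B. ?P B \<longrightarrow> card B < Suc N" using bound by (simp add: less_Suc_eq_le)
  then have "\<exists>B. ?P B \<and> (\<forall>C. ?P C \<longrightarrow> card C \<le> card B)"
    by (rule ex_has_greatest_nat[of ?P B\<^sub>0, rotated]) (use B\<^sub>0 in simp)
  then obtain B where B: "?P B" and maximal: "\<And>C. ?P C \<Longrightarrow> card C \<le> card B" by blast
  interpret finite_family R K B by unfold_locales (use K B V in auto)
  have "x \<in> lin_span R K B" if x: "x \<in> V" for x
  proof (cases "x \<in> B")
    case True then show ?thesis using lin_span_superset by blast
  next
    case False
    then have "\<not> lin_indep R K (insert x B)" using maximal[of "insert x B"] B x by auto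
    then show ?thesis using lin_span_if_dependent B x V False by blast
  qed
  then show thesis using that B by blast
qed

locale finite_basis = finite_family +
  assumes indep: "lin_indep R K B"
begin

lemma coords_unique:
  assumes a: "a \<in> B \<rightarrow> K" "x = (\<Oplus>b\<in>B. a b \<otimes> b)" and b: "b \<in> B"
  shows "coords R K B x b = a b"
proof -
  have x: "x \<in> lin_span R K B" using a by (auto simp: lin_span_def)
  let ?c = "coords R K B x"
  have "(\<Oplus>b\<in>B. (?c b \<ominus> a b) \<otimes> b) = x \<ominus> x"
    using finsum_coeff_minus[OF finite_B coeffs_carrier[OF coords_mem[OF x]] coeffs_carrier[OF a(1)], of "\<lambda>b. b"]
      coords_sum[OF x] a(2) by simp
  moreover have "(\<lambda>b. ?c b \<ominus> a b) \<in> B \<rightarrow> K"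
    using coords_in_K[OF x] a(1) subdivring_minus[OF K] by (auto simp: Pi_iff)
  ultimately have "?c b \<ominus> a b = \<zero>"
    using indep x b unfolding lin_indep_def by (auto simp: a_minus_def r_neg)
  then show ?thesis using coords_in_K[OF x b] a(1) b by (auto simp: Pi_iff)
qed

lemma coords_add:
  assumes "x \<in> lin_span R K B" "y \<in> lin_span R K B" "b \<in> B"
  shows "coords R K B (x \<oplus> y) b = coords R K B x b \<oplus> coords R K B y b"
proof (rule coords_unique[OF _ _ assms(3)])
  show "x \<oplus> y = (\<Oplus>b\<in>B. (coords R K B x b \<oplus> coords R K B y b) \<otimes> b)"
    using finsum_coeff_add[OF coeffs_carrier[OF coords_mem] coeffs_carrier[OF coords_mem]] assms
    by (simp add: coords_sum)
qed (use coords_in_K assms subdivring_add[OF K] in auto)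

lemma coords_lmult:
  assumes "c \<in> K" "x \<in> lin_span R K B" "b \<in> B"
  shows "coords R K B (c \<otimes> x) b = c \<otimes> coords R K B x b"
proof (rule coords_unique[OF _ _ assms(3)])
  show "c \<otimes> x = (\<Oplus>b\<in>B. (c \<otimes> coords R K B x b) \<otimes> b)"
    using finsum_coeff_lmult[OF finite_B _ coeffs_carrier[OF coords_mem]] assms
    by (simp add: coords_sum)
qed (use coords_in_K assms subdivring_mult[OF K] in auto)

lemma coords_self: "b \<in> B \<Longrightarrow> coords R K B b b = \<one>"
  using coords_unique[OF single_coeff finsum_single_coeff[symmetric]] by simp

end

lemma (in divring) linear_functional_exists:
  assumes K: "subdivring K R" and V: "finite V" "V \<subseteq> carrier R" "v \<in> V" "v \<noteq> \<zero>"
  obtains D \<phi> where "V \<subseteq> D" "D \<subseteq> carrier R" "\<zero> \<in> D" "\<And>x y. x \<in> D \<Longrightarrow> y \<in> D \<Longrightarrow> x \<oplus> y \<in> D"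
    "\<And>c x. c \<in> K \<Longrightarrow> x \<in> D \<Longrightarrow> c \<otimes> x \<in> D" "\<phi> v = \<one>" "\<And>x. x \<in> D \<Longrightarrow> \<phi> x \<in> K"
    "\<And>x y. x \<in> D \<Longrightarrow> y \<in> D \<Longrightarrow> \<phi> (x \<oplus> y) = \<phi> x \<oplus> \<phi> y"
    "\<And>c x. c \<in> K \<Longrightarrow> x \<in> D \<Longrightarrow> \<phi> (c \<otimes> x) = c \<otimes> \<phi> x"
proof -
  have "lin_indep R K {v}"
    unfolding lin_indep_def using V subdivring_carrier[OF K] by (auto simp: finsum_insert Pi_iff)
  moreover have "card B \<le> card V" if "B \<subseteq> V" for B using that V(1) by (rule card_mono[rotated])
  ultimately obtain B where B: "finite B" "{v} \<subseteq> B" "B \<subseteq> V" "lin_indep R K B" "V \<subseteq> lin_span R K B"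
    using maximal_lin_indep[OF K V(2), of "{v}" "card V"] V(3) by auto
  interpret finite_basis R K B by unfold_locales (use K B V in auto)
  show thesis
    by (rule that[of "lin_span R K B" "\<lambda>x. coords R K B x v"])
       (use B lin_span_zero lin_span_add lin_span_lmult coords_self coords_in_K coords_add coords_lmult
         in auto)
qed

section \<open>Independence of automorphisms\<close>

context divring
begin

lemma relation_hom_image:
  assumes g: "g \<in> ring_hom R R" and B: "finite B" "B \<subseteq> carrier R" "x \<in> B \<rightarrow> carrier R" "\<chi> \<in> B \<rightarrow> carrier R"
    and \<chi>': "\<And>y. y \<in> carrier R \<Longrightarrow> \<chi>' y = g (\<chi> y)" and rel: "(\<Oplus>b\<in>B. x b \<otimes> \<chi> b) = \<zero>"
  shows "(\<Oplus>b\<in>B. g (x b) \<otimes> \<chi>' b) = \<zero>"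
proof -
  interpret g: ring_hom_ring R R g by (rule ring_hom_ringI2[OF ring_axioms ring_axioms g])
  have "(\<Oplus>b\<in>B. g (x b) \<otimes> \<chi>' b) = (\<Oplus>b\<in>B. g (x b \<otimes> \<chi> b))"
    using B(2-) \<chi>' by (intro finsum_cong') (auto simp: Pi_iff subset_eq)
  also have "\<dots> = g (\<Oplus>b\<in>B. x b \<otimes> \<chi> b)"
    using B by (intro ring_hom_finsum[OF ring_axioms ring_axioms g, symmetric]) auto
  finally show ?thesis using rel by simp
qed

text \<open>A shortest relation normalised to contain the coefficient \<open>\<one>\<close> is fixed by \<open>G\<close>, since applying
  \<open>g \<in> G\<close> and subtracting shortens it.\<close>

lemma not_lin_indep_over_fixed:
  assumes I: "finite I" "i\<^sub>0 \<in> I" "\<And>x. x \<in> carrier R \<Longrightarrow> \<chi> i\<^sub>0 x = x"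
    and \<chi>: "\<And>i x. i \<in> I \<Longrightarrow> x \<in> carrier R \<Longrightarrow> \<chi> i x \<in> carrier R"
    and G: "\<And>g. g \<in> G \<Longrightarrow> g \<in> ring_hom R R"
    and permute: "\<And>g i. g \<in> G \<Longrightarrow> i \<in> I \<Longrightarrow> \<exists>i'\<in>I. \<forall>x\<in>carrier R. \<chi> i x = g (\<chi> i' x)"
    and B: "finite B" "B \<subseteq> carrier R" "card I < card B"
  shows "\<not> lin_indep R {x \<in> carrier R. \<forall>g\<in>G. g x = x} B"
proof -
  define W where "W = {x \<in> B \<rightarrow> carrier R. \<forall>i\<in>I. (\<Oplus>b\<in>B. x b \<otimes> \<chi> i b) = \<zero>}"
  have \<chi>B: "\<chi> i \<in> B \<rightarrow> carrier R" if "i \<in> I" for i using \<chi> that B(2) by auto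
  have scale: "(\<lambda>b. c \<otimes> x b) \<in> W" if "x \<in> W" "c \<in> carrier R" for x c
    using that finsum_coeff_lmult[OF B(1) that(2) _ \<chi>B, of x] by (auto simp: W_def)
  obtain x where x: "x \<in> W" "\<exists>b\<in>B. x b \<noteq> \<zero>"
    using homogeneous_system[OF I(1) B(1,3), of \<chi>] \<chi>B by (auto simp: W_def Pi_iff)
  have W: "W \<subseteq> B \<rightarrow> carrier R" by (auto simp: W_def)
  then obtain y b\<^sub>0 where y: "y \<in> W" "b\<^sub>0 \<in> B" "y b\<^sub>0 = \<one>"
    and minimal: "\<And>z. z \<in> W \<Longrightarrow> z b\<^sub>0 = \<zero> \<Longrightarrow> (\<And>b. b \<in> B \<Longrightarrow> y b = \<zero> \<Longrightarrow> z b = \<zero>) \<Longrightarrow> \<forall>b\<in>B. z b = \<zero>"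
    using minimal_support_vector[OF B(1) W scale x] by blast
  have yc: "y \<in> B \<rightarrow> carrier R" and y_rel: "\<And>i. i \<in> I \<Longrightarrow> (\<Oplus>b\<in>B. y b \<otimes> \<chi> i b) = \<zero>"
    using y(1) by (auto simp: W_def)
  have "g (y b) = y b" if g: "g \<in> G" and b: "b \<in> B" for g b
  proof -
    interpret g: ring_hom_ring R R g by (rule ring_hom_ringI2[OF ring_axioms ring_axioms G[OF g]])
    have gy: "(\<lambda>b. g (y b)) \<in> B \<rightarrow> carrier R" using yc by (simp add: Pi_iff)
    have "(\<Oplus>b\<in>B. g (y b) \<otimes> \<chi> i b) = \<zero>" if i: "i \<in> I" for i
    proof -
      obtain i' where i': "i' \<in> I" "\<And>x. x \<in> carrier R \<Longrightarrow> \<chi> i x = g (\<chi> i' x)" using permute[OF g i] by blast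
      show ?thesis by (rule relation_hom_image[OF G[OF g] B(1,2) yc \<chi>B[OF i'(1)] i'(2) y_rel[OF i'(1)]])
    qed
    then have "(\<Oplus>b\<in>B. (y b \<ominus> g (y b)) \<otimes> \<chi> i b) = \<zero>" if "i \<in> I" for i
      using finsum_coeff_minus[OF B(1) yc gy \<chi>B[OF that]] y_rel[OF that] that by simp
    moreover have "(\<lambda>b. y b \<ominus> g (y b)) \<in> B \<rightarrow> carrier R" using yc gy by auto
    ultimately have "(\<lambda>b. y b \<ominus> g (y b)) \<in> W" by (simp add: W_def)
    then have "y b \<ominus> g (y b) = \<zero>" using minimal[of "\<lambda>b. y b \<ominus> g (y b)"] y(3) b by simp
    then show ?thesis using yc gy b by (auto simp: Pi_iff)
  qed
  then have fixed: "y \<in> B \<rightarrow> {x \<in> carrier R. \<forall>g\<in>G. g x = x}" using yc by auto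
  have "(\<Oplus>b\<in>B. y b \<otimes> \<chi> i\<^sub>0 b) = (\<Oplus>b\<in>B. y b \<otimes> b)"
    using yc B(2) I(3) by (intro finsum_cong') (auto simp: Pi_iff subset_eq)
  then have rel: "(\<Oplus>b\<in>B. y b \<otimes> b) = \<zero>" using y_rel[OF I(2)] by simp
  show ?thesis
  proof
    assume "lin_indep R {x \<in> carrier R. \<forall>g\<in>G. g x = x} B"
    then have "y b\<^sub>0 = \<zero>" using fixed rel y(2) unfolding lin_indep_def by blast
    then show False using y(3) by simp
  qed
qed

end

definition conj_on :: "('a,'m) ring_scheme \<Rightarrow> 'b set \<Rightarrow> ('b \<Rightarrow> 'a) \<Rightarrow> ('b \<Rightarrow> 'a) \<Rightarrow> bool" where
  "conj_on R D f g \<longleftrightarrow> (\<exists>c\<in>carrier R. c \<noteq> \<zero>\<^bsub>R\<^esub> \<and> (\<forall>x\<in>D. f x \<otimes>\<^bsub>R\<^esub> c = c \<otimes>\<^bsub>R\<^esub> g x))"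

context divring
begin

lemma conj_on_central_imp_eq:
  assumes "conj_on R D f g" "x \<in> D" "f x \<in> carrier R" "g x \<in> carrier R"
    and "\<And>c. c \<in> carrier R \<Longrightarrow> f x \<otimes> c = c \<otimes> f x"
  shows "f x = g x"
  using assms mult_left_cancel unfolding conj_on_def by metis

lemma conj_on_sym:
  assumes "conj_on R D f g" "f \<in> D \<rightarrow> carrier R" "g \<in> D \<rightarrow> carrier R"
  shows "conj_on R D g f"
proof -
  obtain c where c: "c \<in> carrier R" "c \<noteq> \<zero>" "\<And>x. x \<in> D \<Longrightarrow> f x \<otimes> c = c \<otimes> g x"
    using assms(1) unfolding conj_on_def by blast
  have "g x \<otimes> inv c = inv c \<otimes> f x" if "x \<in> D" for x
  proof -
    have "g x \<otimes> inv c = inv c \<otimes> (c \<otimes> g x) \<otimes> inv c"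
      using c that assms(3) by (simp add: m_assoc[symmetric] Pi_iff)
    also have "\<dots> = inv c \<otimes> (f x \<otimes> c) \<otimes> inv c" using c(3)[OF that] by simp
    also have "\<dots> = inv c \<otimes> f x" using c(1,2) that assms(2) by (simp add: m_assoc Pi_iff)
    finally show ?thesis .
  qed
  then show ?thesis unfolding conj_on_def using c by (auto intro!: bexI[of _ "inv c"])
qed

lemma dedekind_conj_on:
  assumes J: "finite J"
    and D: "\<one> \<in> D" "\<And>x y. x \<in> D \<Longrightarrow> y \<in> D \<Longrightarrow> x \<otimes> y \<in> D"
    and \<chi>: "\<And>j x. j \<in> J \<Longrightarrow> x \<in> D \<Longrightarrow> \<chi> j x \<in> carrier R"
    and \<chi>_one: "\<And>j. j \<in> J \<Longrightarrow> \<chi> j \<one> = \<one>"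
    and \<chi>_mult: "\<And>j x y. j \<in> J \<Longrightarrow> x \<in> D \<Longrightarrow> y \<in> D \<Longrightarrow> \<chi> j (x \<otimes> y) = \<chi> j x \<otimes> \<chi> j y"
    and a: "a \<in> J \<rightarrow> carrier R" "\<exists>j\<in>J. a j \<noteq> \<zero>" "\<And>x. x \<in> D \<Longrightarrow> (\<Oplus>j\<in>J. \<chi> j x \<otimes> a j) = \<zero>"
  shows "\<exists>i\<in>J. \<exists>j\<in>J. i \<noteq> j \<and> conj_on R D (\<chi> i) (\<chi> j)"
proof -
  define W where "W = {a \<in> J \<rightarrow> carrier R. \<forall>x\<in>D. (\<Oplus>j\<in>J. \<chi> j x \<otimes> a j) = \<zero>}"
  interpret O: divring "opp_ring R" by (rule opp_ring_divring)
  have scale: "(\<lambda>j. a j \<otimes> c) \<in> W" if "a \<in> W" "c \<in> carrier R" for a c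
    using that \<chi> O.finsum_coeff_lmult[OF J, of c a] by (auto simp: W_def Pi_iff)
  have "W \<subseteq> J \<rightarrow> carrier (opp_ring R)" "a \<in> W" using a by (auto simp: W_def)
  then obtain y j\<^sub>0 where y: "y \<in> W" "j\<^sub>0 \<in> J" "y j\<^sub>0 = \<one>"
    and minimal: "\<And>z. z \<in> W \<Longrightarrow> z j\<^sub>0 = \<zero> \<Longrightarrow> (\<And>j. j \<in> J \<Longrightarrow> y j = \<zero> \<Longrightarrow> z j = \<zero>) \<Longrightarrow> \<forall>j\<in>J. z j = \<zero>"
    using O.minimal_support_vector[OF J, of W a] scale a(2) unfolding opp_ring_simps by blast
  have yc: "y j \<in> carrier R" if "j \<in> J" for j using y(1) that by (auto simp: W_def)
  have y_rel: "(\<Oplus>j\<in>J. \<chi> j x \<otimes> y j) = \<zero>" if "x \<in> D" for x using y(1) that by (auto simp: W_def)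
  have conj: "\<chi> j v \<otimes> y j = y j \<otimes> \<chi> j\<^sub>0 v" if v: "v \<in> D" and j: "j \<in> J" for v j
  proof -
    define z where "z j = \<chi> j v \<otimes> y j \<ominus> y j \<otimes> \<chi> j\<^sub>0 v" for j
    have "(\<Oplus>j\<in>J. \<chi> j u \<otimes> z j) = \<zero>" if u: "u \<in> D" for u
    proof -
      have "(\<Oplus>j\<in>J. \<chi> j u \<otimes> z j) = (\<Oplus>j\<in>J. \<chi> j (u \<otimes> v) \<otimes> y j \<ominus> (\<chi> j u \<otimes> y j) \<otimes> \<chi> j\<^sub>0 v)"
        using yc \<chi> y(2) v u \<chi>_mult by (intro finsum_cong') (auto simp: z_def a_minus_def r_distr r_minus m_assoc)
      also have "\<dots> = (\<Oplus>j\<in>J. \<chi> j (u \<otimes> v) \<otimes> y j) \<ominus> (\<Oplus>j\<in>J. (\<chi> j u \<otimes> y j) \<otimes> \<chi> j\<^sub>0 v)"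
        using yc \<chi> y(2) v u D J by (intro finsum_minus) auto
      also have "(\<Oplus>j\<in>J. (\<chi> j u \<otimes> y j) \<otimes> \<chi> j\<^sub>0 v) = (\<Oplus>j\<in>J. \<chi> j u \<otimes> y j) \<otimes> \<chi> j\<^sub>0 v"
        using yc \<chi> y(2) v u J by (intro finsum_ldistr[symmetric]) auto
      finally show ?thesis using y_rel[OF u] y_rel[OF D(2)[OF u v]] \<chi> y(2) v by simp
    qed
    moreover have "z \<in> J \<rightarrow> carrier R" using yc \<chi> y(2) v by (auto simp: z_def)
    ultimately have "z \<in> W" by (simp add: W_def)
    moreover have "z j\<^sub>0 = \<zero>" using y(2,3) \<chi> v by (simp add: z_def)
    moreover have "z j = \<zero>" if "j \<in> J" "y j = \<zero>" for j using that \<chi> y(2) v by (simp add: z_def)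
    ultimately have "z j = \<zero>" using minimal j by blast
    then show ?thesis using yc \<chi> y(2) v j by (simp add: z_def)
  qed
  have "\<exists>j\<in>J. j \<noteq> j\<^sub>0 \<and> y j \<noteq> \<zero>"
  proof (rule ccontr)
    assume "\<not> ?thesis"
    then have "(\<Oplus>j\<in>J. \<chi> j \<one> \<otimes> y j) = \<chi> j\<^sub>0 \<one> \<otimes> y j\<^sub>0"
      using J y(2) yc \<chi> D by (intro finsum_eq_single) auto
    then show False using y_rel[OF D(1)] \<chi>_one[OF y(2)] y(3) by simp
  qed
  then show ?thesis using conj yc y(2) unfolding conj_on_def by blast
qed

lemma conj_on_if_card_gt:
  assumes J: "finite J" and B: "finite B" "B \<subseteq> D" "card B < card J"
    and D: "subring D R" and K: "K \<subseteq> D" and span: "D \<subseteq> lin_span R K B"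
    and \<chi>: "\<And>j. j \<in> J \<Longrightarrow> \<chi> j \<in> ring_hom (R\<lparr>carrier := D\<rparr>) R"
    and \<chi>_fixed: "\<And>j x. j \<in> J \<Longrightarrow> x \<in> K \<Longrightarrow> \<chi> j x = x"
  shows "\<exists>i\<in>J. \<exists>j\<in>J. i \<noteq> j \<and> conj_on R D (\<chi> i) (\<chi> j)"
proof -
  note D_closed = subringE[OF D]
  have \<chi>D: "\<chi> j x \<in> carrier R" if "j \<in> J" "x \<in> D" for j x
    using ring_hom_closed[OF \<chi>[OF that(1)]] that by auto
  have \<chi>_mult: "\<chi> j (x \<otimes> y) = \<chi> j x \<otimes> \<chi> j y" if "j \<in> J" "x \<in> D" "y \<in> D" for j x y
    using ring_hom_mult[OF \<chi>[OF that(1)]] that by auto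
  obtain a where a: "a \<in> J \<rightarrow> carrier R" "\<exists>j\<in>J. a j \<noteq> \<zero>" "\<And>b. b \<in> B \<Longrightarrow> (\<Oplus>j\<in>J. \<chi> j b \<otimes> a j) = \<zero>"
    using homogeneous_system_right[OF B(1) J B(3), of "\<lambda>b j. \<chi> j b"] \<chi>D B(2) by (meson subsetD)
  have ac: "a j \<in> carrier R" if "j \<in> J" for j using a(1) that by auto
  have "(\<Oplus>j\<in>J. \<chi> j x \<otimes> a j) = \<zero>" if "x \<in> D" for x
  proof -
    obtain c where c: "c \<in> B \<rightarrow> K" "x = (\<Oplus>b\<in>B. c b \<otimes> b)" using span \<open>x \<in> D\<close> by (auto simp: lin_span_def)
    have cD: "c b \<in> K" "c b \<in> D" "c b \<in> carrier R" "b \<in> D" if "b \<in> B" for b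
      using c(1) that K B D_closed(1) by auto
    have "\<chi> j x \<otimes> a j = (\<Oplus>b\<in>B. c b \<otimes> (\<chi> j b \<otimes> a j))" if j: "j \<in> J" for j
    proof -
      have "\<chi> j x = (\<Oplus>b\<in>B. \<chi> j (c b \<otimes> b))" unfolding c(2)
        by (rule additive_finsum[OF ring_axioms B(1), of _ D])
           (use cD D_closed \<chi>D ring_hom_add[OF \<chi>[OF j]] j in auto)
      also have "\<dots> = (\<Oplus>b\<in>B. c b \<otimes> \<chi> j b)"
        using cD \<chi>D \<chi>_mult \<chi>_fixed j by (intro finsum_cong') auto
      finally have "\<chi> j x \<otimes> a j = (\<Oplus>b\<in>B. c b \<otimes> \<chi> j b \<otimes> a j)"
        using cD \<chi>D j ac B by (simp add: finsum_ldistr Pi_def)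
      also have "\<dots> = (\<Oplus>b\<in>B. c b \<otimes> (\<chi> j b \<otimes> a j))"
        using cD \<chi>D ac j by (intro finsum_cong') (auto simp: m_assoc)
      finally show ?thesis .
    qed
    then have "(\<Oplus>j\<in>J. \<chi> j x \<otimes> a j) = (\<Oplus>j\<in>J. \<Oplus>b\<in>B. c b \<otimes> (\<chi> j b \<otimes> a j))"
      using cD \<chi>D ac \<open>x \<in> D\<close> by (intro finsum_cong') auto
    also have "\<dots> = (\<Oplus>b\<in>B. \<Oplus>j\<in>J. c b \<otimes> (\<chi> j b \<otimes> a j))"
      using J B cD \<chi>D ac by (intro finsum_swap) auto
    also have "\<dots> = (\<Oplus>b\<in>B. c b \<otimes> (\<Oplus>j\<in>J. \<chi> j b \<otimes> a j))"
      using J B cD \<chi>D ac by (intro finsum_cong') (auto simp: finsum_rdistr Pi_def)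
    also have "\<dots> = \<zero>" using a(3) cD by (intro add.finprod_one_eqI) auto
    finally show ?thesis .
  qed
  then show ?thesis
    using \<chi>D \<chi>_mult ring_hom_one[OF \<chi>] a(1,2)
    by (intro dedekind_conj_on[OF J D_closed(3,6), of \<chi> a]) auto
qed

end

section \<open>Cyclic outer extensions\<close>

lemma ring_iso_funpow: "s \<in> ring_iso R R \<Longrightarrow> (s ^^ i) \<in> ring_iso R R"
  by (induction i) (auto intro: ring_iso_set_trans simp: id_def[symmetric] ring_iso_set_refl)

lemma funpow_mod_period:
  assumes "\<And>x. x \<in> A \<Longrightarrow> s x \<in> A" "\<And>x. x \<in> A \<Longrightarrow> (s ^^ e) x = x" "x \<in> A"
  shows "(s ^^ (m mod e)) x = (s ^^ m) x"
proof -
  have "(s ^^ (q * e)) x = x" for q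
    by (induction q) (use assms in \<open>auto simp: funpow_add\<close>)
  then have "(s ^^ (m mod e)) x = (s ^^ (m mod e)) ((s ^^ (m div e * e)) x)" by simp
  also have "\<dots> = (s ^^ m) x" by (metis comp_apply funpow_add mod_div_mult_eq)
  finally show ?thesis .
qed

locale cyclic_outer_extension = divring R for R (structure) +
  fixes K s B
  assumes s_iso: "s \<in> ring_iso R R" and fixed: "{x \<in> carrier R. s x = x} = K" and outer: "outer R K"
    and B: "finite B" "B \<subseteq> carrier R" "lin_indep R K B" "carrier R \<subseteq> lin_span R K B"
begin

lemma funpow_iso: "(s ^^ i) \<in> ring_iso R R"
  by (rule ring_iso_funpow[OF s_iso])

lemma funpow_closed: "x \<in> carrier R \<Longrightarrow> (s ^^ i) x \<in> carrier R"
  using ring_iso_memE(1)[OF funpow_iso] .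

lemma funpow_fixed: "x \<in> K \<Longrightarrow> (s ^^ i) x = x"
  by (induction i) (use fixed in auto)

lemma conj_on_funpow_imp_eq:
  assumes "conj_on R (carrier R) (s ^^ i) (s ^^ j)" "x \<in> carrier R"
  shows "(s ^^ i) x = (s ^^ j) x"
proof -
  obtain c where c: "c \<in> carrier R" "c \<noteq> \<zero>" "\<And>y. y \<in> carrier R \<Longrightarrow> (s ^^ i) y \<otimes> c = c \<otimes> (s ^^ j) y"
    using assms(1) unfolding conj_on_def by blast
  have K: "K \<subseteq> carrier R" using fixed by auto
  have "c \<otimes> y = y \<otimes> c" if "y \<in> K" for y using c(3)[of y] funpow_fixed that K by auto
  then have "c \<otimes> (s ^^ i) x = (s ^^ i) x \<otimes> c"
    using outer outer_iff_commute[OF K] c(1) funpow_closed[OF assms(2)] by blast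
  then have "c \<otimes> (s ^^ i) x = c \<otimes> (s ^^ j) x" using c(3)[OF assms(2)] by simp
  then show ?thesis using mult_left_cancel c funpow_closed[OF assms(2)] by blast
qed

lemma period_exists: "\<exists>n. 0 < n \<and> n \<le> card B \<and> (\<forall>x\<in>carrier R. (s ^^ n) x = x)"
proof -
  have "\<exists>i\<in>{..card B}. \<exists>j\<in>{..card B}. i \<noteq> j \<and> conj_on R (carrier R) (s ^^ i) (s ^^ j)"
    using conj_on_if_card_gt[OF _ B(1,2) _ carrier_is_subring _ B(4), of "{..card B}" "\<lambda>i. s ^^ i"]
      funpow_iso funpow_fixed fixed by (auto simp: ring_iso_def)
  then obtain i j where ij: "i < j" "j \<le> card B" and eq: "\<forall>x\<in>carrier R. (s ^^ i) x = (s ^^ j) x"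
    by (metis atMost_iff linorder_neq_iff conj_on_funpow_imp_eq)
  have "(s ^^ (j - i)) x = x" if "x \<in> carrier R" for x
  proof -
    have "(s ^^ i) ` carrier R = carrier R"
      using ring_iso_memE(5)[OF funpow_iso] by (simp add: bij_betw_def)
    then obtain y where y: "y \<in> carrier R" "x = (s ^^ i) y" using \<open>x \<in> carrier R\<close> by (metis imageE)
    have "s ^^ j = (s ^^ (j - i)) \<circ> (s ^^ i)"
      using ij(1) by (metis funpow_add le_add_diff_inverse2 less_imp_le)
    then show ?thesis using eq y by simp
  qed
  then show ?thesis using ij by (intro exI[of _ "j - i"]) auto
qed

lemma card_basis_le_period:
  assumes e: "0 < e" "\<And>x. x \<in> carrier R \<Longrightarrow> (s ^^ e) x = x"
  shows "card B \<le> e"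
proof (rule ccontr)
  assume "\<not> card B \<le> e"
  have permute: "\<exists>i'\<in>{..<e}. \<forall>x\<in>carrier R. (s ^^ i) x = s ((s ^^ i') x)" if "i \<in> {..<e}" for i
  proof (cases i)
    case 0
    have "s ((s ^^ (e - 1)) x) = (s ^^ e) x" for x using e(1) by (cases e) auto
    then show ?thesis using 0 e by (intro bexI[of _ "e - 1"]) auto
  next
    case (Suc i') then show ?thesis using that by (intro bexI[of _ i']) auto
  qed
  have "\<not> lin_indep R {x \<in> carrier R. \<forall>g\<in>{s}. g x = x} B"
    by (rule not_lin_indep_over_fixed[of "{..<e}" 0 "\<lambda>i. s ^^ i"])
       (use e(1) funpow_closed permute B \<open>\<not> card B \<le> e\<close> s_iso in \<open>auto simp: ring_iso_def\<close>)
  then show False using B(3) fixed by simp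
qed

lemma card_basis_pos: "0 < card B"
  and funpow_card_basis: "x \<in> carrier R \<Longrightarrow> (s ^^ card B) x = x"
  using period_exists card_basis_le_period by (metis le_antisym less_le_trans)+

lemma card_basis_dvd_period:
  assumes m: "\<And>x. x \<in> carrier R \<Longrightarrow> (s ^^ m) x = x"
  shows "card B dvd m"
proof (rule ccontr)
  assume "\<not> ?thesis"
  moreover have "(s ^^ (m mod card B)) x = x" if "x \<in> carrier R" for x
    using funpow_mod_period[of "carrier R" s "card B" x m] funpow_closed[of _ 1] funpow_card_basis m that by simp
  ultimately have "card B \<le> m mod card B" by (intro card_basis_le_period) (auto simp: dvd_eq_mod_eq_0)
  then show False using card_basis_pos mod_less_divisor[of "card B" m] by linarith
qed

end

lemma compatible_exponents_exist:
  fixes d :: "nat \<Rightarrow> nat"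
  assumes pos: "\<And>n. 0 < d n" and dvd: "\<And>n. d n dvd d (Suc n)"
    and coprime: "\<And>n. coprime (d (Suc n) div d n) (d n)"
  shows "\<exists>l :: nat \<Rightarrow> nat. \<forall>n. 0 < l n \<and> l n dvd l (Suc n) \<and>
            d n dvd (l (Suc n) div l n - 1) \<and> d n dvd l n"
proof -
  have "\<exists>r>0. d n dvd (r - 1) \<and> (d (Suc n) div d n) dvd r" for n
  proof -
    let ?e = "d (Suc n) div d n"
    have "?e \<noteq> 0" using pos[of "Suc n"] dvd[of n] by (simp add: dvd_div_eq_0_iff)
    then obtain x y where "?e * x = d n * y + 1"
      using bezout_nat[of ?e "d n"] coprime[of n] by (auto simp: coprime_iff_gcd_eq_1)
    then have "?e * x - 1 = d n * y" "0 < ?e * x" by simp_all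
    then show ?thesis by (intro exI[of _ "?e * x"]) auto
  qed
  then obtain r where r: "\<And>n. r n > 0" "\<And>n. d n dvd (r n - 1)" "\<And>n. (d (Suc n) div d n) dvd r n" by metis
  define l where "l n = d 0 * (\<Prod>i<n. r i)" for n
  have l_Suc: "l (Suc n) = l n * r n" for n by (simp add: l_def)
  have l_pos: "l n > 0" for n using pos r by (auto simp: l_def)
  have "d n dvd l n" for n
  proof (induction n)
    case 0 show ?case by (simp add: l_def)
  next
    case (Suc n)
    have "d (Suc n) = d n * (d (Suc n) div d n)" using dvd[of n] by simp
    then show ?case using Suc r(3)[of n] unfolding l_Suc by (metis mult_dvd_mono)
  qed
  then show ?thesis using l_pos l_Suc r by (intro exI[of _ l]) auto
qed

section \<open>Galois groups under ring isomorphisms\<close>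

lemma mem_Gal_iff:
  "g \<in> carrier (Gal R K) \<longleftrightarrow> g \<in> ring_iso R R \<and> g \<in> extensional (carrier R) \<and> (\<forall>x\<in>K. g x = x)"
  by (simp add: Gal_def)

lemma Gal_simps [simp]:
  "g \<otimes>\<^bsub>Gal R K\<^esub> f = compose (carrier R) g f" "\<one>\<^bsub>Gal R K\<^esub> = restrict id (carrier R)"
  by (simp_all add: Gal_def)

lemma
  assumes "g \<in> carrier (Gal R K)"
  shows Gal_hom: "g \<in> ring_hom R R"
    and Gal_bij: "bij_betw g (carrier R) (carrier R)"
    and Gal_extensional: "g \<in> extensional (carrier R)"
    and Gal_fixes: "\<And>x. x \<in> K \<Longrightarrow> g x = x"
  using assms by (auto simp: mem_Gal_iff ring_iso_def)

lemma
  assumes "g \<in> carrier (Gal R K)"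
  shows Gal_closed: "\<And>x. x \<in> carrier R \<Longrightarrow> g x \<in> carrier R"
    and Gal_one: "g \<one>\<^bsub>R\<^esub> = \<one>\<^bsub>R\<^esub>"
    and Gal_mult: "\<And>x y. x \<in> carrier R \<Longrightarrow> y \<in> carrier R \<Longrightarrow> g (x \<otimes>\<^bsub>R\<^esub> y) = g x \<otimes>\<^bsub>R\<^esub> g y"
    and Gal_add: "\<And>x y. x \<in> carrier R \<Longrightarrow> y \<in> carrier R \<Longrightarrow> g (x \<oplus>\<^bsub>R\<^esub> y) = g x \<oplus>\<^bsub>R\<^esub> g y"
  using Gal_hom[OF assms] by (auto simp: ring_hom_def)

lemma
  assumes "g \<in> carrier (Gal (R\<lparr>carrier := L\<rparr>) K)"
  shows Gal_subring_closed: "\<And>x. x \<in> L \<Longrightarrow> g x \<in> L"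
    and Gal_subring_one: "g \<one>\<^bsub>R\<^esub> = \<one>\<^bsub>R\<^esub>"
    and Gal_subring_mult: "\<And>x y. x \<in> L \<Longrightarrow> y \<in> L \<Longrightarrow> g (x \<otimes>\<^bsub>R\<^esub> y) = g x \<otimes>\<^bsub>R\<^esub> g y"
    and Gal_subring_add: "\<And>x y. x \<in> L \<Longrightarrow> y \<in> L \<Longrightarrow> g (x \<oplus>\<^bsub>R\<^esub> y) = g x \<oplus>\<^bsub>R\<^esub> g y"
    and Gal_subring_extensional: "g \<in> extensional L"
  using Gal_closed[OF assms] Gal_one[OF assms] Gal_mult[OF assms] Gal_add[OF assms]
    Gal_extensional[OF assms] by auto

lemma ring_iso_cong:
  assumes "ring R" "f \<in> ring_iso R S" "\<And>x. x \<in> carrier R \<Longrightarrow> g x = f x"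
  shows "g \<in> ring_iso R S"
proof -
  interpret ring R by fact
  have "bij_betw g (carrier R) (carrier S)"
    using assms bij_betw_cong[of "carrier R" g f "carrier S"] by (auto simp: ring_iso_def)
  then show ?thesis using assms by (auto simp: ring_iso_def ring_hom_def Pi_def)
qed

lemma Gal_conjugate:
  assumes "ring R" "ring S" "j \<in> ring_iso R S" "K \<subseteq> carrier R" "g \<in> carrier (Gal R K)"
  shows "(\<lambda>y\<in>carrier S. j (g (inv_into (carrier R) j y))) \<in> carrier (Gal S (j ` K))"
proof -
  interpret R: ring R by fact
  have j': "inv_into (carrier R) j \<in> ring_iso S R" by (rule ring_iso_set_sym[OF assms(1,3)])
  have "(j \<circ> g) \<circ> inv_into (carrier R) j \<in> ring_iso S S"
    using assms j' by (intro ring_iso_set_trans[OF j'] ring_iso_set_trans[of g R R j S]) (auto simp: mem_Gal_iff)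
  then have iso: "(\<lambda>y\<in>carrier S. j (g (inv_into (carrier R) j y))) \<in> ring_iso S S"
    by (rule ring_iso_cong[OF assms(2)]) auto
  have "inj_on j (carrier R)" "j ` carrier R = carrier S"
    using assms(3) by (auto simp: ring_iso_def bij_betw_def)
  then have "(\<lambda>y\<in>carrier S. j (g (inv_into (carrier R) j y))) (j x) = j x" if "x \<in> K" for x
    using that assms(4) Gal_fixes[OF assms(5) that] by (auto simp: inv_into_f_f subset_eq)
  then show ?thesis using iso by (auto simp: mem_Gal_iff)
qed

lemma Gal_group:
  assumes "ring R" "K \<subseteq> carrier R" shows "group (Gal R K)"
proof (rule groupI)
  fix f g assume f: "f \<in> carrier (Gal R K)" and g: "g \<in> carrier (Gal R K)"
  have "compose (carrier R) f g \<in> ring_iso R R"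
    by (rule ring_iso_cong[OF assms(1) ring_iso_set_trans[of g R R f R]])
       (use f g in \<open>auto simp: mem_Gal_iff compose_def\<close>)
  then show "f \<otimes>\<^bsub>Gal R K\<^esub> g \<in> carrier (Gal R K)"
    using f g assms(2) by (auto simp: mem_Gal_iff compose_def)
next
  show "\<one>\<^bsub>Gal R K\<^esub> \<in> carrier (Gal R K)"
    using assms(2) ring_iso_cong[OF assms(1) ring_iso_set_refl, of "restrict id (carrier R)"]
    by (auto simp: mem_Gal_iff)
next
  fix x y z assume "x \<in> carrier (Gal R K)" "y \<in> carrier (Gal R K)" "z \<in> carrier (Gal R K)"
  then show "x \<otimes>\<^bsub>Gal R K\<^esub> y \<otimes>\<^bsub>Gal R K\<^esub> z = x \<otimes>\<^bsub>Gal R K\<^esub> (y \<otimes>\<^bsub>Gal R K\<^esub> z)"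
    by (auto simp: compose_def Gal_closed intro!: ext)
next
  fix x assume x: "x \<in> carrier (Gal R K)"
  then show "\<one>\<^bsub>Gal R K\<^esub> \<otimes>\<^bsub>Gal R K\<^esub> x = x"
    using Gal_extensional[OF x] by (auto simp: compose_def Gal_closed extensional_def intro!: ext)
  let ?y = "\<lambda>y\<in>carrier R. inv_into (carrier R) x y"
  have "?y \<in> ring_iso R R"
    by (rule ring_iso_cong[OF assms(1) ring_iso_set_sym[OF assms(1), of x]]) (use x in \<open>auto simp: mem_Gal_iff\<close>)
  moreover have "?y k = k" if k: "k \<in> K" for k
    using Gal_fixes[OF x k] Gal_bij[OF x] k assms(2)
    by (metis bij_betw_def inv_into_f_f restrict_apply' subsetD)
  ultimately have "?y \<in> carrier (Gal R K)" by (auto simp: mem_Gal_iff)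
  moreover have "?y \<otimes>\<^bsub>Gal R K\<^esub> x = \<one>\<^bsub>Gal R K\<^esub>"
    using Gal_bij[OF x] Gal_closed[OF x] by (auto simp: compose_def bij_betw_def intro!: ext)
  ultimately show "\<exists>y\<in>carrier (Gal R K). y \<otimes>\<^bsub>Gal R K\<^esub> x = \<one>\<^bsub>Gal R K\<^esub>" by blast
qed

lemma Gal_inverse_exists:
  assumes "ring R" "K \<subseteq> carrier R" "g \<in> carrier (Gal R K)"
  obtains g' where "g' \<in> carrier (Gal R K)"
    "\<And>x. x \<in> carrier R \<Longrightarrow> g (g' x) = x" "\<And>x. x \<in> carrier R \<Longrightarrow> g' (g x) = x"
proof -
  interpret G: group "Gal R K" by (rule Gal_group[OF assms(1,2)])
  let ?g' = "inv\<^bsub>Gal R K\<^esub> g"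
  have g': "?g' \<in> carrier (Gal R K)" using assms(3) by (rule G.inv_closed)
  have "compose (carrier R) g ?g' = restrict id (carrier R)" "compose (carrier R) ?g' g = restrict id (carrier R)"
    using G.r_inv[OF assms(3)] G.l_inv[OF assms(3)] by simp_all
  then have "g (?g' x) = x" "?g' (g x) = x" if "x \<in> carrier R" for x
    using that by (metis compose_eq id_apply restrict_apply')+
  then show thesis using that[OF g'] by blast
qed

locale ring_isomorphism = R: ring R + S: ring S
  for R :: "('a,'m) ring_scheme" and S :: "('b,'n) ring_scheme" +
  fixes j :: "'a \<Rightarrow> 'b"
  assumes iso: "j \<in> ring_iso R S"
begin

abbreviation j' :: "'b \<Rightarrow> 'a" where "j' \<equiv> inv_into (carrier R) j"

lemma inverse_iso: "j' \<in> ring_iso S R"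
  by (rule ring_iso_set_sym[OF R.ring_axioms iso])

lemma bij: "bij_betw j (carrier R) (carrier S)"
  using ring_iso_memE(5)[OF iso] .

lemma closed [simp]: "x \<in> carrier R \<Longrightarrow> j x \<in> carrier S"
  and inverse_closed [simp]: "y \<in> carrier S \<Longrightarrow> j' y \<in> carrier R"
  and left_inverse [simp]: "x \<in> carrier R \<Longrightarrow> j' (j x) = x"
  and right_inverse [simp]: "y \<in> carrier S \<Longrightarrow> j (j' y) = y"
  using ring_iso_memE(1)[OF iso] ring_iso_memE(1)[OF inverse_iso]
    bij_betw_inv_into_left[OF bij] bij_betw_inv_into_right[OF bij] by blast+

lemma image_inverse_image: "K \<subseteq> carrier R \<Longrightarrow> j' ` j ` K = K"
  by (simp add: image_image subset_eq)

lemma inverse_inverse: "x \<in> carrier R \<Longrightarrow> inv_into (carrier S) j' x = j x"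
  by (metis bij_betw_def closed inverse_iso inv_into_f_f left_inverse ring_iso_memE(5))

lemma Gal_conjugate_inverse:
  assumes "K \<subseteq> carrier R" "g \<in> carrier (Gal S (j ` K))"
  shows "(\<lambda>x\<in>carrier R. j' (g (j x))) \<in> carrier (Gal R K)"
proof -
  have "(\<lambda>y\<in>carrier R. j' (g (inv_into (carrier S) j' y))) \<in> carrier (Gal R (j' ` j ` K))"
    by (rule Gal_conjugate[OF S.ring_axioms R.ring_axioms inverse_iso _ assms(2)]) (use assms(1) in auto)
  moreover have "(\<lambda>y\<in>carrier R. j' (g (inv_into (carrier S) j' y))) = (\<lambda>x\<in>carrier R. j' (g (j x)))"
    using inverse_inverse by (intro restrict_ext) simp
  ultimately show ?thesis unfolding image_inverse_image[OF assms(1)] by simp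
qed

lemma Gal_image_iso:
  assumes K: "K \<subseteq> carrier R" shows "Gal R K \<cong> Gal S (j ` K)"
proof -
  let ?\<Phi> = "\<lambda>g. \<lambda>y\<in>carrier S. j (g (j' y))"
  let ?\<Psi> = "\<lambda>g. \<lambda>x\<in>carrier R. j' (g (j x))"
  have closed: "?\<Phi> g \<in> carrier (Gal S (j ` K))" if "g \<in> carrier (Gal R K)" for g
    using Gal_conjugate[OF R.ring_axioms S.ring_axioms iso K that] .
  have "?\<Phi> \<in> hom (Gal R K) (Gal S (j ` K))"
  proof (rule homI)
    fix f g assume f: "f \<in> carrier (Gal R K)" and g: "g \<in> carrier (Gal R K)"
    show "?\<Phi> (f \<otimes>\<^bsub>Gal R K\<^esub> g) = ?\<Phi> f \<otimes>\<^bsub>Gal S (j ` K)\<^esub> ?\<Phi> g"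
      by (auto simp: compose_def Gal_closed[OF g] Gal_closed[OF f] intro!: ext)
  qed (use closed in auto)
  moreover have "bij_betw ?\<Phi> (carrier (Gal R K)) (carrier (Gal S (j ` K)))"
  proof (rule bij_betwI[of _ _ _ ?\<Psi>])
    show "?\<Phi> \<in> carrier (Gal R K) \<rightarrow> carrier (Gal S (j ` K))" using closed by auto
    show "?\<Psi> \<in> carrier (Gal S (j ` K)) \<rightarrow> carrier (Gal R K)" using Gal_conjugate_inverse[OF K] by auto
    show "?\<Psi> (?\<Phi> g) = g" if g: "g \<in> carrier (Gal R K)" for g
      using Gal_extensional[OF g] Gal_closed[OF g] by (auto simp: extensional_def intro!: ext)
    show "?\<Phi> (?\<Psi> g) = g" if g: "g \<in> carrier (Gal S (j ` K))" for g
      using Gal_extensional[OF g] Gal_closed[OF g] by (auto simp: extensional_def intro!: ext)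
  qed
  ultimately show ?thesis unfolding is_iso_def iso_def by auto
qed

lemma galois_image:
  assumes K: "K \<subseteq> carrier R" and gal: "galois R K" shows "galois S (j ` K)"
proof -
  have "y \<in> j ` K" if y: "y \<in> carrier S" "\<forall>g\<in>carrier (Gal S (j ` K)). g y = y" for y
  proof -
    have "g (j' y) = j' y" if g: "g \<in> carrier (Gal R K)" for g
    proof -
      have "j (g (j' y)) = y"
        using y Gal_conjugate[OF R.ring_axioms S.ring_axioms iso K g] by force
      then have "j' (j (g (j' y))) = j' y" by simp
      then show ?thesis using y(1) Gal_closed[OF g] by simp
    qed
    then have "j' y \<in> {x \<in> carrier R. \<forall>g\<in>carrier (Gal R K). g x = x}" using y(1) by simp
    then have "j' y \<in> K" using gal unfolding galois_def by simp
    then show ?thesis using y(1) right_inverse by (metis image_eqI)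
  qed
  moreover have "j ` K \<subseteq> carrier S" using K by auto
  ultimately show ?thesis unfolding galois_def using Gal_fixes[of _ S "j ` K"] by blast
qed

lemma outer_image:
  assumes K: "K \<subseteq> carrier R" and outer: "outer R K" shows "outer S (j ` K)"
  unfolding outer_def
proof (intro ballI impI)
  fix u x assume u: "u \<in> Units S" and fixed: "\<forall>x\<in>j ` K. u \<otimes>\<^bsub>S\<^esub> x \<otimes>\<^bsub>S\<^esub> inv\<^bsub>S\<^esub> u = x"
    and x: "x \<in> carrier S"
  let ?u = "j' u" and ?v = "j' (inv\<^bsub>S\<^esub> u)"
  note j'_hom = ring_iso_memE[OF inverse_iso]
  have u_carrier: "u \<in> carrier S" "inv\<^bsub>S\<^esub> u \<in> carrier S" using u by auto
  have v: "?u \<in> carrier R" "?v \<in> carrier R" "?u \<otimes>\<^bsub>R\<^esub> ?v = \<one>\<^bsub>R\<^esub>" "?v \<otimes>\<^bsub>R\<^esub> ?u = \<one>\<^bsub>R\<^esub>"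
    using u u_carrier j'_hom(2)[OF u_carrier] j'_hom(2)[OF u_carrier(2,1)] j'_hom(4) by auto
  then have unit: "?u \<in> Units R" and inv: "inv\<^bsub>R\<^esub> ?u = ?v"
    using R.inv_char by (auto simp: Units_def)
  have conj: "?u \<otimes>\<^bsub>R\<^esub> j' y \<otimes>\<^bsub>R\<^esub> ?v = j' (u \<otimes>\<^bsub>S\<^esub> y \<otimes>\<^bsub>S\<^esub> inv\<^bsub>S\<^esub> u)" if "y \<in> carrier S" for y
    using u_carrier that j'_hom(2) by auto
  have "?u \<otimes>\<^bsub>R\<^esub> y \<otimes>\<^bsub>R\<^esub> inv\<^bsub>R\<^esub> ?u = y" if "y \<in> K" for y
    using conj[of "j y"] fixed that K inv by (auto simp: subset_eq)
  then have "?u \<otimes>\<^bsub>R\<^esub> j' x \<otimes>\<^bsub>R\<^esub> inv\<^bsub>R\<^esub> ?u = j' x"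
    using outer unit inverse_closed[OF x] unfolding outer_def by blast
  then have "j (j' (u \<otimes>\<^bsub>S\<^esub> x \<otimes>\<^bsub>S\<^esub> inv\<^bsub>S\<^esub> u)) = j (j' x)" using conj[OF x] inv by simp
  moreover have "u \<otimes>\<^bsub>S\<^esub> x \<otimes>\<^bsub>S\<^esub> inv\<^bsub>S\<^esub> u \<in> carrier S" using u_carrier x by simp
  ultimately show "u \<otimes>\<^bsub>S\<^esub> x \<otimes>\<^bsub>S\<^esub> inv\<^bsub>S\<^esub> u = x" using x by simp
qed

lemma divring_image:
  assumes "divring R" shows "divring S"
proof -
  interpret D: divring R by fact
  have hom: "ring_hom_ring R S j"
    by (rule ring_hom_ringI2[OF R.ring_axioms S.ring_axioms]) (use iso in \<open>simp add: ring_iso_def\<close>)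
  interpret hom: ring_hom_ring R S j by (rule hom)
  show ?thesis
  proof unfold_locales
    show "\<one>\<^bsub>S\<^esub> \<noteq> \<zero>\<^bsub>S\<^esub>"
      using D.one_not_zero left_inverse[OF R.one_closed] left_inverse[OF R.zero_closed] by auto
    fix x assume x: "x \<in> carrier S" "x \<noteq> \<zero>\<^bsub>S\<^esub>"
    have "j' x \<in> carrier R" using x by simp
    moreover have "j' x \<noteq> \<zero>\<^bsub>R\<^esub>"
    proof
      assume "j' x = \<zero>\<^bsub>R\<^esub>"
      then show False using right_inverse[OF x(1)] x(2) by simp
    qed
    ultimately have "j (inv\<^bsub>R\<^esub> (j' x)) \<otimes>\<^bsub>S\<^esub> x = \<one>\<^bsub>S\<^esub>" "x \<otimes>\<^bsub>S\<^esub> j (inv\<^bsub>R\<^esub> (j' x)) = \<one>\<^bsub>S\<^esub>"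
      using hom.hom_mult[of "j' x" "inv\<^bsub>R\<^esub> (j' x)"] hom.hom_mult[of "inv\<^bsub>R\<^esub> (j' x)" "j' x"] x by auto
    then show "x \<in> Units S"
      using x closed[of "inv\<^bsub>R\<^esub> (j' x)"] \<open>j' x \<in> _\<close> \<open>j' x \<noteq> _\<close> by (auto simp: Units_def)
  qed
qed

end

lemma (in divring_hom) ring_isomorphism_subring:
  assumes "subring K R"
  shows "ring_isomorphism (R\<lparr>carrier := K\<rparr>) (S\<lparr>carrier := \<phi> ` K\<rparr>) \<phi>"
proof (intro ring_isomorphism.intro ring_isomorphism_axioms.intro)
  show "ring (R\<lparr>carrier := K\<rparr>)" "ring (S\<lparr>carrier := \<phi> ` K\<rparr>)"
    using R.subring_is_ring[OF assms] S.subring_is_ring[OF img_is_subring[OF assms]] .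
  show "\<phi> \<in> ring_iso (R\<lparr>carrier := K\<rparr>) (S\<lparr>carrier := \<phi> ` K\<rparr>)"
    using subringE(1)[OF assms] inj_on_subset[OF hom_inj]
    by (intro ring_iso_memI) (auto simp: bij_betw_def subset_eq)
qed

lemma (in divring) image_ring_isomorphism:
  assumes "inj_on f (carrier R)"
  shows "ring_isomorphism R (image_ring f R) f"
  by (intro ring_isomorphism.intro ring_isomorphism_axioms.intro ring_axioms
    inj_imp_image_ring_is_ring inj_imp_image_ring_iso assms)

section \<open>Composita with a central Galois extension\<close>

locale finite_central_galois = divring E for E (structure) +
  fixes F L :: "'a set"
  assumes F: "subdivring F E" and L: "subdivring L E" and F_subset_L: "F \<subseteq> L"
    and central: "\<And>x y. x \<in> L \<Longrightarrow> y \<in> carrier E \<Longrightarrow> x \<otimes> y = y \<otimes> x"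
    and finite_Gal: "finite (carrier (Gal (E\<lparr>carrier := L\<rparr>) F))"
    and galois_L: "galois (E\<lparr>carrier := L\<rparr>) F"
begin

abbreviation "Gal_L \<equiv> Gal (E\<lparr>carrier := L\<rparr>) F"

lemma L_carrier [simp]: "x \<in> L \<Longrightarrow> x \<in> carrier E"
  by (rule subdivring_carrier[OF L])

lemma L_ring: "ring (E\<lparr>carrier := L\<rparr>)"
  by (rule subring_is_ring[OF subdivring_imp_subring[OF L]])

lemma Gal_L_group: "group Gal_L"
  by (rule Gal_group[OF L_ring]) (use F_subset_L in simp)

lemmas Gal_L_closed = Gal_subring_closed[of _ L E F]
  and Gal_L_one = Gal_subring_one[of _ L E F]
  and Gal_L_mult = Gal_subring_mult[of _ L E F]
  and Gal_L_add = Gal_subring_add[of _ L E F]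

lemma Gal_L_carrier [simp]: "g \<in> carrier Gal_L \<Longrightarrow> x \<in> L \<Longrightarrow> g x \<in> carrier E"
  by (simp add: Gal_L_closed)

lemma Gal_L_eqI:
  assumes "f \<in> carrier Gal_L" "g \<in> carrier Gal_L" "\<And>x. x \<in> L \<Longrightarrow> f x = g x"
  shows "f = g"
  using Gal_subring_extensional[OF assms(1)] Gal_subring_extensional[OF assms(2)] assms(3)
  by (intro extensionalityI)

lemma card_lin_indep_le_card_Gal:
  assumes B: "finite B" "B \<subseteq> L" "lin_indep E F B"
  shows "card B \<le> card (carrier Gal_L)"
proof (rule ccontr)
  assume gt: "\<not> ?thesis"
  interpret L: divring "E\<lparr>carrier := L\<rparr>" by (rule subdivring_divring[OF L])
  interpret G: group Gal_L by (rule Gal_L_group)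
  have permute: "\<exists>i'\<in>carrier Gal_L. \<forall>x\<in>L. i x = g (i' x)" if g: "g \<in> carrier Gal_L" and i: "i \<in> carrier Gal_L" for g i
  proof -
    define i' where "i' = inv\<^bsub>Gal_L\<^esub> g \<otimes>\<^bsub>Gal_L\<^esub> i"
    have "i' \<in> carrier Gal_L" using g i by (auto simp: i'_def simp del: Gal_simps)
    moreover have "g \<otimes>\<^bsub>Gal_L\<^esub> i' = i"
      using g i by (simp add: i'_def G.m_assoc[symmetric] del: Gal_simps)
    then have "\<forall>x\<in>L. i x = g (i' x)" by (auto simp: compose_def)
    ultimately show ?thesis by blast
  qed
  have "\<not> lin_indep (E\<lparr>carrier := L\<rparr>) {x \<in> carrier (E\<lparr>carrier := L\<rparr>). \<forall>g\<in>carrier Gal_L. g x = x} B"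
  proof (rule L.not_lin_indep_over_fixed[where \<chi> = "\<lambda>g. g" and I = "carrier Gal_L" and i\<^sub>0 = "\<one>\<^bsub>Gal_L\<^esub>"])
    show "\<one>\<^bsub>Gal_L\<^esub> \<in> carrier Gal_L" by (rule G.one_closed)
  qed (use finite_Gal B gt Gal_hom permute in \<open>auto simp: Gal_L_closed\<close>)
  moreover have "{x \<in> carrier (E\<lparr>carrier := L\<rparr>). \<forall>g\<in>carrier Gal_L. g x = x} = F"
    using galois_L unfolding galois_def by simp
  ultimately show False
    using B lin_indep_carrier_update[OF ring_axioms subdivring_imp_subring[OF L] B(1,2) F_subset_L] by simp
qed

lemma basis_exists:
  obtains B where "finite B" "B \<subseteq> L" "lin_indep E F B" "L \<subseteq> lin_span E F B"
proof (rule maximal_lin_indep[OF F, of L "{}"])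
  show "lin_indep E F {}" by (simp add: lin_indep_def)
qed (use card_lin_indep_le_card_Gal subdivring_subset[OF L] that in auto)

definition trace :: "'a \<Rightarrow> 'a" where
  "trace e = (\<Oplus>g\<in>carrier Gal_L. g e)"

lemma trace_in_F:
  assumes e: "e \<in> L" shows "trace e \<in> F"
proof -
  interpret G: group Gal_L by (rule Gal_L_group)
  have "f (trace e) = trace e" if f: "f \<in> carrier Gal_L" for f
  proof -
    let ?m = "\<lambda>g. compose L f g"
    have inj: "inj_on ?m (carrier Gal_L)" using G.inj_on_cmult[OF f] by simp
    have "?m ` carrier Gal_L \<subseteq> carrier Gal_L" using G.m_closed[OF f] by auto
    then have image: "?m ` carrier Gal_L = carrier Gal_L" using endo_inj_surj[OF finite_Gal _ inj] by blast
    have "f (trace e) = (\<Oplus>g\<in>carrier Gal_L. f (g e))"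
      unfolding trace_def
      using subdivring_closed[OF L] Gal_L_add[OF f] Gal_L_closed e f
      by (intro additive_finsum[OF ring_axioms finite_Gal, of _ L]) auto
    also have "\<dots> = (\<Oplus>g\<in>carrier Gal_L. ?m g e)"
      using Gal_L_closed e f by (intro finsum_cong') (auto simp: compose_def)
    also have "\<dots> = (\<Oplus>g\<in>?m ` carrier Gal_L. g e)"
      using inj e image by (intro finsum_reindex[symmetric]) auto
    finally show ?thesis by (simp add: image trace_def)
  qed
  moreover have "trace e \<in> L" unfolding trace_def
    by (rule finsum_mem_subring[OF subdivring_imp_subring[OF L] finite_Gal])
       (use Gal_L_closed e in auto)
  ultimately show ?thesis using galois_L unfolding galois_def by auto
qed

lemma trace_nonzero: "\<exists>e\<in>L. trace e \<noteq> \<zero>"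
proof (rule ccontr)
  assume trivial: "\<not> ?thesis"
  interpret G: group Gal_L by (rule Gal_L_group)
  have "(\<Oplus>g\<in>carrier Gal_L. g x \<otimes> \<one>) = \<zero>" if "x \<in> L" for x
  proof -
    have "(\<Oplus>g\<in>carrier Gal_L. g x \<otimes> \<one>) = trace x"
      unfolding trace_def using that by (intro finsum_cong') auto
    then show ?thesis using trivial that by auto
  qed
  then have "\<exists>i\<in>carrier Gal_L. \<exists>j\<in>carrier Gal_L. i \<noteq> j \<and> conj_on E L i j"
    using G.one_closed subdivring_one[OF L] subdivring_mult[OF L]
    by (intro dedekind_conj_on[OF finite_Gal, of L "\<lambda>g. g" "\<lambda>_. \<one>"])
       (auto simp: Gal_L_one Gal_L_mult simp del: Gal_simps)
  then obtain i j where ij: "i \<in> carrier Gal_L" "j \<in> carrier Gal_L" "i \<noteq> j" "conj_on E L i j" by blast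
  have "i x = j x" if "x \<in> L" for x
    using conj_on_central_imp_eq[OF ij(4) that] central Gal_L_closed ij(1,2) that by simp
  then show False using Gal_L_eqI ij(1-3) by blast
qed

end

locale central_compositum = finite_central_galois +
  fixes H :: "'a set"
  assumes H: "subdivring H E" and F_subset_H: "F \<subseteq> H"
    and disjoint: "\<And>B. finite B \<Longrightarrow> B \<subseteq> L \<Longrightarrow> lin_indep E F B \<Longrightarrow> lin_indep E H B"

locale compositum_basis = central_compositum +
  fixes B
  assumes finite_basis: "finite B" and basis_subset: "B \<subseteq> L" and basis_indep: "lin_indep E F B"
    and basis_spans: "L \<subseteq> lin_span E F B"
begin

sublocale finite_basis E H B
  by unfold_locales (use H finite_basis basis_subset disjoint basis_indep in auto)

abbreviation "M \<equiv> lin_span E H B"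

abbreviation "Gal_M \<equiv> Gal (E\<lparr>carrier := M\<rparr>) H"

lemmas Gal_M_closed = Gal_subring_closed[of _ M E H]
  and Gal_M_one = Gal_subring_one[of _ M E H]
  and Gal_M_mult = Gal_subring_mult[of _ M E H]
  and Gal_M_add = Gal_subring_add[of _ M E H]

lemma basis_in_L [simp]: "b \<in> B \<Longrightarrow> b \<in> L"
  using basis_subset by auto

lemma L_subset_M: "L \<subseteq> M"
  using basis_spans lin_span_mono[OF F_subset_H] by blast

lemma H_subset_M: "H \<subseteq> M"
proof
  fix x assume "x \<in> H"
  then have "x \<otimes> \<one> \<in> M" using L_subset_M subdivring_one[OF L] by (intro lin_span_lmult) auto
  then show "x \<in> M" using \<open>x \<in> H\<close> by simp
qed

lemma prod_in_M: "h \<in> H \<Longrightarrow> e \<in> L \<Longrightarrow> h \<otimes> e \<in> M"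
  using lin_span_lmult L_subset_M by blast

lemma M_induct [consumes 1, case_names prod add]:
  assumes "x \<in> M" and prod: "\<And>h e. h \<in> H \<Longrightarrow> e \<in> L \<Longrightarrow> P (h \<otimes> e)"
    and add: "\<And>x y. x \<in> M \<Longrightarrow> y \<in> M \<Longrightarrow> P x \<Longrightarrow> P y \<Longrightarrow> P (x \<oplus> y)"
  shows "P x"
proof -
  obtain c where c: "c \<in> B \<rightarrow> H" "x = (\<Oplus>b\<in>B. c b \<otimes> b)" using assms(1) by (auto simp: lin_span_def)
  have "P (\<zero> \<otimes> \<zero>)" using prod subdivring_zero[OF H] subdivring_zero[OF L] by blast
  then have "(\<Oplus>b\<in>B. c b \<otimes> b) \<in> {x \<in> M. P x}"
    using c(1) prod add lin_span_add lin_span_zero prod_in_M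
    by (intro finsum_mem[OF finite_B]) (auto simp: Pi_iff)
  then show ?thesis using c by simp
qed

lemma prod_mult_prod:
  assumes "h \<in> H" "e \<in> L" "h' \<in> H" "e' \<in> L"
  shows "(h \<otimes> e) \<otimes> (h' \<otimes> e') = (h \<otimes> h') \<otimes> (e \<otimes> e')"
proof -
  have "(h \<otimes> e) \<otimes> (h' \<otimes> e') = h \<otimes> (e \<otimes> h') \<otimes> e'" using assms by (simp add: m_assoc)
  also have "\<dots> = h \<otimes> (h' \<otimes> e) \<otimes> e'" using central[of e h'] assms by simp
  finally show ?thesis using assms by (simp add: m_assoc)
qed

lemma M_mult:
  assumes "x \<in> M" "y \<in> M" shows "x \<otimes> y \<in> M"
  using assms(1)
proof (induction x rule: M_induct)
  case (prod h e)
  show ?case using assms(2)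
  proof (induction y rule: M_induct)
    case (prod h' e')
    then show ?case
      using \<open>h \<in> H\<close> \<open>e \<in> L\<close> subdivring_mult[OF H] subdivring_mult[OF L]
      by (subst prod_mult_prod) (auto intro: prod_in_M)
  next
    case (add x y) then show ?case using \<open>h \<in> H\<close> \<open>e \<in> L\<close> by (simp add: r_distr lin_span_add)
  qed
next
  case (add x x') then show ?case using assms(2) by (simp add: l_distr lin_span_add)
qed

lemma M_subring: "subring M E"
proof (rule subringI)
  show "\<ominus> x \<in> M" if "x \<in> M" for x
    using lin_span_lmult[OF _ that, of "\<ominus> \<one>"] subdivring_closed[OF H] that by (simp add: l_minus)
  show "\<one> \<in> M" using L_subset_M subdivring_one[OF L] by blast
qed (use lin_span_add M_mult in auto)

text \<open>Right multiplication by \<open>x\<close> is an injective \<open>H\<close>-linear map of the finite-dimensional space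
  \<open>M\<close>, hence \<open>\<one>\<close> is in its image.\<close>

lemma M_inv:
  assumes x: "x \<in> M" "x \<noteq> \<zero>" shows "inv x \<in> M"
proof -
  define v where "v j = (case j of None \<Rightarrow> \<one> | Some b \<Rightarrow> b \<otimes> x)" for j
  let ?J = "insert None (Some ` B)"
  have bM: "b \<in> M" if "b \<in> B" for b using L_subset_M that by auto
  have "v \<in> ?J \<rightarrow> M" using M_mult[OF bM x(1)] L_subset_M subdivring_one[OF L] by (auto simp: v_def)
  moreover have "card B < card ?J" using finite_B by (simp add: card_image)
  ultimately obtain c where c: "c \<in> ?J \<rightarrow> H" "\<exists>j\<in>?J. c j \<noteq> \<zero>" and rel: "(\<Oplus>j\<in>?J. c j \<otimes> v j) = \<zero>"
    using dependent_if_card_gt[of ?J v] finite_B by auto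
  define s where "s = (\<Oplus>b\<in>B. c (Some b) \<otimes> b)"
  have cH: "c None \<in> H" "\<And>b. b \<in> B \<Longrightarrow> c (Some b) \<in> H" using c(1) by auto
  have s: "s \<in> M" unfolding s_def lin_span_def using cH by (auto intro!: exI[of _ "\<lambda>b. c (Some b)"])
  have "(\<Oplus>j\<in>?J. c j \<otimes> v j) = c None \<otimes> v None \<oplus> (\<Oplus>j\<in>Some ` B. c j \<otimes> v j)"
    using finite_B cH x by (intro finsum_insert) (auto simp: v_def)
  also have "(\<Oplus>j\<in>Some ` B. c j \<otimes> v j) = (\<Oplus>b\<in>B. c (Some b) \<otimes> b \<otimes> x)"
    using cH x by (subst finsum_reindex) (auto simp: v_def m_assoc intro!: finsum_cong')
  also have "\<dots> = s \<otimes> x" unfolding s_def using finite_B cH x by (intro finsum_ldistr[symmetric]) auto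
  finally have sum: "c None \<oplus> s \<otimes> x = \<zero>" using rel cH by (simp add: v_def)
  have nonzero: "c None \<noteq> \<zero>"
  proof
    assume "c None = \<zero>"
    then have "s = \<zero>" using sum s x by simp
    then have "\<forall>b\<in>B. c (Some b) = \<zero>"
      using indep cH(2) unfolding lin_indep_def s_def by (auto dest!: bspec[of _ _ "\<lambda>b. c (Some b)"])
    then show False using c(2) \<open>c None = \<zero>\<close> by auto
  qed
  let ?q = "\<ominus> (inv (c None))"
  have q: "?q \<in> H" using nonzero cH subdivring_inv[OF H] subdivring_uminus[OF H] by blast
  have "s \<otimes> x = \<ominus> c None" using sum s x cH by (metis K_carrier a_comm lin_span_carrier m_closed minus_equality)
  then have "?q \<otimes> s \<otimes> x = \<one>"
    using nonzero cH s x q by (simp add: m_assoc l_minus r_minus)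
  then have "inv x = ?q \<otimes> s" using x s q by (intro inv_eqI_left) auto
  then show ?thesis using lin_span_lmult[OF q s] by simp
qed

lemma M_subdivring: "subdivring M E"
  by (rule subdivringI[OF M_subring M_inv])

definition extend :: "('a \<Rightarrow> 'a) \<Rightarrow> 'a \<Rightarrow> 'a" where
  "extend g x = (\<Oplus>b\<in>B. coords E H B x b \<otimes> g b)"

lemma extend_closed:
  assumes "g \<in> carrier Gal_L" "x \<in> M" shows "extend g x \<in> M"
  unfolding extend_def
  using coords_in_K[OF assms(2)] Gal_L_closed[OF assms(1)] prod_in_M
  by (intro finsum_mem_subring[OF M_subring finite_B]) auto

lemma extend_add:
  assumes g: "g \<in> carrier Gal_L" and x: "x \<in> M" and y: "y \<in> M"
  shows "extend g (x \<oplus> y) = extend g x \<oplus> extend g y"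
proof -
  have gB: "g \<in> B \<rightarrow> carrier E" using g by auto
  have "extend g (x \<oplus> y) = (\<Oplus>b\<in>B. (coords E H B x b \<oplus> coords E H B y b) \<otimes> g b)"
    unfolding extend_def using coords_in_K x y g by (intro finsum_cong') (auto simp: coords_add)
  then show ?thesis
    unfolding extend_def using finsum_coeff_add[OF _ _ gB] coeffs_carrier[OF coords_mem] x y by simp
qed

lemma extend_prod:
  assumes g: "g \<in> carrier Gal_L" and h: "h \<in> H" and e: "e \<in> L"
  shows "extend g (h \<otimes> e) = h \<otimes> g e"
proof -
  obtain f where f: "f \<in> B \<rightarrow> F" "e = (\<Oplus>b\<in>B. f b \<otimes> b)" using basis_spans e by (auto simp: lin_span_def)
  have f_mem: "f b \<in> H" "f b \<in> L" "f b \<in> F" if "b \<in> B" for b using f(1) that F_subset_H F_subset_L by auto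
  then have fH: "f \<in> B \<rightarrow> H" by auto
  have gB: "g \<in> B \<rightarrow> carrier E" using g by auto
  have "g e = (\<Oplus>b\<in>B. g (f b \<otimes> b))" unfolding f(2)
    using f_mem subdivring_closed[OF L] Gal_L_add[OF g] g
    by (intro additive_finsum[OF ring_axioms finite_B, of _ L]) auto
  also have "\<dots> = (\<Oplus>b\<in>B. f b \<otimes> g b)"
    using f_mem g by (intro finsum_cong') (auto simp: Gal_L_mult Gal_fixes)
  finally have ge: "g e = (\<Oplus>b\<in>B. f b \<otimes> g b)" .
  have "coords E H B (h \<otimes> e) b = h \<otimes> f b" if "b \<in> B" for b
    using coords_lmult[OF h _ that, of e] coords_unique[OF fH f(2) that] L_subset_M e by auto
  then have "extend g (h \<otimes> e) = (\<Oplus>b\<in>B. (h \<otimes> f b) \<otimes> g b)"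
    unfolding extend_def using g f_mem h by (intro finsum_cong') auto
  also have "\<dots> = h \<otimes> g e"
    unfolding ge using finsum_coeff_lmult[OF finite_B _ coeffs_carrier[OF fH] gB] h by simp
  finally show ?thesis .
qed

lemma extend_L: "g \<in> carrier Gal_L \<Longrightarrow> e \<in> L \<Longrightarrow> extend g e = g e"
  using extend_prod[of g \<one> e] subdivring_one[OF H] by simp

lemma extend_H: "g \<in> carrier Gal_L \<Longrightarrow> h \<in> H \<Longrightarrow> extend g h = h"
  using extend_prod[of g h \<one>] subdivring_one[OF L] Gal_L_one[of g] by simp

lemma extend_mult:
  assumes g: "g \<in> carrier Gal_L" and x: "x \<in> M" and y: "y \<in> M"
  shows "extend g (x \<otimes> y) = extend g x \<otimes> extend g y"
  using x
proof (induction x rule: M_induct)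
  case (prod h e)
  show ?case using y
  proof (induction y rule: M_induct)
    case (prod h' e')
    have "extend g ((h \<otimes> e) \<otimes> (h' \<otimes> e')) = extend g ((h \<otimes> h') \<otimes> (e \<otimes> e'))"
      using prod \<open>h \<in> H\<close> \<open>e \<in> L\<close> by (subst prod_mult_prod) auto
    also have "\<dots> = (h \<otimes> h') \<otimes> (g e \<otimes> g e')"
      using prod \<open>h \<in> H\<close> \<open>e \<in> L\<close> g subdivring_mult[OF H] subdivring_mult[OF L]
      by (simp add: extend_prod Gal_L_mult)
    also have "\<dots> = (h \<otimes> g e) \<otimes> (h' \<otimes> g e')"
      using prod \<open>h \<in> H\<close> \<open>e \<in> L\<close> Gal_L_closed[OF g] by (subst prod_mult_prod) auto
    finally show ?case using prod \<open>h \<in> H\<close> \<open>e \<in> L\<close> g by (simp add: extend_prod)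
  next
    case (add y y')
    then show ?case
      using \<open>h \<in> H\<close> \<open>e \<in> L\<close> g lin_span_carrier[OF extend_closed[OF g]]
      by (simp add: r_distr extend_add M_mult prod_in_M)
  qed
next
  case (add x x')
  then show ?case using g y lin_span_carrier[OF extend_closed[OF g]] by (simp add: l_distr extend_add M_mult)
qed

lemma extend_inverse:
  assumes "g \<in> carrier Gal_L" "g' \<in> carrier Gal_L" "\<And>e. e \<in> L \<Longrightarrow> g (g' e) = e" and "x \<in> M"
  shows "extend g (extend g' x) = x"
  using assms(4)
proof (induction x rule: M_induct)
  case (prod h e)
  then show ?case using assms(1-3) Gal_L_closed[OF assms(2)] by (simp add: extend_prod)
next
  case (add x y)
  then show ?case using assms(1,2) by (simp add: extend_add extend_closed)
qed

lemma restrict_extend_Gal: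
  assumes g: "g \<in> carrier Gal_L" shows "restrict (extend g) M \<in> carrier Gal_M"
proof -
  obtain g' where g': "g' \<in> carrier Gal_L" "\<And>x. x \<in> L \<Longrightarrow> g (g' x) = x" "\<And>x. x \<in> L \<Longrightarrow> g' (g x) = x"
    using Gal_inverse_exists[OF L_ring _ g] F_subset_L by auto
  have "bij_betw (extend g) M M"
    by (rule bij_betwI[of _ _ _ "extend g'"]) (use extend_closed extend_inverse g g' in auto)
  then have "bij_betw (restrict (extend g) M) M M" by (simp cong: bij_betw_cong)
  moreover have "\<one> \<in> M" "extend g \<one> = \<one>"
    using L_subset_M subdivring_one[OF L] extend_L[OF g] Gal_L_one[OF g] by auto
  ultimately have "restrict (extend g) M \<in> ring_iso (E\<lparr>carrier := M\<rparr>) (E\<lparr>carrier := M\<rparr>)"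
    by (intro ring_iso_memI) (auto simp: g extend_closed extend_mult extend_add M_mult lin_span_add)
  then show ?thesis using extend_H[OF g] H_subset_M by (auto simp: mem_Gal_iff)
qed

lemma restrict_Gal_M:
  assumes g: "g \<in> carrier Gal_M" shows "restrict g L \<in> carrier Gal_L"
proof (rule ccontr)
  assume new: "restrict g L \<notin> carrier Gal_L"
  let ?J = "insert (restrict g L) (carrier Gal_L)"
  have J_carrier: "f \<in> L \<rightarrow> carrier E" if "f \<in> ?J" for f
    using that L_subset_M Gal_M_closed[OF g] by auto
  have hom: "f \<in> ring_hom (E\<lparr>carrier := L\<rparr>) E" if "f \<in> ?J" for f
  proof (rule ring_hom_memI)
    fix x y assume "x \<in> carrier (E\<lparr>carrier := L\<rparr>)" "y \<in> carrier (E\<lparr>carrier := L\<rparr>)"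
    then have xy: "x \<in> L" "y \<in> L" "x \<in> M" "y \<in> M" using L_subset_M by auto
    show "f x \<in> carrier E" using J_carrier[OF that] xy by auto
    show "f (x \<otimes>\<^bsub>E\<lparr>carrier := L\<rparr>\<^esub> y) = f x \<otimes> f y" "f (x \<oplus>\<^bsub>E\<lparr>carrier := L\<rparr>\<^esub> y) = f x \<oplus> f y"
      using that xy subdivring_closed[OF L] g
      by (auto simp: Gal_L_mult Gal_L_add Gal_M_mult Gal_M_add)
  next
    show "f \<one>\<^bsub>E\<lparr>carrier := L\<rparr>\<^esub> = \<one>"
      using that subdivring_one[OF L] g by (auto simp: Gal_L_one Gal_M_one)
  qed
  have fixed: "f x = x" if "f \<in> ?J" "x \<in> F" for f x
    using that Gal_fixes[OF g] subsetD[OF F_subset_H] subsetD[OF F_subset_L] by (auto simp: Gal_fixes)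
  have "\<exists>i\<in>?J. \<exists>j\<in>?J. i \<noteq> j \<and> conj_on E L i j"
  proof (rule conj_on_if_card_gt[OF _ finite_B basis_subset _ subdivring_imp_subring[OF L] F_subset_L basis_spans])
    show "card B < card ?J" using card_lin_indep_le_card_Gal[OF finite_B basis_subset basis_indep] new finite_Gal by simp
  qed (use finite_Gal hom fixed in auto)
  then obtain i j where ij: "i \<in> ?J" "j \<in> ?J" "i \<noteq> j" "conj_on E L i j" by blast
  have "i x = j x" if x: "x \<in> L" for x
  proof -
    have closed: "i x \<in> carrier E" "j x \<in> carrier E" using J_carrier ij x by auto
    consider "i \<in> carrier Gal_L" | "j \<in> carrier Gal_L" using ij(1-3) by blast
    then show ?thesis
    proof cases
      case 1 then show ?thesis
        using conj_on_central_imp_eq[OF ij(4) x closed] central Gal_L_closed x by blast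
    next
      case 2 then show ?thesis
        using conj_on_central_imp_eq[OF conj_on_sym[OF ij(4) J_carrier[OF ij(1)] J_carrier[OF ij(2)]] x closed(2,1)]
          central Gal_L_closed x by metis
    qed
  qed
  moreover have "i \<in> extensional L" "j \<in> extensional L" using ij(1,2) Gal_subring_extensional by auto
  ultimately show False using ij(3) extensionalityI by blast
qed

lemma Gal_M_eqI:
  assumes f: "f \<in> carrier Gal_M" and g: "g \<in> carrier Gal_M" and eq: "\<And>x. x \<in> L \<Longrightarrow> f x = g x"
  shows "f = g"
proof (rule extensionalityI)
  show "f \<in> extensional M" "g \<in> extensional M" using f g by (auto dest: Gal_subring_extensional)
  fix x assume "x \<in> M"
  then show "f x = g x"
  proof (induction x rule: M_induct)
    case (prod h e)
    have mem: "h \<in> M" "e \<in> M" using prod H_subset_M L_subset_M by auto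
    show ?case
      using Gal_M_mult[OF f mem] Gal_M_mult[OF g mem] Gal_fixes[OF f] Gal_fixes[OF g] prod eq by simp
  next
    case (add x y) then show ?case using Gal_M_add[OF f] Gal_M_add[OF g] by simp
  qed
qed

lemma Gal_M_iso: "Gal_M \<cong> Gal_L"
proof -
  let ?\<rho> = "\<lambda>g. restrict g L"
  have "?\<rho> \<in> hom Gal_M Gal_L"
  proof (rule homI)
    fix f g assume f: "f \<in> carrier Gal_M" and g: "g \<in> carrier Gal_M"
    have "g x \<in> L" if "x \<in> L" for x using Gal_L_closed[OF restrict_Gal_M[OF g] that] that by simp
    then show "?\<rho> (f \<otimes>\<^bsub>Gal_M\<^esub> g) = ?\<rho> f \<otimes>\<^bsub>Gal_L\<^esub> ?\<rho> g"
      using L_subset_M by (auto simp: compose_def intro!: ext)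
  qed (rule restrict_Gal_M)
  moreover have "bij_betw ?\<rho> (carrier Gal_M) (carrier Gal_L)"
    unfolding bij_betw_def
  proof
    show "inj_on ?\<rho> (carrier Gal_M)"
      by (rule inj_onI, rule Gal_M_eqI) (auto dest: fun_cong split: if_splits simp: restrict_def)
    show "?\<rho> ` carrier Gal_M = carrier Gal_L"
    proof
      show "?\<rho> ` carrier Gal_M \<subseteq> carrier Gal_L" using restrict_Gal_M by auto
      show "carrier Gal_L \<subseteq> ?\<rho> ` carrier Gal_M"
      proof
        fix g assume g: "g \<in> carrier Gal_L"
        have "restrict (restrict (extend g) M) L = g"
          using Gal_subring_extensional[OF g] extend_L[OF g] L_subset_M by (intro extensionalityI[of _ L]) auto
        then show "g \<in> ?\<rho> ` carrier Gal_M" using restrict_extend_Gal[OF g] by (metis image_eqI)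
      qed
    qed
  qed
  ultimately show ?thesis unfolding is_iso_def iso_def by auto
qed

lemma outer_M: "outer (E\<lparr>carrier := M\<rparr>) H"
proof -
  interpret M: divring "E\<lparr>carrier := M\<rparr>" by (rule subdivring_divring[OF M_subdivring])
  have "u \<otimes> x = x \<otimes> u" if u: "u \<in> M" "\<forall>y\<in>H. u \<otimes> y = y \<otimes> u" and "x \<in> M" for u x
    using \<open>x \<in> M\<close>
  proof (induction x rule: M_induct)
    case (prod h e)
    have "u \<otimes> (h \<otimes> e) = h \<otimes> (u \<otimes> e)" using prod u by (simp flip: m_assoc)
    also have "\<dots> = (h \<otimes> e) \<otimes> u" using prod u central[of e u] by (simp add: m_assoc)
    finally show ?case .
  next
    case (add x y) then show ?case using u by (simp add: r_distr l_distr)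
  qed
  then show ?thesis using M.outer_iff_commute[of H] H_subset_M by (simp, blast)
qed

lemma trace_extend_in_H:
  assumes "y \<in> M" shows "(\<Oplus>g\<in>carrier Gal_L. extend g y) \<in> H"
  using assms
proof (induction y rule: M_induct)
  case (prod h e)
  have "(\<Oplus>g\<in>carrier Gal_L. extend g (h \<otimes> e)) = (\<Oplus>g\<in>carrier Gal_L. h \<otimes> g e)"
    using prod by (intro finsum_cong') (auto simp: extend_prod)
  also have "\<dots> = h \<otimes> trace e"
    unfolding trace_def using prod finite_Gal by (intro finsum_rdistr[symmetric]) auto
  finally show ?case using prod trace_in_F[of e] F_subset_H subdivring_mult[OF H] by auto
next
  case (add x y)
  have "(\<Oplus>g\<in>carrier Gal_L. extend g (x \<oplus> y)) = (\<Oplus>g\<in>carrier Gal_L. extend g x \<oplus> extend g y)"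
    using add extend_closed by (intro finsum_cong') (auto simp: extend_add)
  also have "\<dots> = (\<Oplus>g\<in>carrier Gal_L. extend g x) \<oplus> (\<Oplus>g\<in>carrier Gal_L. extend g y)"
    using add extend_closed by (intro finsum_addf) auto
  finally show ?case using add subdivring_add[OF H] by auto
qed

text \<open>If \<open>x\<close> is fixed and \<open>e \<in> L\<close> has nonzero trace \<open>t\<close>, then \<open>x t\<close> is the trace of \<open>x e\<close>, so it lies in
  \<open>H\<close>.\<close>

lemma galois_M: "galois (E\<lparr>carrier := M\<rparr>) H"
proof -
  have "x \<in> H" if x: "x \<in> M" and fixed: "\<And>g. g \<in> carrier Gal_M \<Longrightarrow> g x = x" for x
  proof -
    have extend_x: "extend g x = x" if "g \<in> carrier Gal_L" for g using fixed[OF restrict_extend_Gal[OF that]] x by simp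
    obtain e where e: "e \<in> L" "trace e \<noteq> \<zero>" using trace_nonzero by blast
    have trace_e: "trace e \<in> H" using trace_in_F[OF e(1)] F_subset_H by blast
    have "e \<in> M" using e(1) L_subset_M by blast
    then have "(\<Oplus>g\<in>carrier Gal_L. extend g (x \<otimes> e)) = (\<Oplus>g\<in>carrier Gal_L. x \<otimes> g e)"
      using x e by (intro finsum_cong') (auto simp: extend_mult extend_L extend_x)
    also have "\<dots> = x \<otimes> trace e" unfolding trace_def using x e finite_Gal by (intro finsum_rdistr[symmetric]) auto
    finally have "x \<otimes> trace e \<in> H" using trace_extend_in_H M_mult[OF x \<open>e \<in> M\<close>] by metis
    then have "(x \<otimes> trace e) \<otimes> inv (trace e) \<in> H" using trace_e e(2) subdivring_mult[OF H] subdivring_inv[OF H] by blast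
    then show "x \<in> H" using trace_e e(2) x by (simp add: m_assoc)
  qed
  then show ?thesis unfolding galois_def using H_subset_M Gal_fixes[of _ "E\<lparr>carrier := M\<rparr>" H] by auto
qed

end

theorem (in central_compositum) compositum_galois:
  obtains B where "finite B" "B \<subseteq> L" "subdivring (lin_span E H B) E" "H \<subseteq> lin_span E H B"
    "outer (E\<lparr>carrier := lin_span E H B\<rparr>) H" "galois (E\<lparr>carrier := lin_span E H B\<rparr>) H"
    "Gal (E\<lparr>carrier := lin_span E H B\<rparr>) H \<cong> Gal (E\<lparr>carrier := L\<rparr>) F"
proof -
  obtain B where B: "finite B" "B \<subseteq> L" "lin_indep E F B" "L \<subseteq> lin_span E F B"
    by (rule basis_exists)
  interpret compositum_basis E F L H B by unfold_locales (use B in auto)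
  show thesis
    by (rule that[OF B(1,2) M_subdivring H_subset_M outer_M galois_M Gal_M_iso])
qed

section \<open>Twisted series\<close>

definition twisted_series ::
  "('a,'m) ring_scheme \<Rightarrow> 'a set \<Rightarrow> 'g::linordered_idom set \<Rightarrow> ('g \<Rightarrow> 'a \<Rightarrow> 'a) \<Rightarrow> ('g \<Rightarrow> 'a) ring" where
  "twisted_series R K \<Gamma> \<tau> = \<lparr>carrier = {f. (\<forall>s. f s \<in> K) \<and> (\<forall>s. f s \<noteq> \<zero>\<^bsub>R\<^esub> \<longrightarrow> s \<in> \<Gamma>) \<and>
        (\<forall>x. finite {s. f s \<noteq> \<zero>\<^bsub>R\<^esub> \<and> s \<le> x})},
     monoid.mult = (\<lambda>f g r. \<Oplus>\<^bsub>R\<^esub>s\<in>{s. f s \<noteq> \<zero>\<^bsub>R\<^esub> \<and> g (r - s) \<noteq> \<zero>\<^bsub>R\<^esub>}. f s \<otimes>\<^bsub>R\<^esub> \<tau> s (g (r - s))),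
     one = (\<lambda>s. if s = 0 then \<one>\<^bsub>R\<^esub> else \<zero>\<^bsub>R\<^esub>),
     ring.zero = (\<lambda>s. \<zero>\<^bsub>R\<^esub>),
     ring.add = (\<lambda>f g s. f s \<oplus>\<^bsub>R\<^esub> g s)\<rparr>"

lemma mem_twisted_series:
  "f \<in> carrier (twisted_series R K \<Gamma> \<tau>) \<longleftrightarrow> (\<forall>s. f s \<in> K) \<and> (\<forall>s. f s \<noteq> \<zero>\<^bsub>R\<^esub> \<longrightarrow> s \<in> \<Gamma>) \<and>
        (\<forall>x. finite {s. f s \<noteq> \<zero>\<^bsub>R\<^esub> \<and> s \<le> x})"
  by (simp add: twisted_series_def)

lemma twisted_series_apply [simp]:
  "\<one>\<^bsub>twisted_series R K \<Gamma> \<tau>\<^esub> s = (if s = 0 then \<one>\<^bsub>R\<^esub> else \<zero>\<^bsub>R\<^esub>)"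
  "\<zero>\<^bsub>twisted_series R K \<Gamma> \<tau>\<^esub> s = \<zero>\<^bsub>R\<^esub>"
  "(f \<oplus>\<^bsub>twisted_series R K \<Gamma> \<tau>\<^esub> g) s = f s \<oplus>\<^bsub>R\<^esub> g s"
  by (simp_all add: twisted_series_def)

lemma twisted_series_mult_apply:
  "(f \<otimes>\<^bsub>twisted_series R K \<Gamma> \<tau>\<^esub> g) r =
     (\<Oplus>\<^bsub>R\<^esub>s\<in>{s. f s \<noteq> \<zero>\<^bsub>R\<^esub> \<and> g (r - s) \<noteq> \<zero>\<^bsub>R\<^esub>}. f s \<otimes>\<^bsub>R\<^esub> \<tau> s (g (r - s)))"
  by (simp add: twisted_series_def)

definition monom_at :: "('a,'m) ring_scheme \<Rightarrow> 'a \<Rightarrow> 'g \<Rightarrow> 'g \<Rightarrow> 'a" where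
  "monom_at R a s = (\<lambda>r. if r = s then a else \<zero>\<^bsub>R\<^esub>)"

lemma monom_at_same [simp]: "monom_at R a s s = a"
  and monom_at_other [simp]: "r \<noteq> s \<Longrightarrow> monom_at R a s r = \<zero>\<^bsub>R\<^esub>"
  by (simp_all add: monom_at_def)

definition along :: "('a,'m) ring_scheme \<Rightarrow> ('i \<Rightarrow> 'g) \<Rightarrow> ('i \<Rightarrow> 'a) \<Rightarrow> 'g \<Rightarrow> 'a" where
  "along R \<rho> f t = (if t \<in> range \<rho> then f (inv_into UNIV \<rho> t) else \<zero>\<^bsub>R\<^esub>)"

lemma along_apply [simp]: "inj \<rho> \<Longrightarrow> along R \<rho> f (\<rho> i) = f i"
  and along_outside [simp]: "t \<notin> range \<rho> \<Longrightarrow> along R \<rho> f t = \<zero>\<^bsub>R\<^esub>"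
  by (simp_all add: along_def)

lemma along_nonzeroE:
  assumes "along R \<rho> f t \<noteq> \<zero>\<^bsub>R\<^esub>" "inj \<rho>"
  obtains i where "t = \<rho> i" "f i \<noteq> \<zero>\<^bsub>R\<^esub>"
  using assms by (cases "t \<in> range \<rho>") auto

lemma along_eqI:
  assumes "inj \<rho>" "\<And>i. g (\<rho> i) = f i" "\<And>t. t \<notin> range \<rho> \<Longrightarrow> g t = \<zero>\<^bsub>R\<^esub>"
  shows "along R \<rho> f = g"
proof
  fix t show "along R \<rho> f t = g t" using assms by (cases "t \<in> range \<rho>") auto
qed

lemma along_inject: "inj \<rho> \<Longrightarrow> along R \<rho> f = along R \<rho> g \<longleftrightarrow> f = g"
  by (metis along_apply ext)

lemma along_monom: "inj \<rho> \<Longrightarrow> along R \<rho> (monom_at R a i) = monom_at R a (\<rho> i)"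
  by (rule along_eqI) (auto simp: monom_at_def inj_eq)

lemma (in ring) geometric_sum:
  assumes g: "g \<in> carrier R"
  shows "(\<one> \<ominus> g) \<otimes> (\<Oplus>k\<in>{..<n}. g [^] k) = \<one> \<ominus> g [^] (n::nat)"
proof (induction n)
  case 0 show ?case using g by (simp add: a_minus_def r_neg)
next
  case (Suc n)
  have "(\<Oplus>k\<in>{..<Suc n}. g [^] k) = g [^] n \<oplus> (\<Oplus>k\<in>{..<n}. g [^] k)"
    unfolding lessThan_Suc using g by (subst finsum_insert) auto
  then have "(\<one> \<ominus> g) \<otimes> (\<Oplus>k\<in>{..<Suc n}. g [^] k) = (\<one> \<ominus> g) \<otimes> g [^] n \<oplus> (\<one> \<ominus> g [^] n)"
    using Suc g by (simp add: r_distr)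
  also have "(\<one> \<ominus> g) \<otimes> g [^] n = g [^] n \<ominus> g [^] Suc n"
    using g by (simp add: a_minus_def l_distr l_minus nat_pow_Suc2[symmetric] del: nat_pow_Suc)
  also have "(g [^] n \<ominus> g [^] Suc n) \<oplus> (\<one> \<ominus> g [^] n) = \<one> \<ominus> g [^] Suc n"
    using g unfolding a_minus_def by (simp add: a_ac r_neg r_neg2 del: nat_pow_Suc)
  finally show ?case .
qed

locale series_twist = divring R for R (structure) +
  fixes K :: "'a set" and \<Gamma> :: "'g::linordered_idom set" and \<tau> :: "'g \<Rightarrow> 'a \<Rightarrow> 'a"
  assumes K: "subdivring K R"
    and archimedean: "\<And>x \<epsilon>::'g. 0 < \<epsilon> \<Longrightarrow> \<exists>n::nat. x < of_nat n * \<epsilon>"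
    and \<Gamma>_0: "0 \<in> \<Gamma>" and \<Gamma>_add: "\<And>s t. s \<in> \<Gamma> \<Longrightarrow> t \<in> \<Gamma> \<Longrightarrow> s + t \<in> \<Gamma>"
    and \<Gamma>_uminus: "\<And>s. s \<in> \<Gamma> \<Longrightarrow> - s \<in> \<Gamma>"
    and \<tau>_closed: "\<And>s x. x \<in> K \<Longrightarrow> \<tau> s x \<in> K"
    and \<tau>_add: "\<And>s x y. x \<in> K \<Longrightarrow> y \<in> K \<Longrightarrow> \<tau> s (x \<oplus> y) = \<tau> s x \<oplus> \<tau> s y"
    and \<tau>_mult: "\<And>s x y. x \<in> K \<Longrightarrow> y \<in> K \<Longrightarrow> \<tau> s (x \<otimes> y) = \<tau> s x \<otimes> \<tau> s y"
    and \<tau>_one [simp]: "\<And>s. \<tau> s \<one> = \<one>"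
    and \<tau>_0: "\<And>x. x \<in> K \<Longrightarrow> \<tau> 0 x = x"
    and \<tau>_comp: "\<And>s t x. s \<in> \<Gamma> \<Longrightarrow> t \<in> \<Gamma> \<Longrightarrow> x \<in> K \<Longrightarrow> \<tau> (s + t) x = \<tau> s (\<tau> t x)"
begin

abbreviation "S \<equiv> twisted_series R K \<Gamma> \<tau>"

lemma \<tau>_zero [simp]: "\<tau> s \<zero> = \<zero>"
  using \<tau>_add[of \<zero> \<zero> s] \<tau>_closed[of \<zero> s] subdivring_zero[OF K] subdivring_carrier[OF K] by simp

lemma \<tau>_finsum:
  assumes "finite A" "f \<in> A \<rightarrow> K" shows "\<tau> s (\<Oplus>i\<in>A. f i) = (\<Oplus>i\<in>A. \<tau> s (f i))"
  by (rule additive_finsum[OF ring_axioms assms])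
     (use subdivring_closed[OF K] subdivring_carrier[OF K] \<tau>_closed \<tau>_add in auto)

lemma
  assumes "f \<in> carrier S"
  shows coeff_in_K: "f s \<in> K"
    and support_subset: "f s \<noteq> \<zero> \<Longrightarrow> s \<in> \<Gamma>"
    and finite_support_le: "finite {s. f s \<noteq> \<zero> \<and> s \<le> x}"
    and coeff_carrier [simp]: "f s \<in> carrier R"
    and \<tau>_coeff_carrier [simp]: "\<tau> t (f s) \<in> carrier R"
  using assms subdivring_carrier[OF K] \<tau>_closed by (auto simp: mem_twisted_series)

lemma support_lower_bound:
  assumes "f \<in> carrier S" obtains a where "\<And>s. f s \<noteq> \<zero> \<Longrightarrow> a \<le> s"
proof -
  let ?A = "insert 0 {s. f s \<noteq> \<zero> \<and> s \<le> 0}"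
  have fin: "finite ?A" using finite_support_le[OF assms] by simp
  have "Min ?A \<le> s" if "f s \<noteq> \<zero>" for s
  proof (cases "s \<le> 0")
    case True then show ?thesis using fin that by (intro Min_le) auto
  next
    case False
    have "Min ?A \<le> 0" using fin by (intro Min_le) auto
    then show ?thesis using False by simp
  qed
  then show thesis by (rule that)
qed

lemma support_positive_lower_bound:
  assumes f: "f \<in> carrier S" and pos: "\<And>s. f s \<noteq> \<zero> \<Longrightarrow> 0 < s"
  obtains \<epsilon> where "0 < \<epsilon>" "\<And>s. f s \<noteq> \<zero> \<Longrightarrow> \<epsilon> \<le> s"
proof -
  let ?A = "insert 1 {s. f s \<noteq> \<zero> \<and> s \<le> 1}"
  have fin: "finite ?A" using finite_support_le[OF f] by simp
  have "Min ?A \<le> s" if "f s \<noteq> \<zero>" for s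
  proof (cases "s \<le> 1")
    case True then show ?thesis using fin that by (intro Min_le) auto
  next
    case False
    have "Min ?A \<le> 1" using fin by (intro Min_le) auto
    then show ?thesis using False by simp
  qed
  moreover have "0 < Min ?A" using fin pos by (subst Min_gr_iff) auto
  ultimately show thesis using that by blast
qed

lemma least_exponent:
  assumes f: "f \<in> carrier S" "f \<noteq> \<zero>\<^bsub>S\<^esub>"
  obtains m where "f m \<noteq> \<zero>" "\<And>s. s < m \<Longrightarrow> f s = \<zero>"
proof -
  obtain s\<^sub>1 where s\<^sub>1: "f s\<^sub>1 \<noteq> \<zero>" using f(2) by (auto simp: fun_eq_iff)
  let ?A = "{s. f s \<noteq> \<zero> \<and> s \<le> s\<^sub>1}"
  have fin: "finite ?A" by (rule finite_support_le[OF f(1)])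
  have Min: "Min ?A \<in> ?A" using fin s\<^sub>1 by (intro Min_in) auto
  have "f s = \<zero>" if "s < Min ?A" for s
  proof (rule ccontr)
    assume "f s \<noteq> \<zero>"
    then have "Min ?A \<le> s" using fin that Min by (intro Min_le) auto
    then show False using that by simp
  qed
  then show thesis using that Min by blast
qed

lemma finite_mult_support:
  assumes f: "f \<in> carrier S" and g: "g \<in> carrier S"
  shows "finite {s. f s \<noteq> \<zero> \<and> g (r - s) \<noteq> \<zero>}"
proof -
  obtain b where b: "\<And>s. g s \<noteq> \<zero> \<Longrightarrow> b \<le> s" using support_lower_bound[OF g] by blast
  have "{s. f s \<noteq> \<zero> \<and> g (r - s) \<noteq> \<zero>} \<subseteq> {s. f s \<noteq> \<zero> \<and> s \<le> r - b}"
    using b by (force simp: algebra_simps)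
  then show ?thesis using finite_support_le[OF f] finite_subset by blast
qed

lemma mult_eq:
  assumes f: "f \<in> carrier S" and g: "g \<in> carrier S"
    and A: "finite A" "\<And>s. f s \<noteq> \<zero> \<Longrightarrow> g (r - s) \<noteq> \<zero> \<Longrightarrow> s \<in> A"
  shows "(f \<otimes>\<^bsub>S\<^esub> g) r = (\<Oplus>s\<in>A. f s \<otimes> \<tau> s (g (r - s)))"
  unfolding twisted_series_mult_apply
proof (rule add.finprod_mono_neutral_cong_left)
  fix s assume "s \<in> A - {s. f s \<noteq> \<zero> \<and> g (r - s) \<noteq> \<zero>}"
  then consider "f s = \<zero>" | "g (r - s) = \<zero>" by auto
  then show "f s \<otimes> \<tau> s (g (r - s)) = \<zero>" by cases (use f g in auto)
qed (use A f g in auto)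

lemma mult_nonzeroE:
  assumes "(f \<otimes>\<^bsub>S\<^esub> g) r \<noteq> \<zero>" obtains s where "f s \<noteq> \<zero>" "g (r - s) \<noteq> \<zero>"
proof -
  have "{s. f s \<noteq> \<zero> \<and> g (r - s) \<noteq> \<zero>} \<noteq> {}"
    using assms unfolding twisted_series_mult_apply by (metis (lifting) finsum_empty)
  then show thesis using that by auto
qed

lemma mult_closed:
  assumes f: "f \<in> carrier S" and g: "g \<in> carrier S" shows "f \<otimes>\<^bsub>S\<^esub> g \<in> carrier S"
  unfolding mem_twisted_series
proof (intro conjI allI impI)
  fix r
  show "(f \<otimes>\<^bsub>S\<^esub> g) r \<in> K" unfolding twisted_series_mult_apply
    by (rule finsum_mem_subring[OF subdivring_imp_subring[OF K] finite_mult_support[OF f g]])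
       (use coeff_in_K f g \<tau>_closed subdivring_mult[OF K] in auto)
  show "r \<in> \<Gamma>" if nonzero: "(f \<otimes>\<^bsub>S\<^esub> g) r \<noteq> \<zero>"
  proof -
    obtain s where "f s \<noteq> \<zero>" "g (r - s) \<noteq> \<zero>" using mult_nonzeroE[OF nonzero] by blast
    then have "s + (r - s) \<in> \<Gamma>" using support_subset f g by (intro \<Gamma>_add) auto
    then show ?thesis by simp
  qed
next
  fix x
  obtain a b where a: "\<And>s. f s \<noteq> \<zero> \<Longrightarrow> a \<le> s" and b: "\<And>s. g s \<noteq> \<zero> \<Longrightarrow> b \<le> s"
    using support_lower_bound[OF f] support_lower_bound[OF g] by metis
  let ?A = "{s. f s \<noteq> \<zero> \<and> s \<le> x - b}" and ?B = "{t. g t \<noteq> \<zero> \<and> t \<le> x - a}"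
  have "{s. (f \<otimes>\<^bsub>S\<^esub> g) s \<noteq> \<zero> \<and> s \<le> x} \<subseteq> (\<lambda>(s,t). s + t) ` (?A \<times> ?B)"
  proof
    fix r assume "r \<in> {s. (f \<otimes>\<^bsub>S\<^esub> g) s \<noteq> \<zero> \<and> s \<le> x}"
    then have r: "(f \<otimes>\<^bsub>S\<^esub> g) r \<noteq> \<zero>" "r \<le> x" by auto
    obtain s where s: "f s \<noteq> \<zero>" "g (r - s) \<noteq> \<zero>" using mult_nonzeroE[OF r(1)] by blast
    then have "s \<le> x - b" "r - s \<le> x - a" using a[of s] b[of "r - s"] r(2) by (auto simp: algebra_simps)
    then show "r \<in> (\<lambda>(s,t). s + t) ` (?A \<times> ?B)"
      using s by (intro image_eqI[of _ _ "(s, r - s)"]) auto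
  qed
  moreover have "finite \<dots>" using finite_support_le[OF f] finite_support_le[OF g] by auto
  ultimately show "finite {s. (f \<otimes>\<^bsub>S\<^esub> g) s \<noteq> \<zero> \<and> s \<le> x}" by (rule finite_subset)
qed

lemma mult_apply_ldistr:
  assumes f: "f \<in> carrier S" and g: "g \<in> carrier S" and x: "x \<in> carrier R" and A: "finite A"
    and support: "\<And>s. x \<noteq> \<zero> \<Longrightarrow> f s \<noteq> \<zero> \<Longrightarrow> g (u - s) \<noteq> \<zero> \<Longrightarrow> s \<in> A"
  shows "(f \<otimes>\<^bsub>S\<^esub> g) u \<otimes> x = (\<Oplus>s\<in>A. f s \<otimes> \<tau> s (g (u - s)) \<otimes> x)"
proof (cases "x = \<zero>")
  case True
  have "(\<Oplus>s\<in>A. f s \<otimes> \<tau> s (g (u - s)) \<otimes> x) = \<zero>" by (rule add.finprod_one_eqI) (use True f g in simp)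
  then show ?thesis using True mult_closed[OF f g] by simp
next
  case False
  have "(f \<otimes>\<^bsub>S\<^esub> g) u = (\<Oplus>s\<in>A. f s \<otimes> \<tau> s (g (u - s)))" by (rule mult_eq[OF f g A support[OF False]])
  then show ?thesis using A f g x by (simp add: finsum_ldistr)
qed

lemma triple_product_left:
  fixes r :: 'g
  assumes f: "f \<in> carrier S" and g: "g \<in> carrier S" and h: "h \<in> carrier S"
    and a: "\<And>s. f s \<noteq> \<zero> \<Longrightarrow> a \<le> s" and b: "\<And>s. g s \<noteq> \<zero> \<Longrightarrow> b \<le> s" and c: "\<And>s. h s \<noteq> \<zero> \<Longrightarrow> c \<le> s"
  defines "A \<equiv> {s. f s \<noteq> \<zero> \<and> s \<le> r - b - c}" and "B \<equiv> {t. g t \<noteq> \<zero> \<and> t \<le> r - a - c}"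
  shows "((f \<otimes>\<^bsub>S\<^esub> g) \<otimes>\<^bsub>S\<^esub> h) r = (\<Oplus>s\<in>A. \<Oplus>t\<in>B. f s \<otimes> \<tau> s (g t) \<otimes> \<tau> (s + t) (h (r - s - t)))"
proof -
  have finA: "finite A" and finB: "finite B"
    using finite_support_le[OF f] finite_support_le[OF g] by (auto simp: A_def B_def)
  define U where "U = (\<lambda>(s,t). s + t) ` (A \<times> B)"
  have finU: "finite U" using finA finB by (auto simp: U_def)
  let ?T = "\<lambda>u s. f s \<otimes> \<tau> s (g (u - s)) \<otimes> \<tau> u (h (r - u))"
  have T: "?T u s \<in> carrier R" for u s using f g h by simp
  have sum_u: "(f \<otimes>\<^bsub>S\<^esub> g) u \<otimes> \<tau> u (h (r - u)) = (\<Oplus>s\<in>A. ?T u s)" for u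
  proof (rule mult_apply_ldistr[OF f g _ finA])
    fix s assume "\<tau> u (h (r - u)) \<noteq> \<zero>" "f s \<noteq> \<zero>" "g (u - s) \<noteq> \<zero>"
    moreover from this have "h (r - u) \<noteq> \<zero>" by auto
    ultimately show "s \<in> A" using b[of "u - s"] c[of "r - u"] by (auto simp: A_def algebra_simps)
  qed (use h in simp)
  have sum_s: "(\<Oplus>u\<in>U. ?T u s) = (\<Oplus>t\<in>B. ?T (s + t) s)" if s: "s \<in> A" for s
  proof -
    have "(\<Oplus>u\<in>(\<lambda>t. s + t) ` B. ?T u s) = (\<Oplus>u\<in>U. ?T u s)"
    proof (rule add.finprod_mono_neutral_cong_left[OF finU])
      show "(\<lambda>t. s + t) ` B \<subseteq> U" using s by (auto simp: U_def)
      fix u assume u: "u \<in> U - (\<lambda>t. s + t) ` B"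
      have "g (u - s) = \<zero> \<or> h (r - u) = \<zero>"
      proof (rule ccontr)
        assume "\<not> ?thesis"
        then have "u - s \<in> B" using a[of s] c[of "r - u"] s by (auto simp: A_def B_def algebra_simps)
        then show False using u image_eqI[of u "\<lambda>t. s + t" "u - s" B] by auto
      qed
      then show "?T u s = \<zero>" using f g h by auto
    qed (use T in auto)
    also have "(\<Oplus>u\<in>(\<lambda>t. s + t) ` B. ?T u s) = (\<Oplus>t\<in>B. ?T (s + t) s)"
      using T by (intro finsum_reindex) (auto simp: inj_on_def)
    finally show ?thesis by simp
  qed
  have "((f \<otimes>\<^bsub>S\<^esub> g) \<otimes>\<^bsub>S\<^esub> h) r = (\<Oplus>u\<in>U. (f \<otimes>\<^bsub>S\<^esub> g) u \<otimes> \<tau> u (h (r - u)))"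
  proof (rule mult_eq[OF mult_closed[OF f g] h finU])
    fix u assume u: "(f \<otimes>\<^bsub>S\<^esub> g) u \<noteq> \<zero>" and hu: "h (r - u) \<noteq> \<zero>"
    obtain s where s: "f s \<noteq> \<zero>" "g (u - s) \<noteq> \<zero>" using mult_nonzeroE[OF u] by blast
    then have "s \<in> A" "u - s \<in> B"
      using a[OF s(1)] b[OF s(2)] c[OF hu] by (auto simp: A_def B_def algebra_simps)
    then show "u \<in> U" unfolding U_def by (intro image_eqI[of _ _ "(s, u - s)"]) auto
  qed
  also have "\<dots> = (\<Oplus>s\<in>A. \<Oplus>u\<in>U. ?T u s)" unfolding sum_u using finA finU T by (intro finsum_swap) auto
  also have "\<dots> = (\<Oplus>s\<in>A. \<Oplus>t\<in>B. ?T (s + t) s)"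
    by (rule finsum_cong'[OF refl _ sum_s]) (use f g h in auto)
  finally show ?thesis by (simp add: algebra_simps)
qed

lemma triple_product_right:
  fixes r :: 'g
  assumes f: "f \<in> carrier S" and g: "g \<in> carrier S" and h: "h \<in> carrier S"
    and a: "\<And>s. f s \<noteq> \<zero> \<Longrightarrow> a \<le> s" and b: "\<And>s. g s \<noteq> \<zero> \<Longrightarrow> b \<le> s" and c: "\<And>s. h s \<noteq> \<zero> \<Longrightarrow> c \<le> s"
  defines "A \<equiv> {s. f s \<noteq> \<zero> \<and> s \<le> r - b - c}" and "B \<equiv> {t. g t \<noteq> \<zero> \<and> t \<le> r - a - c}"
  shows "(f \<otimes>\<^bsub>S\<^esub> (g \<otimes>\<^bsub>S\<^esub> h)) r = (\<Oplus>s\<in>A. \<Oplus>t\<in>B. f s \<otimes> \<tau> s (g t) \<otimes> \<tau> (s + t) (h (r - s - t)))"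
proof -
  have finA: "finite A" and finB: "finite B"
    using finite_support_le[OF f] finite_support_le[OF g] by (auto simp: A_def B_def)
  have inner: "f s \<otimes> \<tau> s ((g \<otimes>\<^bsub>S\<^esub> h) (r - s)) = (\<Oplus>t\<in>B. f s \<otimes> \<tau> s (g t) \<otimes> \<tau> (s + t) (h (r - s - t)))"
    if s: "s \<in> A" for s
  proof -
    have comp: "\<tau> s (g t \<otimes> \<tau> t (h (r - s - t))) = \<tau> s (g t) \<otimes> \<tau> (s + t) (h (r - s - t))" if "t \<in> B" for t
      using s that support_subset[OF f] support_subset[OF g] coeff_in_K[OF g] coeff_in_K[OF h] \<tau>_closed
      by (simp add: A_def B_def \<tau>_mult \<tau>_comp)
    have "(g \<otimes>\<^bsub>S\<^esub> h) (r - s) = (\<Oplus>t\<in>B. g t \<otimes> \<tau> t (h (r - s - t)))"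
    proof (rule mult_eq[OF g h finB])
      fix t assume "g t \<noteq> \<zero>" "h (r - s - t) \<noteq> \<zero>"
      then show "t \<in> B" using a[of s] c[of "r - s - t"] s by (auto simp: A_def B_def algebra_simps)
    qed
    then have "\<tau> s ((g \<otimes>\<^bsub>S\<^esub> h) (r - s)) = (\<Oplus>t\<in>B. \<tau> s (g t \<otimes> \<tau> t (h (r - s - t))))"
      using finB coeff_in_K[OF g] coeff_in_K[OF h] \<tau>_closed subdivring_mult[OF K] by (simp add: \<tau>_finsum)
    also have "\<dots> = (\<Oplus>t\<in>B. \<tau> s (g t) \<otimes> \<tau> (s + t) (h (r - s - t)))"
      using comp g h by (intro finsum_cong') auto
    finally have "f s \<otimes> \<tau> s ((g \<otimes>\<^bsub>S\<^esub> h) (r - s)) =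
        (\<Oplus>t\<in>B. f s \<otimes> (\<tau> s (g t) \<otimes> \<tau> (s + t) (h (r - s - t))))"
      using finB f g h by (simp add: finsum_rdistr)
    then show ?thesis using f g h by (simp add: m_assoc)
  qed
  have "(f \<otimes>\<^bsub>S\<^esub> (g \<otimes>\<^bsub>S\<^esub> h)) r = (\<Oplus>s\<in>A. f s \<otimes> \<tau> s ((g \<otimes>\<^bsub>S\<^esub> h) (r - s)))"
  proof (rule mult_eq[OF f mult_closed[OF g h] finA])
    fix s assume s: "f s \<noteq> \<zero>" "(g \<otimes>\<^bsub>S\<^esub> h) (r - s) \<noteq> \<zero>"
    obtain t where "g t \<noteq> \<zero>" "h (r - s - t) \<noteq> \<zero>" using mult_nonzeroE[OF s(2)] by blast
    then show "s \<in> A" using b[of t] c[of "r - s - t"] s by (auto simp: A_def algebra_simps)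
  qed
  also have "\<dots> = (\<Oplus>s\<in>A. \<Oplus>t\<in>B. f s \<otimes> \<tau> s (g t) \<otimes> \<tau> (s + t) (h (r - s - t)))"
    using inner f g h by (intro finsum_cong') auto
  finally show ?thesis .
qed

lemma mult_assoc:
  assumes "f \<in> carrier S" "g \<in> carrier S" "h \<in> carrier S"
  shows "f \<otimes>\<^bsub>S\<^esub> g \<otimes>\<^bsub>S\<^esub> h = f \<otimes>\<^bsub>S\<^esub> (g \<otimes>\<^bsub>S\<^esub> h)"
proof
  fix r
  obtain a b c where "\<And>s. f s \<noteq> \<zero> \<Longrightarrow> a \<le> s" "\<And>s. g s \<noteq> \<zero> \<Longrightarrow> b \<le> s" "\<And>s. h s \<noteq> \<zero> \<Longrightarrow> c \<le> s"
    using assms support_lower_bound by metis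
  then show "(f \<otimes>\<^bsub>S\<^esub> g \<otimes>\<^bsub>S\<^esub> h) r = (f \<otimes>\<^bsub>S\<^esub> (g \<otimes>\<^bsub>S\<^esub> h)) r"
    using triple_product_left[OF assms, of a b c r] triple_product_right[OF assms, of a b c r] by simp
qed

lemma monom_closed: "a \<in> K \<Longrightarrow> s \<in> \<Gamma> \<Longrightarrow> monom_at R a s \<in> carrier S"
  using subdivring_zero[OF K] by (auto simp: mem_twisted_series monom_at_def intro: finite_subset[of _ "{s}"])

lemma monom_mult_apply:
  assumes "a \<in> K" "s \<in> \<Gamma>" "f \<in> carrier S"
  shows "(monom_at R a s \<otimes>\<^bsub>S\<^esub> f) r = a \<otimes> \<tau> s (f (r - s))"
proof -
  have "(monom_at R a s \<otimes>\<^bsub>S\<^esub> f) r = (\<Oplus>t\<in>{s}. monom_at R a s t \<otimes> \<tau> t (f (r - t)))"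
    by (rule mult_eq[OF monom_closed[OF assms(1,2)] assms(3)]) (auto simp: monom_at_def split: if_splits)
  then show ?thesis using assms subdivring_carrier[OF K] by (simp add: finsum_insert)
qed

lemma monom_one: "monom_at R \<one> 0 = \<one>\<^bsub>S\<^esub>"
  by (auto simp: monom_at_def)

lemma monom_mult_monom:
  assumes "a \<in> K" "b \<in> K" "s \<in> \<Gamma>" "t \<in> \<Gamma>"
  shows "monom_at R a s \<otimes>\<^bsub>S\<^esub> monom_at R b t = monom_at R (a \<otimes> \<tau> s b) (s + t)"
proof
  fix r
  have "r - s = t \<longleftrightarrow> r = s + t" by (auto simp: algebra_simps)
  then show "(monom_at R a s \<otimes>\<^bsub>S\<^esub> monom_at R b t) r = monom_at R (a \<otimes> \<tau> s b) (s + t) r"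
    using assms subdivring_carrier[OF K] monom_mult_apply[OF assms(1,3) monom_closed[OF assms(2,4)], of r]
    by (simp add: monom_at_def)
qed

lemma add_closed:
  assumes f: "f \<in> carrier S" and g: "g \<in> carrier S" shows "f \<oplus>\<^bsub>S\<^esub> g \<in> carrier S"
proof -
  have nonzero: "f s \<noteq> \<zero> \<or> g s \<noteq> \<zero>" if "f s \<oplus> g s \<noteq> \<zero>" for s using that by auto
  have "finite {s. f s \<oplus> g s \<noteq> \<zero> \<and> s \<le> x}" for x
    by (rule finite_subset[of _ "{s. f s \<noteq> \<zero> \<and> s \<le> x} \<union> {s. g s \<noteq> \<zero> \<and> s \<le> x}"])
       (use finite_support_le f g nonzero in auto)
  moreover have "s \<in> \<Gamma>" if "f s \<oplus> g s \<noteq> \<zero>" for s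
    using nonzero[OF that] support_subset[OF f] support_subset[OF g] by blast
  ultimately show ?thesis
    using coeff_in_K[OF f] coeff_in_K[OF g] subdivring_add[OF K] by (simp add: mem_twisted_series)
qed

lemma uminus_closed:
  assumes f: "f \<in> carrier S" shows "(\<lambda>s. \<ominus> f s) \<in> carrier S"
proof -
  have "\<ominus> f s \<noteq> \<zero> \<longleftrightarrow> f s \<noteq> \<zero>" for s using f by (metis coeff_carrier minus_minus minus_zero)
  then show ?thesis
    using coeff_in_K[OF f] subdivring_uminus[OF K] finite_support_le[OF f] support_subset[OF f]
    by (simp add: mem_twisted_series)
qed

lemma mult_distrib_right:
  assumes f: "f \<in> carrier S" and g: "g \<in> carrier S" and h: "h \<in> carrier S"
  shows "(f \<oplus>\<^bsub>S\<^esub> g) \<otimes>\<^bsub>S\<^esub> h = f \<otimes>\<^bsub>S\<^esub> h \<oplus>\<^bsub>S\<^esub> g \<otimes>\<^bsub>S\<^esub> h"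
proof
  fix r
  let ?A = "{s. f s \<noteq> \<zero> \<and> h (r - s) \<noteq> \<zero>} \<union> {s. g s \<noteq> \<zero> \<and> h (r - s) \<noteq> \<zero>}"
  have A: "finite ?A" using finite_mult_support f g h by auto
  have "((f \<oplus>\<^bsub>S\<^esub> g) \<otimes>\<^bsub>S\<^esub> h) r = (\<Oplus>s\<in>?A. (f \<oplus>\<^bsub>S\<^esub> g) s \<otimes> \<tau> s (h (r - s)))"
    by (rule mult_eq[OF add_closed[OF f g] h A]) auto
  also have "\<dots> = (\<Oplus>s\<in>?A. f s \<otimes> \<tau> s (h (r - s))) \<oplus> (\<Oplus>s\<in>?A. g s \<otimes> \<tau> s (h (r - s)))"
    using f g h finsum_coeff_add[of f ?A g "\<lambda>s. \<tau> s (h (r - s))"] by simp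
  also have "(\<Oplus>s\<in>?A. f s \<otimes> \<tau> s (h (r - s))) = (f \<otimes>\<^bsub>S\<^esub> h) r" by (rule mult_eq[OF f h A, symmetric]) auto
  also have "(\<Oplus>s\<in>?A. g s \<otimes> \<tau> s (h (r - s))) = (g \<otimes>\<^bsub>S\<^esub> h) r" by (rule mult_eq[OF g h A, symmetric]) auto
  finally show "((f \<oplus>\<^bsub>S\<^esub> g) \<otimes>\<^bsub>S\<^esub> h) r = (f \<otimes>\<^bsub>S\<^esub> h \<oplus>\<^bsub>S\<^esub> g \<otimes>\<^bsub>S\<^esub> h) r"
    by (simp only: twisted_series_apply(3)[where s = r])
qed

lemma mult_distrib_left:
  assumes f: "f \<in> carrier S" and g: "g \<in> carrier S" and h: "h \<in> carrier S"
  shows "h \<otimes>\<^bsub>S\<^esub> (f \<oplus>\<^bsub>S\<^esub> g) = h \<otimes>\<^bsub>S\<^esub> f \<oplus>\<^bsub>S\<^esub> h \<otimes>\<^bsub>S\<^esub> g"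
proof
  fix r
  let ?A = "{s. h s \<noteq> \<zero> \<and> f (r - s) \<noteq> \<zero>} \<union> {s. h s \<noteq> \<zero> \<and> g (r - s) \<noteq> \<zero>}"
  have A: "finite ?A" using finite_mult_support f g h by auto
  have "(h \<otimes>\<^bsub>S\<^esub> (f \<oplus>\<^bsub>S\<^esub> g)) r = (\<Oplus>s\<in>?A. h s \<otimes> \<tau> s ((f \<oplus>\<^bsub>S\<^esub> g) (r - s)))"
    by (rule mult_eq[OF h add_closed[OF f g] A]) auto
  also have "\<dots> = (\<Oplus>s\<in>?A. h s \<otimes> \<tau> s (f (r - s)) \<oplus> h s \<otimes> \<tau> s (g (r - s)))"
    using f g h coeff_in_K by (intro finsum_cong') (auto simp: r_distr \<tau>_add)
  also have "\<dots> = (\<Oplus>s\<in>?A. h s \<otimes> \<tau> s (f (r - s))) \<oplus> (\<Oplus>s\<in>?A. h s \<otimes> \<tau> s (g (r - s)))"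
    using f g h by (intro finsum_addf) auto
  also have "(\<Oplus>s\<in>?A. h s \<otimes> \<tau> s (f (r - s))) = (h \<otimes>\<^bsub>S\<^esub> f) r" by (rule mult_eq[OF h f A, symmetric]) auto
  also have "(\<Oplus>s\<in>?A. h s \<otimes> \<tau> s (g (r - s))) = (h \<otimes>\<^bsub>S\<^esub> g) r" by (rule mult_eq[OF h g A, symmetric]) auto
  finally show "(h \<otimes>\<^bsub>S\<^esub> (f \<oplus>\<^bsub>S\<^esub> g)) r = (h \<otimes>\<^bsub>S\<^esub> f \<oplus>\<^bsub>S\<^esub> h \<otimes>\<^bsub>S\<^esub> g) r"
    by (simp only: twisted_series_apply(3)[where s = r])
qed

lemma series_ring: "ring S"
proof (rule ringI)
  show "abelian_group S"
  proof (rule abelian_groupI)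
    show "\<zero>\<^bsub>S\<^esub> \<in> carrier S" using subdivring_zero[OF K] by (simp add: mem_twisted_series)
    fix x assume x: "x \<in> carrier S"
    show "\<exists>y\<in>carrier S. y \<oplus>\<^bsub>S\<^esub> x = \<zero>\<^bsub>S\<^esub>"
      by (rule bexI[OF _ uminus_closed[OF x]]) (use x in \<open>simp add: l_neg fun_eq_iff\<close>)
    show "\<zero>\<^bsub>S\<^esub> \<oplus>\<^bsub>S\<^esub> x = x" using x by (simp add: fun_eq_iff)
  qed (use add_closed in \<open>auto simp: a_ac fun_eq_iff\<close>)
  show "monoid S"
  proof (rule monoidI)
    show one: "\<one>\<^bsub>S\<^esub> \<in> carrier S" using monom_closed subdivring_one[OF K] \<Gamma>_0 monom_one by metis
    fix f assume f: "f \<in> carrier S"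
    show "\<one>\<^bsub>S\<^esub> \<otimes>\<^bsub>S\<^esub> f = f"
      using monom_mult_apply[OF subdivring_one[OF K] \<Gamma>_0 f] f \<tau>_0[OF coeff_in_K[OF f]]
      by (simp add: fun_eq_iff monom_one)
    show "f \<otimes>\<^bsub>S\<^esub> \<one>\<^bsub>S\<^esub> = f"
    proof
      fix r
      have "(f \<otimes>\<^bsub>S\<^esub> \<one>\<^bsub>S\<^esub>) r = (\<Oplus>s\<in>{r}. f s \<otimes> \<tau> s (\<one>\<^bsub>S\<^esub> (r - s)))"
        by (rule mult_eq[OF f one]) (auto split: if_splits)
      then show "(f \<otimes>\<^bsub>S\<^esub> \<one>\<^bsub>S\<^esub>) r = f r" using f by (simp add: finsum_insert)
    qed
  qed (use mult_closed mult_assoc in auto)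
qed (use mult_distrib_right mult_distrib_left in auto)

sublocale S: ring S by (rule series_ring)

lemma uminus_series: "f \<in> carrier S \<Longrightarrow> \<ominus>\<^bsub>S\<^esub> f = (\<lambda>s. \<ominus> f s)"
  by (rule S.minus_equality) (use uminus_closed in \<open>auto simp: l_neg fun_eq_iff\<close>)

lemma minus_series_apply: "f \<in> carrier S \<Longrightarrow> g \<in> carrier S \<Longrightarrow> (f \<ominus>\<^bsub>S\<^esub> g) s = f s \<ominus> g s"
  by (simp add: a_minus_def uminus_series)

lemma finsum_series_apply:
  assumes "finite B" "\<And>b. b \<in> B \<Longrightarrow> f b \<in> carrier S"
  shows "(\<Oplus>\<^bsub>S\<^esub>b\<in>B. f b) t = (\<Oplus>b\<in>B. f b t)"
  by (rule S.additive_finsum[OF ring_axioms assms(1), of f "carrier S" "\<lambda>g. g t"]) (use assms(2) in auto)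

lemma mult_cong_le:
  assumes u: "u \<in> carrier S" "\<And>s. u s \<noteq> \<zero> \<Longrightarrow> 0 \<le> s" and v: "v \<in> carrier S" "v' \<in> carrier S"
    and eq: "\<And>t. t \<le> r \<Longrightarrow> v t = v' t"
  shows "(u \<otimes>\<^bsub>S\<^esub> v) r = (u \<otimes>\<^bsub>S\<^esub> v') r"
proof -
  have eq': "u s \<noteq> \<zero> \<Longrightarrow> v (r - s) = v' (r - s)" for s using u(2)[of s] eq[of "r - s"] by simp
  then have "{s. u s \<noteq> \<zero> \<and> v (r - s) \<noteq> \<zero>} = {s. u s \<noteq> \<zero> \<and> v' (r - s) \<noteq> \<zero>}" by auto
  then show ?thesis unfolding twisted_series_mult_apply
    by (intro finsum_cong') (use u v eq' in auto)
qed

lemma series_limit: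
  assumes P: "\<And>N. P N \<in> carrier S" and \<epsilon>: "0 < \<epsilon>"
    and step: "\<And>N r. r < of_nat N * \<epsilon> \<Longrightarrow> P (Suc N) r = P N r"
  obtains b where "b \<in> carrier S" "\<And>N r. r < of_nat N * \<epsilon> \<Longrightarrow> b r = P N r"
proof -
  have stable: "P M r = P N r" if "N \<le> M" "r < of_nat N * \<epsilon>" for M N r
    using that(1)
  proof (induction M rule: dec_induct)
    case (step M)
    have "of_nat N * \<epsilon> \<le> of_nat M * \<epsilon>" using step.hyps \<epsilon> by (intro mult_right_mono) auto
    then show ?case using step.IH assms(3)[of r M] that(2) by simp
  qed simp
  define n where "n r = (LEAST N. r < of_nat N * \<epsilon>)" for r
  have n: "r < of_nat (n r) * \<epsilon>" for r
    unfolding n_def using archimedean[OF \<epsilon>] by (rule LeastI_ex)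
  define b where "b r = P (n r) r" for r
  have b: "b r = P N r" if "r < of_nat N * \<epsilon>" for N r
    using stable[OF _ n, of r N] that by (simp add: b_def n_def Least_le)
  have "finite {s. b s \<noteq> \<zero> \<and> s \<le> x}" for x
  proof -
    obtain N :: nat where "x < of_nat N * \<epsilon>" using archimedean[OF \<epsilon>] by blast
    then have "{s. b s \<noteq> \<zero> \<and> s \<le> x} \<subseteq> {s. P N s \<noteq> \<zero> \<and> s \<le> x}" using b[of _ N] by force
    then show ?thesis using finite_support_le[OF P] finite_subset by blast
  qed
  then have "b \<in> carrier S"
    using coeff_in_K[OF P] support_subset[OF P] by (auto simp: mem_twisted_series b_def)
  then show thesis using that b by blast
qed

lemma one_minus_right_inverse:
  assumes g: "g \<in> carrier S" and pos: "\<And>s. g s \<noteq> \<zero> \<Longrightarrow> 0 < s"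
  shows "\<exists>b\<in>carrier S. (\<one>\<^bsub>S\<^esub> \<ominus>\<^bsub>S\<^esub> g) \<otimes>\<^bsub>S\<^esub> b = \<one>\<^bsub>S\<^esub>"
proof -
  obtain \<epsilon> where \<epsilon>: "0 < \<epsilon>" "\<And>s. g s \<noteq> \<zero> \<Longrightarrow> \<epsilon> \<le> s"
    using support_positive_lower_bound[OF g pos] by blast
  have pow: "of_nat k * \<epsilon> \<le> r" if "(g [^]\<^bsub>S\<^esub> (k::nat)) r \<noteq> \<zero>" for k r
    using that
  proof (induction k arbitrary: r)
    case 0 then show ?case by (auto split: if_splits)
  next
    case (Suc k)
    then have "(g [^]\<^bsub>S\<^esub> k \<otimes>\<^bsub>S\<^esub> g) r \<noteq> \<zero>" by simp
    then obtain s where s: "(g [^]\<^bsub>S\<^esub> k) s \<noteq> \<zero>" "g (r - s) \<noteq> \<zero>" by (rule mult_nonzeroE)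
    then show ?case using Suc.IH[OF s(1)] \<epsilon>(2)[OF s(2)] by (simp add: algebra_simps)
  qed
  define P where "P N = (\<Oplus>\<^bsub>S\<^esub>k\<in>{..<N}. g [^]\<^bsub>S\<^esub> k)" for N :: nat
  have P: "P N \<in> carrier S" for N using g by (auto simp: P_def)
  have step: "P (Suc N) r = P N r" if "r < of_nat N * \<epsilon>" for N r
  proof -
    have "P (Suc N) = g [^]\<^bsub>S\<^esub> N \<oplus>\<^bsub>S\<^esub> P N"
      unfolding P_def lessThan_Suc using g by (subst S.finsum_insert) auto
    moreover have "(g [^]\<^bsub>S\<^esub> N) r = \<zero>" using pow[of N r] that by fastforce
    ultimately show ?thesis using P by simp
  qed
  obtain b where b: "b \<in> carrier S" "\<And>N r. r < of_nat N * \<epsilon> \<Longrightarrow> b r = P N r"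
    using series_limit[where P = P, OF P \<epsilon>(1) step] by blast
  have nonneg: "0 \<le> s" if "(\<one>\<^bsub>S\<^esub> \<ominus>\<^bsub>S\<^esub> g) s \<noteq> \<zero>" for s
    using that pos[of s] g unfolding minus_series_apply[OF S.one_closed g]
    by (cases "g s = \<zero>"; cases "s = 0") (auto simp: a_minus_def)
  have "((\<one>\<^bsub>S\<^esub> \<ominus>\<^bsub>S\<^esub> g) \<otimes>\<^bsub>S\<^esub> b) r = \<one>\<^bsub>S\<^esub> r" for r
  proof -
    obtain N :: nat where N: "r < of_nat N * \<epsilon>" using archimedean[OF \<epsilon>(1)] by blast
    have "((\<one>\<^bsub>S\<^esub> \<ominus>\<^bsub>S\<^esub> g) \<otimes>\<^bsub>S\<^esub> b) r = ((\<one>\<^bsub>S\<^esub> \<ominus>\<^bsub>S\<^esub> g) \<otimes>\<^bsub>S\<^esub> P N) r"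
      using g b N P nonneg by (intro mult_cong_le) auto
    also have "\<dots> = \<one>\<^bsub>S\<^esub> r \<ominus> (g [^]\<^bsub>S\<^esub> N) r"
      unfolding P_def S.geometric_sum[OF g] using g by (intro minus_series_apply) auto
    also have "(g [^]\<^bsub>S\<^esub> N) r = \<zero>" using pow[of N r] N by fastforce
    also have "\<one>\<^bsub>S\<^esub> r \<ominus> \<zero> = \<one>\<^bsub>S\<^esub> r" by (simp add: a_minus_def)
    finally show ?thesis .
  qed
  then show ?thesis using b(1) by blast
qed

lemma monom_right_inverse:
  assumes "a \<in> K" "a \<noteq> \<zero>" "s \<in> \<Gamma>"
  shows "monom_at R a s \<otimes>\<^bsub>S\<^esub> monom_at R (\<tau> (- s) (inv a)) (- s) = \<one>\<^bsub>S\<^esub>"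
proof -
  have inv: "inv a \<in> K" using assms subdivring_inv[OF K] by blast
  have "\<tau> s (\<tau> (- s) (inv a)) = inv a"
    using \<tau>_comp[OF assms(3) \<Gamma>_uminus[OF assms(3)] inv] \<tau>_0[OF inv] by simp
  then show ?thesis
    using monom_mult_monom[OF assms(1) \<tau>_closed[OF inv] assms(3) \<Gamma>_uminus[OF assms(3)]] assms
      subdivring_carrier[OF K] by (simp add: monom_one)
qed

text \<open>Divided by its leading monomial, \<open>f\<close> becomes \<open>\<one> \<ominus> g\<close> with \<open>g\<close> of positive support, which the geometric
  series inverts.\<close>

lemma right_inverse_exists:
  assumes f: "f \<in> carrier S" "f \<noteq> \<zero>\<^bsub>S\<^esub>"
  shows "\<exists>b\<in>carrier S. f \<otimes>\<^bsub>S\<^esub> b = \<one>\<^bsub>S\<^esub>"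
proof -
  obtain m where m: "f m \<noteq> \<zero>" and below: "\<And>s. s < m \<Longrightarrow> f s = \<zero>" using least_exponent[OF f] by blast
  have \<Gamma>: "m \<in> \<Gamma>" "- m \<in> \<Gamma>" using support_subset[OF f(1) m] \<Gamma>_uminus by auto
  have inv: "f m \<in> K" "inv (f m) \<in> K" using coeff_in_K[OF f(1)] m subdivring_inv[OF K] by auto
  define a' where "a' = \<tau> (- m) (inv (f m))"
  have a': "a' \<in> K" "a' \<in> carrier R" using inv \<tau>_closed subdivring_carrier[OF K] by (auto simp: a'_def)
  define c where "c = monom_at R (f m) m"
  define c' where "c' = monom_at R a' (- m)"
  have cc: "c \<in> carrier S" "c' \<in> carrier S" using monom_closed inv a' \<Gamma> by (auto simp: c_def c'_def)
  have inverse: "c \<otimes>\<^bsub>S\<^esub> c' = \<one>\<^bsub>S\<^esub>" unfolding c_def c'_def a'_def by (rule monom_right_inverse[OF inv(1) m \<Gamma>(1)])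
  define u where "u = c' \<otimes>\<^bsub>S\<^esub> f"
  have u: "u \<in> carrier S" using cc f by (simp add: u_def)
  have u_apply: "u r = a' \<otimes> \<tau> (- m) (f (r + m))" for r
    unfolding u_def c'_def using monom_mult_apply[OF a'(1) \<Gamma>(2) f(1)] by simp
  have u\<^sub>0: "u 0 = \<one>" using \<tau>_mult[OF inv(2,1), of "- m"] m f by (simp add: u_apply a'_def)
  have below_u: "u r = \<zero>" if "r < 0" for r using below[of "r + m"] that a' by (simp add: u_apply)
  define g where "g = \<one>\<^bsub>S\<^esub> \<ominus>\<^bsub>S\<^esub> u"
  have g: "g \<in> carrier S" using u by (simp add: g_def)
  have "0 < s" if "g s \<noteq> \<zero>" for s
    using that u\<^sub>0 below_u[of s] u unfolding g_def by (cases "s < 0"; cases "s = 0") (auto simp: minus_series_apply)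
  then obtain b where b: "b \<in> carrier S" "(\<one>\<^bsub>S\<^esub> \<ominus>\<^bsub>S\<^esub> g) \<otimes>\<^bsub>S\<^esub> b = \<one>\<^bsub>S\<^esub>"
    using one_minus_right_inverse[OF g] by blast
  have "\<one>\<^bsub>S\<^esub> \<ominus>\<^bsub>S\<^esub> g = u" using u by (simp add: g_def a_minus_def S.minus_add S.a_assoc[symmetric] S.r_neg)
  then have ub: "c' \<otimes>\<^bsub>S\<^esub> f \<otimes>\<^bsub>S\<^esub> b = \<one>\<^bsub>S\<^esub>" using b(2) by (simp add: u_def)
  have "f \<otimes>\<^bsub>S\<^esub> b = (c \<otimes>\<^bsub>S\<^esub> c') \<otimes>\<^bsub>S\<^esub> (f \<otimes>\<^bsub>S\<^esub> b)" using inverse f b by simp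
  also have "\<dots> = c" using ub cc f b by (simp add: S.m_assoc)
  finally have "f \<otimes>\<^bsub>S\<^esub> (b \<otimes>\<^bsub>S\<^esub> c') = \<one>\<^bsub>S\<^esub>" using inverse cc f b by (simp add: S.m_assoc[symmetric])
  then show ?thesis using b cc by (intro bexI[of _ "b \<otimes>\<^bsub>S\<^esub> c'"]) auto
qed

lemma series_divring: "divring S"
proof
  show one_not_zero: "\<one>\<^bsub>S\<^esub> \<noteq> \<zero>\<^bsub>S\<^esub>"
  proof
    assume "\<one>\<^bsub>S\<^esub> = \<zero>\<^bsub>S\<^esub>"
    from fun_cong[OF this, of 0] show False by simp
  qed
  fix x assume x: "x \<in> carrier S" "x \<noteq> \<zero>\<^bsub>S\<^esub>"
  obtain y where y: "y \<in> carrier S" "x \<otimes>\<^bsub>S\<^esub> y = \<one>\<^bsub>S\<^esub>" using right_inverse_exists[OF x] by blast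
  have "y \<noteq> \<zero>\<^bsub>S\<^esub>" using y x one_not_zero by auto
  then obtain z where z: "z \<in> carrier S" "y \<otimes>\<^bsub>S\<^esub> z = \<one>\<^bsub>S\<^esub>" using right_inverse_exists[OF y(1)] by blast
  have "x = x \<otimes>\<^bsub>S\<^esub> (y \<otimes>\<^bsub>S\<^esub> z)" using x z by simp
  also have "\<dots> = (x \<otimes>\<^bsub>S\<^esub> y) \<otimes>\<^bsub>S\<^esub> z" using S.m_assoc x(1) y(1) z(1) by presburger
  also have "\<dots> = z" using y z by simp
  finally show "x \<in> Units S" using x y z by (auto simp: Units_def)
qed

lemma along_closed:
  assumes "inj \<rho>" "\<And>i. f i \<in> K" "range \<rho> \<subseteq> \<Gamma>" "\<And>x. finite {i. f i \<noteq> \<zero> \<and> \<rho> i \<le> x}"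
  shows "along R \<rho> f \<in> carrier S"
proof -
  have "{s. along R \<rho> f s \<noteq> \<zero> \<and> s \<le> x} = \<rho> ` {i. f i \<noteq> \<zero> \<and> \<rho> i \<le> x}" for x
    using assms(1) by (auto elim!: along_nonzeroE)
  then show ?thesis
    using assms subdivring_zero[OF K] by (auto simp: mem_twisted_series along_def)
qed

lemma along_mult_apply:
  assumes \<rho>: "inj \<rho>" and f: "along R \<rho> f \<in> carrier S" and g: "g \<in> carrier S"
    and A: "finite A" "\<And>i. f i \<noteq> \<zero> \<Longrightarrow> g (t - \<rho> i) \<noteq> \<zero> \<Longrightarrow> i \<in> A"
  shows "(along R \<rho> f \<otimes>\<^bsub>S\<^esub> g) t = (\<Oplus>i\<in>A. f i \<otimes> \<tau> (\<rho> i) (g (t - \<rho> i)))"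
proof -
  have "(along R \<rho> f \<otimes>\<^bsub>S\<^esub> g) t = (\<Oplus>s\<in>\<rho> ` A. along R \<rho> f s \<otimes> \<tau> s (g (t - s)))"
    using A \<rho> by (intro mult_eq[OF f g]) (auto elim!: along_nonzeroE)
  also have "\<dots> = (\<Oplus>i\<in>A. along R \<rho> f (\<rho> i) \<otimes> \<tau> (\<rho> i) (g (t - \<rho> i)))"
    using \<rho> f g by (intro finsum_reindex) (auto intro: inj_on_subset)
  finally show ?thesis using \<rho> by simp
qed

lemma along_mult_outside:
  assumes "inj \<rho>" "\<And>i j. \<rho> (i + j) = \<rho> i + \<rho> j" "t \<notin> range \<rho>"
  shows "(along R \<rho> f \<otimes>\<^bsub>S\<^esub> along R \<rho> g) t = \<zero>"
proof (rule ccontr)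
  assume "(along R \<rho> f \<otimes>\<^bsub>S\<^esub> along R \<rho> g) t \<noteq> \<zero>"
  then obtain s where s: "along R \<rho> f s \<noteq> \<zero>" "along R \<rho> g (t - s) \<noteq> \<zero>" by (rule mult_nonzeroE)
  then obtain i j where "s = \<rho> i" "t - s = \<rho> j" using assms(1) by (metis along_nonzeroE)
  then have "t = \<rho> (i + j)" using assms(2)[of i j] by (simp add: algebra_simps)
  then show False using assms(3) by blast
qed

end

section \<open>Laurent series\<close>

lemma finite_int_le_iff: "(\<forall>x. finite {i. P i \<and> i \<le> x}) \<longleftrightarrow> (\<exists>N::int. \<forall>i<N. \<not> P i)"
proof
  assume "\<forall>x. finite {i. P i \<and> i \<le> x}"
  then have "bdd_below {i. P i \<and> i \<le> 0}" by (intro bdd_below_finite) blast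
  then obtain m where m: "\<And>i. P i \<Longrightarrow> i \<le> 0 \<Longrightarrow> m \<le> i" by (auto simp: bdd_below_def)
  then have "\<forall>i<min m 0. \<not> P i" by force
  then show "\<exists>N. \<forall>i<N. \<not> P i" by blast
next
  assume "\<exists>N. \<forall>i<N. \<not> P i"
  then obtain N where "{i. P i \<and> i \<le> x} \<subseteq> {N..x}" for x by (force simp: not_less)
  then show "\<forall>x. finite {i. P i \<and> i \<le> x}" using finite_subset by blast
qed

lemma laurent_eq_twisted_series: "laurent R K = twisted_series R K UNIV (\<lambda>_ x. x)"
  using finite_int_le_iff[of "\<lambda>i. f i \<noteq> \<zero>\<^bsub>R\<^esub>" for f :: "int \<Rightarrow> 'a"]
  by (simp add: laurent_def twisted_series_def)

locale laurent_series = divring R for R (structure) +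
  fixes K assumes K: "subdivring K R"
begin

sublocale series_twist R K "UNIV :: int set" "\<lambda>_ x. x"
  rewrites "twisted_series R K UNIV (\<lambda>_ x. x) = laurent R K"
proof -
  show "series_twist R K (UNIV :: int set) (\<lambda>_ x. x)"
  proof unfold_locales
    fix x \<epsilon> :: int assume "0 < \<epsilon>"
    then have "of_nat (nat (\<bar>x\<bar> + 1)) * \<epsilon> \<ge> \<bar>x\<bar> + 1" by simp
    then show "\<exists>n::nat. x < of_nat n * \<epsilon>" by (intro exI[of _ "nat (\<bar>x\<bar> + 1)"]) linarith
  qed (use K in auto)
qed (simp add: laurent_eq_twisted_series)

declare \<tau>_zero [simp del] \<tau>_one [simp del]

lemma rat_funs_eq: "rat_funs R K = gen_divring (laurent R K) ((\<lambda>c. monom_at R c 0) ` K \<union> {monom_at R \<one> 1})"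
  by (simp add: rat_funs_def monom_at_def)

lemma rat_funs_subdivring: "subdivring (rat_funs R K) (laurent R K)"
  unfolding rat_funs_eq
  using monom_closed subdivring_one[OF K] by (intro divring.gen_divring_subdivring[OF series_divring]) auto

lemma monom_in_rat_funs:
  assumes "c \<in> K" shows "monom_at R c (int n) \<in> rat_funs R K"
proof -
  let ?Q = "rat_funs R K"
  have generators: "(\<lambda>c. monom_at R c 0) ` K \<union> {monom_at R \<one> 1} \<subseteq> ?Q"
    unfolding rat_funs_eq by (rule gen_divring_superset)
  then have gens: "monom_at R c 0 \<in> ?Q" if "c \<in> K" for c using that by blast
  have T: "monom_at R \<one> 1 \<in> ?Q" using generators by simp
  have "monom_at R \<one> (int n) \<in> ?Q"
  proof (induction n)
    case 0 show ?case using gens subdivring_one[OF K] by simp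
  next
    case (Suc n)
    show ?case
      using subdivring_mult[OF rat_funs_subdivring T Suc]
        monom_mult_monom[OF subdivring_one[OF K] subdivring_one[OF K], of 1 "int n"] by simp
  qed
  then have "monom_at R c 0 \<otimes>\<^bsub>laurent R K\<^esub> monom_at R \<one> (int n) \<in> ?Q"
    by (rule subdivring_mult[OF rat_funs_subdivring gens[OF assms]])
  then show ?thesis
    using assms subdivring_carrier[OF K] monom_mult_monom[OF assms subdivring_one[OF K], of 0 "int n"] by simp
qed

lemma polynomial_in_rat_funs:
  assumes "\<And>i. c i \<in> K" "\<And>i. i \<ge> n \<Longrightarrow> c i = \<zero>"
  shows "along R int c \<in> rat_funs R K"
proof -
  have monom: "monom_at R (c i) (int i) \<in> rat_funs R K" for i by (rule monom_in_rat_funs[OF assms(1)])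
  have "along R int c = (\<Oplus>\<^bsub>laurent R K\<^esub>i\<in>{..<n}. monom_at R (c i) (int i))"
  proof (rule along_eqI)
    have sum: "(\<Oplus>\<^bsub>laurent R K\<^esub>i\<in>{..<n}. monom_at R (c i) (int i)) t = (\<Oplus>i\<in>{..<n}. monom_at R (c i) (int i) t)" for t
      using monom_closed assms(1) by (intro finsum_series_apply) auto
    have c: "c i \<in> carrier R" for i using assms(1) subdivring_carrier[OF K] by blast
    show "(\<Oplus>\<^bsub>laurent R K\<^esub>i\<in>{..<n}. monom_at R (c i) (int i)) (int j) = c j" for j
    proof (cases "j < n")
      case True
      then show ?thesis unfolding sum
        using finsum_eq_single[of "{..<n}" j "\<lambda>i. monom_at R (c i) (int i) (int j)"] c by simp
    next
      case False
      then have "(\<Oplus>i\<in>{..<n}. monom_at R (c i) (int i) (int j)) = \<zero>"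
        by (intro add.finprod_one_eqI) auto
      then show ?thesis unfolding sum using False assms(2) by simp
    qed
    show "(\<Oplus>\<^bsub>laurent R K\<^esub>i\<in>{..<n}. monom_at R (c i) (int i)) t = \<zero>" if "t \<notin> range int" for t
      unfolding sum using that by (intro add.finprod_one_eqI) (auto simp: monom_at_def)
  qed simp
  also have "\<dots> \<in> rat_funs R K"
    using monom by (intro S.finsum_mem_subring[OF subdivring_imp_subring[OF rat_funs_subdivring]]) auto
  finally show ?thesis .
qed

end

section \<open>Skew polynomials\<close>

lemma skewpoly_apply [simp]:
  "\<one>\<^bsub>skewpoly R K s\<^esub> i = (if i = 0 then \<one>\<^bsub>R\<^esub> else \<zero>\<^bsub>R\<^esub>)" "\<zero>\<^bsub>skewpoly R K s\<^esub> i = \<zero>\<^bsub>R\<^esub>"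
  "(p \<oplus>\<^bsub>skewpoly R K s\<^esub> q) i = p i \<oplus>\<^bsub>R\<^esub> q i"
  by (simp_all add: skewpoly_def)

lemma skewpoly_mult_apply:
  "(p \<otimes>\<^bsub>skewpoly R K s\<^esub> q) n = (\<Oplus>\<^bsub>R\<^esub>i\<in>{..n}. p i \<otimes>\<^bsub>R\<^esub> (s ^^ i) (q (n - i)))"
  by (simp add: skewpoly_def)

lemma mem_skewpoly:
  "p \<in> carrier (skewpoly R K s) \<longleftrightarrow> (\<forall>i. p i \<in> K) \<and> (\<exists>N. \<forall>i\<ge>N. p i = \<zero>\<^bsub>R\<^esub>)"
proof -
  have "finite {i. p i \<noteq> \<zero>\<^bsub>R\<^esub>} \<longleftrightarrow> (\<exists>N. \<forall>i\<ge>N. p i = \<zero>\<^bsub>R\<^esub>)"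
    unfolding finite_nat_set_iff_bounded by (auto simp: not_less[symmetric])
  then show ?thesis by (simp add: skewpoly_def)
qed

lemma skewpoly_degree_bound:
  assumes "finite B" "\<And>b. b \<in> B \<Longrightarrow> p b \<in> carrier (skewpoly R K s)"
  shows "\<exists>N. \<forall>b\<in>B. \<forall>i\<ge>N. p b i = \<zero>\<^bsub>R\<^esub>"
proof -
  have "\<forall>b\<in>B. \<exists>N. \<forall>i\<ge>N. p b i = \<zero>\<^bsub>R\<^esub>" using assms(2) by (simp add: mem_skewpoly)
  then obtain N where "\<forall>b\<in>B. \<forall>i\<ge>N b. p b i = \<zero>\<^bsub>R\<^esub>" by metis
  then have "p b i = \<zero>\<^bsub>R\<^esub>" if "b \<in> B" "i \<ge> Max (N ` B)" for b i
    using that assms(1) Max_ge[of "N ` B" "N b"] by (meson dual_order.trans finite_imageI imageI)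
  then show ?thesis by blast
qed

locale skew_polynomials = divring R for R (structure) +
  fixes K s
  assumes K: "subdivring K R" and s_hom: "s \<in> ring_hom (R\<lparr>carrier := K\<rparr>) (R\<lparr>carrier := K\<rparr>)"
begin

abbreviation "Pol \<equiv> skewpoly R K s"

lemma funpow_hom: "(s ^^ j) \<in> ring_hom (R\<lparr>carrier := K\<rparr>) (R\<lparr>carrier := K\<rparr>)"
proof (induction j)
  case 0 show ?case by (simp add: ring_hom_def)
next
  case (Suc j) then show ?case unfolding funpow.simps using s_hom by (rule ring_hom_trans)
qed

lemma funpow_closed: "x \<in> K \<Longrightarrow> (s ^^ j) x \<in> K"
  using ring_hom_closed[OF funpow_hom] by simp

lemma funpow_eq_zero_iff: "x \<in> K \<Longrightarrow> (s ^^ j) x = \<zero> \<longleftrightarrow> x = \<zero>"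
proof -
  interpret divring_hom "R\<lparr>carrier := K\<rparr>" "R\<lparr>carrier := K\<rparr>" "s ^^ j"
    using funpow_hom subdivring_divring[OF K] by (simp add: divring_hom_def divring_hom_axioms_def)
  show "x \<in> K \<Longrightarrow> ?thesis" using hom_eq_zero_iff by simp
qed

lemma
  assumes "p \<in> carrier Pol"
  shows coeff_in_K: "p i \<in> K" and coeff_carrier [simp]: "p i \<in> carrier R"
    and funpow_coeff_carrier [simp]: "(s ^^ j) (p i) \<in> carrier R"
  using assms funpow_closed subdivring_carrier[OF K] by (auto simp: mem_skewpoly)

lemma skewpoly_zero_closed: "\<zero>\<^bsub>Pol\<^esub> \<in> carrier Pol"
  and skewpoly_one_closed: "\<one>\<^bsub>Pol\<^esub> \<in> carrier Pol"
  using subdivring_zero[OF K] subdivring_one[OF K] by (auto simp: mem_skewpoly intro: exI[of _ 1])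

lemma skewpoly_monom_closed: "c \<in> K \<Longrightarrow> monom_at R c n \<in> carrier Pol"
  unfolding mem_skewpoly using subdivring_zero[OF K]
  by (intro conjI exI[of _ "Suc n"]) (auto simp: monom_at_def)

lemma skewpoly_add_closed:
  assumes p: "p \<in> carrier Pol" and q: "q \<in> carrier Pol" shows "p \<oplus>\<^bsub>Pol\<^esub> q \<in> carrier Pol"
proof -
  obtain N M where "\<forall>i\<ge>N. p i = \<zero>" "\<forall>i\<ge>M. q i = \<zero>" using p q by (auto simp: mem_skewpoly)
  then have "\<forall>i\<ge>max N M. (p \<oplus>\<^bsub>Pol\<^esub> q) i = \<zero>" by simp
  moreover have "(p \<oplus>\<^bsub>Pol\<^esub> q) i \<in> K" for i using coeff_in_K p q subdivring_add[OF K] by simp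
  ultimately show ?thesis unfolding mem_skewpoly by blast
qed

lemma skewpoly_mult_closed:
  assumes p: "p \<in> carrier Pol" and q: "q \<in> carrier Pol" shows "p \<otimes>\<^bsub>Pol\<^esub> q \<in> carrier Pol"
proof -
  obtain N M where N: "\<forall>i\<ge>N. p i = \<zero>" and M: "\<forall>i\<ge>M. q i = \<zero>" using p q by (auto simp: mem_skewpoly)
  have "(p \<otimes>\<^bsub>Pol\<^esub> q) i \<in> K" for i
    unfolding skewpoly_mult_apply
    using coeff_in_K p q funpow_closed subdivring_mult[OF K]
    by (intro finsum_mem_subring[OF subdivring_imp_subring[OF K]]) auto
  moreover have "(p \<otimes>\<^bsub>Pol\<^esub> q) i = \<zero>" if i: "i \<ge> N + M" for i
    unfolding skewpoly_mult_apply
  proof (rule add.finprod_one_eqI)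
    fix j
    have "p j = \<zero> \<or> q (i - j) = \<zero>" using N M i by (cases "j \<ge> N") auto
    then show "p j \<otimes> (s ^^ j) (q (i - j)) = \<zero>"
      using p q funpow_eq_zero_iff[OF subdivring_zero[OF K]] by auto
  qed
  ultimately show ?thesis unfolding mem_skewpoly by blast
qed

lemma leading_coeff_exists:
  assumes "p \<in> carrier Pol" "p \<noteq> \<zero>\<^bsub>Pol\<^esub>"
  obtains n where "p n \<noteq> \<zero>" "\<And>i. i > n \<Longrightarrow> p i = \<zero>"
proof -
  obtain N where N: "\<forall>i\<ge>N. p i = \<zero>" using assms(1) by (auto simp: mem_skewpoly)
  obtain i where "p i \<noteq> \<zero>" using assms(2) by (auto simp: fun_eq_iff)
  moreover have "\<forall>i. p i \<noteq> \<zero> \<longrightarrow> i < N" using N by (meson not_le)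
  ultimately have "\<exists>n. p n \<noteq> \<zero> \<and> (\<forall>i. p i \<noteq> \<zero> \<longrightarrow> i \<le> n)"
    using ex_has_greatest_nat[of "\<lambda>i. p i \<noteq> \<zero>" i "\<lambda>i. i" N] by auto
  then show thesis using that by (meson not_le)
qed

lemma skewpoly_mult_nonzero:
  assumes p: "p \<in> carrier Pol" "p \<noteq> \<zero>\<^bsub>Pol\<^esub>" and q: "q \<in> carrier Pol" "q \<noteq> \<zero>\<^bsub>Pol\<^esub>"
  shows "p \<otimes>\<^bsub>Pol\<^esub> q \<noteq> \<zero>\<^bsub>Pol\<^esub>"
proof -
  obtain n where n: "p n \<noteq> \<zero>" "\<And>i. i > n \<Longrightarrow> p i = \<zero>" using leading_coeff_exists[OF p] by blast
  obtain m where m: "q m \<noteq> \<zero>" "\<And>i. i > m \<Longrightarrow> q i = \<zero>" using leading_coeff_exists[OF q] by blast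
  have "(p \<otimes>\<^bsub>Pol\<^esub> q) (n + m) = p n \<otimes> (s ^^ n) (q (n + m - n))"
    unfolding skewpoly_mult_apply
  proof (rule finsum_eq_single)
    fix i assume "i \<noteq> n"
    then have "p i = \<zero> \<or> q (n + m - i) = \<zero>" using n(2)[of i] m(2)[of "n + m - i"] by fastforce
    then show "p i \<otimes> (s ^^ i) (q (n + m - i)) = \<zero>"
      using p q funpow_eq_zero_iff[OF subdivring_zero[OF K]] by auto
  qed (use p q in auto)
  also have "\<dots> \<noteq> \<zero>" using p q n m funpow_eq_zero_iff coeff_in_K by simp
  finally show ?thesis by (auto simp: fun_eq_iff)
qed

definition truncate :: "nat \<Rightarrow> (nat \<Rightarrow> 'a) \<Rightarrow> nat \<Rightarrow> 'a" where
  "truncate N c i = (if i < N then c i else \<zero>)"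

lemma truncate_closed: "c \<in> {..<N} \<rightarrow> K \<Longrightarrow> truncate N c \<in> carrier Pol"
  using subdivring_zero[OF K] by (auto simp: mem_skewpoly truncate_def intro: exI[of _ N])

definition shifted_coeff :: "(nat \<Rightarrow> 'a) \<Rightarrow> nat \<Rightarrow> nat \<Rightarrow> 'a" where
  "shifted_coeff p i j = (if j \<le> i then (s ^^ j) (p (i - j)) else \<zero>)"

lemma shifted_coeff_in_K: "p \<in> carrier Pol \<Longrightarrow> shifted_coeff p i j \<in> K"
  using coeff_in_K funpow_closed subdivring_zero[OF K] by (simp add: shifted_coeff_def)

lemma truncate_mult_apply:
  assumes c: "c \<in> {..<N} \<rightarrow> K" and p: "p \<in> carrier Pol"
  shows "(truncate N c \<otimes>\<^bsub>Pol\<^esub> p) i = (\<Oplus>j\<in>{..<N}. c j \<otimes> shifted_coeff p i j)"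
proof -
  let ?f = "\<lambda>j. truncate N c j \<otimes> shifted_coeff p i j"
  have c_carrier: "c j \<in> carrier R" if "j < N" for j using c that subdivring_carrier[OF K] by auto
  note closed = p coeff_carrier[OF truncate_closed[OF c]] subdivring_carrier[OF K shifted_coeff_in_K[OF p]]
  have "(truncate N c \<otimes>\<^bsub>Pol\<^esub> p) i = (\<Oplus>j\<in>{..i}. ?f j)"
    unfolding skewpoly_mult_apply using closed
    by (intro finsum_cong') (auto simp: shifted_coeff_def)
  also have "\<dots> = (\<Oplus>j\<in>{..i} \<union> {..<N}. ?f j)"
    using closed by (intro add.finprod_mono_neutral_cong_left) (auto simp: shifted_coeff_def)
  also have "\<dots> = (\<Oplus>j\<in>{..<N}. ?f j)"
    using closed by (intro add.finprod_mono_neutral_cong_right) (auto simp: truncate_def)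
  also have "\<dots> = (\<Oplus>j\<in>{..<N}. c j \<otimes> shifted_coeff p i j)"
    using c_carrier closed(3) by (intro finsum_cong') (auto simp: truncate_def)
  finally show ?thesis .
qed

text \<open>For \<open>p\<close>, \<open>q\<close> of degree below \<open>N\<close>, the equation \<open>a p = b q\<close> with \<open>a\<close>, \<open>b\<close> of degree below \<open>N\<close>
  is a homogeneous linear system of \<open>2 N - 1\<close> equations in \<open>2 N\<close> unknowns.\<close>

lemma skewpoly_common_left_multiple:
  assumes p: "p \<in> carrier Pol" and q: "q \<in> carrier Pol"
  shows "\<exists>a\<in>carrier Pol. \<exists>b\<in>carrier Pol. (a \<noteq> \<zero>\<^bsub>Pol\<^esub> \<or> b \<noteq> \<zero>\<^bsub>Pol\<^esub>) \<and> a \<otimes>\<^bsub>Pol\<^esub> p = b \<otimes>\<^bsub>Pol\<^esub> q"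
proof -
  have "\<exists>N. \<forall>r\<in>{p, q}. \<forall>i\<ge>N. r i = \<zero>" by (rule skewpoly_degree_bound) (use p q in auto)
  then obtain M where M: "\<forall>r\<in>{p, q}. \<forall>i\<ge>M. r i = \<zero>" by blast
  define N where "N = Suc M"
  have N: "0 < N" "\<And>i. i \<ge> N \<Longrightarrow> p i = \<zero>" "\<And>i. i \<ge> N \<Longrightarrow> q i = \<zero>" using M by (auto simp: N_def)
  have "\<exists>a\<in>{..<N} \<rightarrow> K. \<exists>b\<in>{..<N} \<rightarrow> K. (\<exists>j\<in>{..<N}. a j \<noteq> \<zero> \<or> b j \<noteq> \<zero>) \<and>
      (\<forall>i\<in>{..<2 * N - 1}. (\<Oplus>j\<in>{..<N}. a j \<otimes> shifted_coeff p i j) = (\<Oplus>j\<in>{..<N}. b j \<otimes> shifted_coeff q i j))"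
    by (rule equal_combinations_exist[OF K]) (use N(1) shifted_coeff_in_K p q in auto)
  then obtain a b j where a: "a \<in> {..<N} \<rightarrow> K" and b: "b \<in> {..<N} \<rightarrow> K"
    and j: "j < N" "a j \<noteq> \<zero> \<or> b j \<noteq> \<zero>"
    and sol: "\<forall>i\<in>{..<2 * N - 1}.
      (\<Oplus>j\<in>{..<N}. a j \<otimes> shifted_coeff p i j) = (\<Oplus>j\<in>{..<N}. b j \<otimes> shifted_coeff q i j)"
    by (elim bexE conjE) (simp only: lessThan_iff)
  have high: "(\<Oplus>j\<in>{..<N}. c j \<otimes> shifted_coeff r i j) = \<zero>"
    if "i \<ge> 2 * N - 1" "\<And>i. i \<ge> N \<Longrightarrow> r i = \<zero>" "c \<in> {..<N} \<rightarrow> K" for c r i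
    using that funpow_eq_zero_iff[OF subdivring_zero[OF K]] subdivring_carrier[OF K]
    by (intro add.finprod_one_eqI) (auto simp: shifted_coeff_def Pi_iff)
  have "(truncate N a \<otimes>\<^bsub>Pol\<^esub> p) i = (truncate N b \<otimes>\<^bsub>Pol\<^esub> q) i" for i
  proof (cases "i < 2 * N - 1")
    case True then show ?thesis unfolding truncate_mult_apply[OF a p] truncate_mult_apply[OF b q] using sol by simp
  next
    case False
    then have "i \<ge> 2 * N - 1" by simp
    then show ?thesis
      unfolding truncate_mult_apply[OF a p] truncate_mult_apply[OF b q]
      by (simp only: high[OF _ N(2) a] high[OF _ N(3) b])
  qed
  then have "truncate N a \<otimes>\<^bsub>Pol\<^esub> p = truncate N b \<otimes>\<^bsub>Pol\<^esub> q" by blast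
  moreover have "truncate N a j \<noteq> \<zero> \<or> truncate N b j \<noteq> \<zero>" using j by (simp add: truncate_def)
  then have "truncate N a \<noteq> \<zero>\<^bsub>Pol\<^esub> \<or> truncate N b \<noteq> \<zero>\<^bsub>Pol\<^esub>" by (auto simp: fun_eq_iff)
  ultimately show ?thesis using truncate_closed[OF a] truncate_closed[OF b] by blast
qed

lemma ore_condition:
  assumes p: "p \<in> carrier Pol" and q: "q \<in> carrier Pol" "q \<noteq> \<zero>\<^bsub>Pol\<^esub>"
  shows "\<exists>a\<in>carrier Pol. \<exists>b\<in>carrier Pol. a \<noteq> \<zero>\<^bsub>Pol\<^esub> \<and> a \<otimes>\<^bsub>Pol\<^esub> p = b \<otimes>\<^bsub>Pol\<^esub> q"
proof -
  obtain a b where ab: "a \<in> carrier Pol" "b \<in> carrier Pol" "a \<noteq> \<zero>\<^bsub>Pol\<^esub> \<or> b \<noteq> \<zero>\<^bsub>Pol\<^esub>"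
    and eq: "a \<otimes>\<^bsub>Pol\<^esub> p = b \<otimes>\<^bsub>Pol\<^esub> q" using skewpoly_common_left_multiple[OF p q(1)] by blast
  have "a \<noteq> \<zero>\<^bsub>Pol\<^esub>"
  proof
    assume a: "a = \<zero>\<^bsub>Pol\<^esub>"
    then have "a \<otimes>\<^bsub>Pol\<^esub> p \<noteq> \<zero>\<^bsub>Pol\<^esub>" unfolding eq using skewpoly_mult_nonzero ab q by blast
    moreover have "(a \<otimes>\<^bsub>Pol\<^esub> p) i = \<zero>" for i
      unfolding skewpoly_mult_apply a using p by (intro add.finprod_one_eqI) auto
    ultimately show False by (auto simp: fun_eq_iff)
  qed
  then show ?thesis using ab eq by blast
qed

end

context series_twist
begin

context
  fixes K' s and \<rho> :: "nat \<Rightarrow> 'g"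
  assumes K': "K' \<subseteq> K" and \<rho>: "inj \<rho>" "\<And>i j. \<rho> (i + j) = \<rho> i + \<rho> j" "range \<rho> \<subseteq> \<Gamma>"
    and \<tau>_\<rho>: "\<And>x i. x \<in> K' \<Longrightarrow> \<tau> (\<rho> i) x = (s ^^ i) x"
begin

lemma along_skewpoly_closed:
  assumes "p \<in> carrier (skewpoly R K' s)" shows "along R \<rho> p \<in> carrier S"
proof (rule along_closed[OF \<rho>(1) _ \<rho>(3)])
  show "p i \<in> K" for i using assms K' by (auto simp: mem_skewpoly)
  show "finite {i. p i \<noteq> \<zero> \<and> \<rho> i \<le> x}" for x
    using assms by (auto simp: skewpoly_def elim: rev_finite_subset)
qed

lemma along_skewpoly_mult:
  assumes p: "p \<in> carrier (skewpoly R K' s)" and q: "q \<in> carrier (skewpoly R K' s)"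
  shows "along R \<rho> (p \<otimes>\<^bsub>skewpoly R K' s\<^esub> q) = along R \<rho> p \<otimes>\<^bsub>S\<^esub> along R \<rho> q"
proof (rule along_eqI[OF \<rho>(1) _ along_mult_outside[OF \<rho>(1,2)]])
  fix n
  have diff: "\<rho> n - \<rho> i = \<rho> (n - i)" if "i \<le> n" for i using \<rho>(2)[of "n - i" i] that by (simp add: algebra_simps)
  have q_mem: "q i \<in> K'" "q i \<in> K" for i using q K' by (auto simp: mem_skewpoly)
  have "p i \<in> carrier R" for i using p K' subdivring_carrier[OF K] by (auto simp: mem_skewpoly)
  then have closed: "p i \<otimes> \<tau> (\<rho> i) (q j) \<in> carrier R" for i j
    using q_mem(2) \<tau>_closed subdivring_carrier[OF K] by simp
  have "(along R \<rho> p \<otimes>\<^bsub>S\<^esub> along R \<rho> q) (\<rho> n) = (\<Oplus>i\<in>{..n}. p i \<otimes> \<tau> (\<rho> i) (along R \<rho> q (\<rho> n - \<rho> i)))"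
  proof (rule along_mult_apply[OF \<rho>(1) along_skewpoly_closed[OF p] along_skewpoly_closed[OF q]])
    fix i assume "along R \<rho> q (\<rho> n - \<rho> i) \<noteq> \<zero>"
    then obtain j where "\<rho> n - \<rho> i = \<rho> j" using \<rho>(1) by (elim along_nonzeroE)
    then have "\<rho> n = \<rho> (j + i)" using \<rho>(2)[of j i] by (simp add: algebra_simps)
    then show "i \<in> {..n}" using \<rho>(1) by (simp add: inj_eq)
  qed simp
  also have "\<dots> = (\<Oplus>i\<in>{..n}. p i \<otimes> (s ^^ i) (q (n - i)))"
    using \<rho>(1) q_mem(1) closed by (intro finsum_cong') (auto simp: diff \<tau>_\<rho>[symmetric])
  finally show "(along R \<rho> p \<otimes>\<^bsub>S\<^esub> along R \<rho> q) (\<rho> n) = (p \<otimes>\<^bsub>skewpoly R K' s\<^esub> q) n"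
    by (simp add: skewpoly_mult_apply)
qed

lemma along_skewpoly_hom: "along R \<rho> \<in> ring_hom (skewpoly R K' s) S"
proof (rule ring_hom_memI)
  have zero: "\<rho> 0 = 0" using \<rho>(2)[of 0 0] by simp
  have "t \<in> range \<rho>" if "t = 0" for t using zero that by (metis rangeI)
  then show "along R \<rho> \<one>\<^bsub>skewpoly R K' s\<^esub> = \<one>\<^bsub>S\<^esub>"
    using \<rho>(1) zero by (intro along_eqI) (auto simp: inj_eq dest: injD[of \<rho> _ 0])
  show "along R \<rho> (p \<oplus>\<^bsub>skewpoly R K' s\<^esub> q) = along R \<rho> p \<oplus>\<^bsub>S\<^esub> along R \<rho> q" for p q
    using \<rho>(1) by (intro along_eqI) auto
qed (use along_skewpoly_closed along_skewpoly_mult in auto)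

end

context
  fixes C
  assumes C: "subdivring C R" "C \<subseteq> K" and Ints_\<Gamma>: "\<And>i. of_int i \<in> \<Gamma>"
    and \<tau>_fixes_C: "\<And>s x. x \<in> C \<Longrightarrow> \<tau> s x = x"
begin

interpretation C: laurent_series R C
  by unfold_locales (rule C(1))

lemma along_laurent_closed:
  assumes f: "f \<in> carrier (laurent R C)" shows "along R of_int f \<in> carrier S"
proof (rule along_closed)
  show "f i \<in> K" for i using C.coeff_in_K[OF f] C(2) by blast
  show "finite {i. f i \<noteq> \<zero> \<and> of_int i \<le> x}" for x :: 'g
  proof -
    obtain n :: nat where "x < of_nat n * 1" using archimedean[of 1 x] by auto
    then have "i \<le> int n" if "of_int i \<le> x" for i
      using that by (metis le_less_trans mult.right_neutral of_int_less_iff of_int_of_nat_eq order_less_imp_le)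
    then have "{i. f i \<noteq> \<zero> \<and> of_int i \<le> x} \<subseteq> {i. f i \<noteq> \<zero> \<and> i \<le> int n}" by auto
    then show ?thesis using C.finite_support_le[OF f] finite_subset by blast
  qed
qed (use Ints_\<Gamma> in \<open>auto simp: inj_on_def\<close>)

lemma along_laurent_mult:
  assumes f: "f \<in> carrier (laurent R C)" and g: "g \<in> carrier (laurent R C)"
  shows "along R of_int (f \<otimes>\<^bsub>laurent R C\<^esub> g) = along R of_int f \<otimes>\<^bsub>S\<^esub> along R of_int g"
proof (rule along_eqI[OF _ _ along_mult_outside])
  fix n
  have inj: "inj (of_int :: int \<Rightarrow> 'g)" by (simp add: inj_on_def)
  have g_diff: "along R of_int g (of_int n - of_int i :: 'g) = g (n - i)" for i
    using along_apply[OF inj, of R g "n - i"] by simp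
  let ?A = "{i. f i \<noteq> \<zero> \<and> g (n - i) \<noteq> \<zero>}"
  have fin: "finite ?A" by (rule C.finite_mult_support[OF f g])
  have "(along R of_int f \<otimes>\<^bsub>S\<^esub> along R of_int g) (of_int n) =
      (\<Oplus>i\<in>?A. f i \<otimes> \<tau> (of_int i) (along R of_int g (of_int n - of_int i :: 'g)))"
    by (rule along_mult_apply[OF inj along_laurent_closed[OF f] along_laurent_closed[OF g] fin]) (simp add: g_diff)
  also have "\<dots> = (f \<otimes>\<^bsub>laurent R C\<^esub> g) n"
    using C.mult_eq[OF f g fin, of n] by (simp add: g_diff \<tau>_fixes_C C.coeff_in_K[OF g])
  finally show "(along R of_int f \<otimes>\<^bsub>S\<^esub> along R of_int g) (of_int n) = (f \<otimes>\<^bsub>laurent R C\<^esub> g) n" .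
qed (auto simp: inj_on_def)

lemma along_laurent_hom: "along R of_int \<in> ring_hom (laurent R C) S"
proof (rule ring_hom_memI)
  have inj: "inj (of_int :: int \<Rightarrow> 'g)" by (simp add: inj_on_def)
  have "t \<in> range of_int" if "t = (0::'g)" for t using that by (metis of_int_0 rangeI)
  then show "along R of_int \<one>\<^bsub>laurent R C\<^esub> = \<one>\<^bsub>S\<^esub>"
    using inj by (intro along_eqI) (auto simp: laurent_eq_twisted_series)
  show "along R of_int (f \<oplus>\<^bsub>laurent R C\<^esub> g) = along R of_int f \<oplus>\<^bsub>S\<^esub> along R of_int g" for f g
    using inj by (intro along_eqI) (auto simp: laurent_eq_twisted_series)
qed (use along_laurent_closed along_laurent_mult in auto)

lemma along_laurent_central:
  assumes C_central: "\<And>x y. x \<in> C \<Longrightarrow> y \<in> K \<Longrightarrow> x \<otimes> y = y \<otimes> x"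
    and \<tau>_Ints: "\<And>i x. x \<in> K \<Longrightarrow> \<tau> (of_int i) x = x"
    and f: "f \<in> carrier (laurent R C)" and g: "g \<in> carrier S"
  shows "along R of_int f \<otimes>\<^bsub>S\<^esub> g = g \<otimes>\<^bsub>S\<^esub> along R of_int f"
proof
  fix t
  let ?F = "along R (of_int :: int \<Rightarrow> 'g) f"
  have F: "?F \<in> carrier S" by (rule along_laurent_closed[OF f])
  have F_in_C: "?F s \<in> C" for s
    using C.coeff_in_K[OF f] subdivring_zero[OF C(1)] by (simp add: along_def)
  let ?A = "{s. ?F s \<noteq> \<zero> \<and> g (t - s) \<noteq> \<zero>}"
  have fin: "finite ?A" by (rule finite_mult_support[OF F g])
  have "(g \<otimes>\<^bsub>S\<^esub> ?F) t = (\<Oplus>s\<in>(\<lambda>s. t - s) ` ?A. g s \<otimes> \<tau> s (?F (t - s)))"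
  proof (rule mult_eq[OF g F])
    fix s assume "g s \<noteq> \<zero>" "?F (t - s) \<noteq> \<zero>"
    then show "s \<in> (\<lambda>s. t - s) ` ?A" by (intro image_eqI[of _ _ "t - s"]) auto
  qed (use fin in auto)
  also have "\<dots> = (\<Oplus>s\<in>?A. g (t - s) \<otimes> \<tau> (t - s) (?F (t - (t - s))))"
    using F g by (intro finsum_reindex) (auto simp: inj_on_def)
  also have "\<dots> = (\<Oplus>s\<in>?A. ?F s \<otimes> \<tau> s (g (t - s)))"
  proof (rule finsum_cong')
    fix s assume "s \<in> ?A"
    then have "s \<in> range of_int" by (metis (mono_tags, lifting) along_outside mem_Collect_eq)
    then have "\<tau> s (g (t - s)) = g (t - s)" using \<tau>_Ints coeff_in_K[OF g] by auto
    then show "g (t - s) \<otimes> \<tau> (t - s) (?F (t - (t - s))) = ?F s \<otimes> \<tau> s (g (t - s))"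
      using C_central[OF F_in_C coeff_in_K[OF g]] by (simp add: \<tau>_fixes_C[OF F_in_C])
  qed (use F g in auto)
  also have "\<dots> = (?F \<otimes>\<^bsub>S\<^esub> g) t" by (rule mult_eq[OF F g fin, symmetric]) auto
  finally show "(?F \<otimes>\<^bsub>S\<^esub> g) t = (g \<otimes>\<^bsub>S\<^esub> ?F) t" by simp
qed

end

end

section \<open>Extending homomorphisms to fields of fractions\<close>

locale ore_generated = H: divring H + E: divring E for H (structure) and E (structure) +
  fixes A and \<phi>
  assumes A: "subring A H" and hom_A: "\<phi> \<in> ring_hom (H\<lparr>carrier := A\<rparr>) E" and inj_A: "inj_on \<phi> A"
    and ore: "\<And>p q. p \<in> A \<Longrightarrow> q \<in> A \<Longrightarrow> q \<noteq> \<zero>\<^bsub>H\<^esub> \<Longrightarrow> \<exists>a\<in>A. \<exists>b\<in>A. a \<noteq> \<zero>\<^bsub>H\<^esub> \<and> a \<otimes>\<^bsub>H\<^esub> p = b \<otimes>\<^bsub>H\<^esub> q"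
    and generates: "gen_divring H A = carrier H"
begin

lemmas A_closed = subringE[OF A]

lemma A_carrier [simp]: "x \<in> A \<Longrightarrow> x \<in> carrier H"
  using A_closed(1) by auto

lemma \<phi>_carrier [simp]: "x \<in> A \<Longrightarrow> \<phi> x \<in> carrier E"
  and \<phi>_mult: "x \<in> A \<Longrightarrow> y \<in> A \<Longrightarrow> \<phi> (x \<otimes>\<^bsub>H\<^esub> y) = \<phi> x \<otimes>\<^bsub>E\<^esub> \<phi> y"
  and \<phi>_add: "x \<in> A \<Longrightarrow> y \<in> A \<Longrightarrow> \<phi> (x \<oplus>\<^bsub>H\<^esub> y) = \<phi> x \<oplus>\<^bsub>E\<^esub> \<phi> y"
  and \<phi>_one: "\<phi> \<one>\<^bsub>H\<^esub> = \<one>\<^bsub>E\<^esub>"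
  using ring_hom_memE[OF hom_A] by auto

lemma \<phi>_nonzero: "x \<in> A \<Longrightarrow> x \<noteq> \<zero>\<^bsub>H\<^esub> \<Longrightarrow> \<phi> x \<noteq> \<zero>\<^bsub>E\<^esub>"
proof
  assume x: "x \<in> A" "x \<noteq> \<zero>\<^bsub>H\<^esub>" "\<phi> x = \<zero>\<^bsub>E\<^esub>"
  have "\<phi> \<zero>\<^bsub>H\<^esub> = \<zero>\<^bsub>E\<^esub>" using ring_hom_zero[OF hom_A H.subring_is_ring[OF A] E.ring_axioms] by simp
  then show False using inj_onD[OF inj_A _ x(1) A_closed(2)] x by simp
qed

definition denominator :: "'a \<Rightarrow> 'a \<Rightarrow> bool" where
  "denominator q x \<longleftrightarrow> q \<in> A \<and> q \<noteq> \<zero>\<^bsub>H\<^esub> \<and> q \<otimes>\<^bsub>H\<^esub> x \<in> A"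

lemma denominator_mult:
  assumes "denominator q x" "x \<in> carrier H" "a \<in> A" "a \<noteq> \<zero>\<^bsub>H\<^esub>"
  shows "denominator (a \<otimes>\<^bsub>H\<^esub> q) x"
  using assms A_closed(6) by (auto simp: denominator_def H.m_assoc)

lemma common_left_multiple:
  assumes "q \<in> A" "q \<noteq> \<zero>\<^bsub>H\<^esub>" "q' \<in> A" "q' \<noteq> \<zero>\<^bsub>H\<^esub>"
  obtains a b where "a \<in> A" "a \<noteq> \<zero>\<^bsub>H\<^esub>" "b \<in> A" "b \<noteq> \<zero>\<^bsub>H\<^esub>" "a \<otimes>\<^bsub>H\<^esub> q = b \<otimes>\<^bsub>H\<^esub> q'"
proof -
  obtain a b where ab: "a \<in> A" "b \<in> A" "a \<noteq> \<zero>\<^bsub>H\<^esub>" "a \<otimes>\<^bsub>H\<^esub> q = b \<otimes>\<^bsub>H\<^esub> q'" using ore assms by blast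
  then have "b \<otimes>\<^bsub>H\<^esub> q' \<noteq> \<zero>\<^bsub>H\<^esub>" using assms by (metis A_carrier H.mult_eq_zero_iff)
  then show thesis using that ab assms by auto
qed

lemma common_denominator:
  assumes "finite B" "\<And>b. b \<in> B \<Longrightarrow> x b \<in> carrier H" "\<And>b. b \<in> B \<Longrightarrow> \<exists>q. denominator q (x b)"
  shows "\<exists>q\<in>A. q \<noteq> \<zero>\<^bsub>H\<^esub> \<and> (\<forall>b\<in>B. denominator q (x b))"
  using assms
proof (induction B rule: finite_induct)
  case empty then show ?case using A_closed(3) H.one_not_zero by blast
next
  case (insert c B)
  then obtain q q' where q: "q \<in> A" "q \<noteq> \<zero>\<^bsub>H\<^esub>" "\<And>b. b \<in> B \<Longrightarrow> denominator q (x b)"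
    and q': "denominator q' (x c)" by blast
  then obtain a b where ab: "a \<in> A" "a \<noteq> \<zero>\<^bsub>H\<^esub>" "b \<in> A" "b \<noteq> \<zero>\<^bsub>H\<^esub>" "a \<otimes>\<^bsub>H\<^esub> q = b \<otimes>\<^bsub>H\<^esub> q'"
    using common_left_multiple[of q q'] unfolding denominator_def by blast
  have "denominator (a \<otimes>\<^bsub>H\<^esub> q) (x c)"
    unfolding ab(5) using denominator_mult[OF q' _ ab(3,4)] insert.prems by blast
  moreover have "denominator (a \<otimes>\<^bsub>H\<^esub> q) (x b)" if "b \<in> B" for b
    using denominator_mult[OF q(3)[OF that] _ ab(1,2)] insert.prems that by blast
  ultimately show ?case unfolding denominator_def by blast
qed

lemma common_denominator_pair:
  assumes "x \<in> carrier H" "y \<in> carrier H" "denominator q x" "denominator q' y"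
  obtains m where "denominator m x" "denominator m y"
proof -
  have "\<exists>m\<in>A. m \<noteq> \<zero>\<^bsub>H\<^esub> \<and> (\<forall>z\<in>{x, y}. denominator m z)"
    by (rule common_denominator) (use assms in auto)
  then show thesis using that by blast
qed

lemma mult_denominator:
  assumes "x \<in> carrier H" "y \<in> carrier H" "denominator q x" "denominator q' y"
  obtains a b where "a \<in> A" "a \<noteq> \<zero>\<^bsub>H\<^esub>" "b \<in> A" "a \<otimes>\<^bsub>H\<^esub> (q \<otimes>\<^bsub>H\<^esub> x) = b \<otimes>\<^bsub>H\<^esub> q'"
    "(a \<otimes>\<^bsub>H\<^esub> q) \<otimes>\<^bsub>H\<^esub> (x \<otimes>\<^bsub>H\<^esub> y) = b \<otimes>\<^bsub>H\<^esub> (q' \<otimes>\<^bsub>H\<^esub> y)" "denominator (a \<otimes>\<^bsub>H\<^esub> q) (x \<otimes>\<^bsub>H\<^esub> y)"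
proof -
  have q: "q \<in> A" "q \<noteq> \<zero>\<^bsub>H\<^esub>" "q \<otimes>\<^bsub>H\<^esub> x \<in> A" and q': "q' \<in> A" "q' \<noteq> \<zero>\<^bsub>H\<^esub>" "q' \<otimes>\<^bsub>H\<^esub> y \<in> A"
    using assms(3,4) by (auto simp: denominator_def)
  obtain a b where ab: "a \<in> A" "b \<in> A" "a \<noteq> \<zero>\<^bsub>H\<^esub>" "a \<otimes>\<^bsub>H\<^esub> (q \<otimes>\<^bsub>H\<^esub> x) = b \<otimes>\<^bsub>H\<^esub> q'"
    using ore[OF q(3) q'(1,2)] by blast
  have "(a \<otimes>\<^bsub>H\<^esub> q) \<otimes>\<^bsub>H\<^esub> (x \<otimes>\<^bsub>H\<^esub> y) = (a \<otimes>\<^bsub>H\<^esub> (q \<otimes>\<^bsub>H\<^esub> x)) \<otimes>\<^bsub>H\<^esub> y"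
    using assms(1,2) ab(1) q by (simp add: H.m_assoc)
  also have "\<dots> = b \<otimes>\<^bsub>H\<^esub> (q' \<otimes>\<^bsub>H\<^esub> y)" unfolding ab(4) using assms(2) ab q' by (simp add: H.m_assoc)
  finally have eq: "(a \<otimes>\<^bsub>H\<^esub> q) \<otimes>\<^bsub>H\<^esub> (x \<otimes>\<^bsub>H\<^esub> y) = b \<otimes>\<^bsub>H\<^esub> (q' \<otimes>\<^bsub>H\<^esub> y)" .
  then have "denominator (a \<otimes>\<^bsub>H\<^esub> q) (x \<otimes>\<^bsub>H\<^esub> y)"
    using ab q q' A_closed(6) by (auto simp: denominator_def)
  then show thesis using that ab eq by blast
qed

lemma denominator_self: "x \<in> A \<Longrightarrow> denominator \<one>\<^bsub>H\<^esub> x"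
  using A_closed(3) by (simp add: denominator_def)

lemma denominator_exists:
  assumes "x \<in> carrier H" shows "\<exists>q. denominator q x"
proof -
  let ?D = "{x \<in> carrier H. \<exists>q. denominator q x}"
  have "subring ?D H"
  proof (rule H.subringI)
    show "\<one>\<^bsub>H\<^esub> \<in> ?D" using denominator_self[OF A_closed(3)] by auto
    show "\<ominus>\<^bsub>H\<^esub> x \<in> ?D" if x: "x \<in> ?D" for x
    proof -
      obtain q where q: "denominator q x" using x by blast
      then have "denominator q (\<ominus>\<^bsub>H\<^esub> x)" using x A_closed(5) by (simp add: denominator_def H.r_minus)
      then show ?thesis using x by blast
    qed
    show "x \<otimes>\<^bsub>H\<^esub> y \<in> ?D" if xy: "x \<in> ?D" "y \<in> ?D" for x y
    proof -
      obtain q q' where "denominator q x" "denominator q' y" using xy by blast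
      then obtain m where "denominator m (x \<otimes>\<^bsub>H\<^esub> y)" using xy mult_denominator by blast
      then show ?thesis using xy by blast
    qed
    show "x \<oplus>\<^bsub>H\<^esub> y \<in> ?D" if xy: "x \<in> ?D" "y \<in> ?D" for x y
    proof -
      obtain q where q: "denominator q x" "denominator q y" using xy common_denominator_pair by blast
      then have "denominator q (x \<oplus>\<^bsub>H\<^esub> y)"
        using xy A_closed(7) by (auto simp: denominator_def H.r_distr)
      then show ?thesis using xy by auto
    qed
  qed auto
  moreover have "inv\<^bsub>H\<^esub> x \<in> ?D" if x: "x \<in> ?D" "x \<noteq> \<zero>\<^bsub>H\<^esub>" for x
  proof -
    obtain q where "denominator q x" "x \<in> carrier H" using x(1) by blast
    then have "denominator (q \<otimes>\<^bsub>H\<^esub> x) (inv\<^bsub>H\<^esub> x)" using x(2) by (simp add: denominator_def H.m_assoc)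
    then show ?thesis using x by auto
  qed
  ultimately have "subdivring ?D H" by (rule H.subdivringI)
  then have "gen_divring H A \<subseteq> ?D" by (rule gen_divring_least) (use denominator_self in auto)
  then show ?thesis using assms generates by auto
qed

definition extension :: "'a \<Rightarrow> 'c" where
  "extension x = (let q = (SOME q. denominator q x) in inv\<^bsub>E\<^esub> (\<phi> q) \<otimes>\<^bsub>E\<^esub> \<phi> (q \<otimes>\<^bsub>H\<^esub> x))"

lemma fraction_unique:
  assumes x: "x \<in> carrier H" and q: "denominator q x" and q': "denominator q' x"
  shows "inv\<^bsub>E\<^esub> (\<phi> q) \<otimes>\<^bsub>E\<^esub> \<phi> (q \<otimes>\<^bsub>H\<^esub> x) = inv\<^bsub>E\<^esub> (\<phi> q') \<otimes>\<^bsub>E\<^esub> \<phi> (q' \<otimes>\<^bsub>H\<^esub> x)"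
proof -
  have expand: "\<phi> (a \<otimes>\<^bsub>H\<^esub> q) \<otimes>\<^bsub>E\<^esub> (inv\<^bsub>E\<^esub> (\<phi> q) \<otimes>\<^bsub>E\<^esub> \<phi> (q \<otimes>\<^bsub>H\<^esub> x)) = \<phi> (a \<otimes>\<^bsub>H\<^esub> q \<otimes>\<^bsub>H\<^esub> x)"
    if "denominator q x" "a \<in> A" for a q
  proof -
    have q: "q \<in> A" "q \<otimes>\<^bsub>H\<^esub> x \<in> A" "\<phi> q \<noteq> \<zero>\<^bsub>E\<^esub>" using that \<phi>_nonzero by (auto simp: denominator_def)
    have "\<phi> q \<otimes>\<^bsub>E\<^esub> (inv\<^bsub>E\<^esub> (\<phi> q) \<otimes>\<^bsub>E\<^esub> \<phi> (q \<otimes>\<^bsub>H\<^esub> x)) = \<phi> (q \<otimes>\<^bsub>H\<^esub> x)"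
      using q by (simp add: E.m_assoc[symmetric])
    then have "\<phi> (a \<otimes>\<^bsub>H\<^esub> q) \<otimes>\<^bsub>E\<^esub> (inv\<^bsub>E\<^esub> (\<phi> q) \<otimes>\<^bsub>E\<^esub> \<phi> (q \<otimes>\<^bsub>H\<^esub> x)) = \<phi> (a \<otimes>\<^bsub>H\<^esub> (q \<otimes>\<^bsub>H\<^esub> x))"
      using that(2) q by (simp add: \<phi>_mult E.m_assoc)
    then show ?thesis using that q x by (simp add: H.m_assoc)
  qed
  have mem: "q \<in> A" "q \<noteq> \<zero>\<^bsub>H\<^esub>" "q \<otimes>\<^bsub>H\<^esub> x \<in> A" "q' \<in> A" "q' \<noteq> \<zero>\<^bsub>H\<^esub>" "q' \<otimes>\<^bsub>H\<^esub> x \<in> A"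
    using q q' by (auto simp: denominator_def)
  obtain a b where ab: "a \<in> A" "a \<noteq> \<zero>\<^bsub>H\<^esub>" "b \<in> A" "b \<noteq> \<zero>\<^bsub>H\<^esub>" "a \<otimes>\<^bsub>H\<^esub> q = b \<otimes>\<^bsub>H\<^esub> q'"
    using common_left_multiple[OF mem(1,2,4,5)] by blast
  have "a \<otimes>\<^bsub>H\<^esub> q \<in> A" "a \<otimes>\<^bsub>H\<^esub> q \<noteq> \<zero>\<^bsub>H\<^esub>" using ab mem A_closed(6) by auto
  then show ?thesis
    using expand[OF q ab(1)] expand[OF q' ab(3)] \<phi>_nonzero[of "a \<otimes>\<^bsub>H\<^esub> q"] \<phi>_nonzero mem unfolding ab(5)
    by (metis E.m_closed E.mult_left_cancel E.nonzero_inv(1) \<phi>_carrier)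
qed

lemma extension_denominator:
  assumes x: "x \<in> carrier H" and q: "denominator q x"
  shows "\<phi> q \<otimes>\<^bsub>E\<^esub> extension x = \<phi> (q \<otimes>\<^bsub>H\<^esub> x)"
proof -
  have mem: "q \<in> A" "q \<otimes>\<^bsub>H\<^esub> x \<in> A" "\<phi> q \<noteq> \<zero>\<^bsub>E\<^esub>" using q \<phi>_nonzero by (auto simp: denominator_def)
  have "extension x = inv\<^bsub>E\<^esub> (\<phi> q) \<otimes>\<^bsub>E\<^esub> \<phi> (q \<otimes>\<^bsub>H\<^esub> x)"
    unfolding extension_def Let_def using fraction_unique[OF x someI[of "\<lambda>q. denominator q x", OF q] q] .
  then show ?thesis using mem by (simp add: E.m_assoc[symmetric])
qed

lemma extension_closed [simp]: "x \<in> carrier H \<Longrightarrow> extension x \<in> carrier E"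
proof -
  assume x: "x \<in> carrier H"
  have "denominator (SOME q. denominator q x) x" using someI_ex[OF denominator_exists[OF x]] .
  then show ?thesis
    unfolding extension_def Let_def using \<phi>_nonzero by (simp add: denominator_def)
qed

lemma extension_extends: "x \<in> A \<Longrightarrow> extension x = \<phi> x"
  using extension_denominator[OF _ denominator_self, of x] by (simp add: \<phi>_one)

lemma extension_add:
  assumes x: "x \<in> carrier H" and y: "y \<in> carrier H"
  shows "extension (x \<oplus>\<^bsub>H\<^esub> y) = extension x \<oplus>\<^bsub>E\<^esub> extension y"
proof -
  obtain q where q: "denominator q x" "denominator q y"
    using common_denominator_pair[OF x y] denominator_exists x y by metis
  have mem: "q \<in> A" "q \<otimes>\<^bsub>H\<^esub> x \<in> A" "q \<otimes>\<^bsub>H\<^esub> y \<in> A" "\<phi> q \<noteq> \<zero>\<^bsub>E\<^esub>"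
    using q \<phi>_nonzero by (auto simp: denominator_def)
  have "denominator q (x \<oplus>\<^bsub>H\<^esub> y)"
    using q x y A_closed(7) by (auto simp: denominator_def H.r_distr)
  then have "\<phi> q \<otimes>\<^bsub>E\<^esub> extension (x \<oplus>\<^bsub>H\<^esub> y) = \<phi> (q \<otimes>\<^bsub>H\<^esub> x \<oplus>\<^bsub>H\<^esub> q \<otimes>\<^bsub>H\<^esub> y)"
    using extension_denominator mem x y by (simp add: H.r_distr)
  also have "\<dots> = \<phi> q \<otimes>\<^bsub>E\<^esub> (extension x \<oplus>\<^bsub>E\<^esub> extension y)"
    using mem x y by (simp add: \<phi>_add E.r_distr extension_denominator q)
  finally show ?thesis using E.mult_left_cancel mem x y by simp
qed

lemma extension_mult:
  assumes x: "x \<in> carrier H" and y: "y \<in> carrier H"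
  shows "extension (x \<otimes>\<^bsub>H\<^esub> y) = extension x \<otimes>\<^bsub>E\<^esub> extension y"
proof -
  obtain q q' where q: "denominator q x" and q': "denominator q' y" using denominator_exists x y by blast
  obtain a b where ab: "a \<in> A" "a \<noteq> \<zero>\<^bsub>H\<^esub>" "b \<in> A" "a \<otimes>\<^bsub>H\<^esub> (q \<otimes>\<^bsub>H\<^esub> x) = b \<otimes>\<^bsub>H\<^esub> q'"
    "(a \<otimes>\<^bsub>H\<^esub> q) \<otimes>\<^bsub>H\<^esub> (x \<otimes>\<^bsub>H\<^esub> y) = b \<otimes>\<^bsub>H\<^esub> (q' \<otimes>\<^bsub>H\<^esub> y)" and aq: "denominator (a \<otimes>\<^bsub>H\<^esub> q) (x \<otimes>\<^bsub>H\<^esub> y)"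
    using mult_denominator[OF x y q q'] by blast
  have mem: "q \<in> A" "q \<otimes>\<^bsub>H\<^esub> x \<in> A" "q' \<in> A" "q' \<otimes>\<^bsub>H\<^esub> y \<in> A" "a \<otimes>\<^bsub>H\<^esub> q \<in> A" "a \<otimes>\<^bsub>H\<^esub> q \<noteq> \<zero>\<^bsub>H\<^esub>"
    using q q' aq by (auto simp: denominator_def)
  have "\<phi> (a \<otimes>\<^bsub>H\<^esub> q) \<otimes>\<^bsub>E\<^esub> extension (x \<otimes>\<^bsub>H\<^esub> y) = \<phi> (b \<otimes>\<^bsub>H\<^esub> (q' \<otimes>\<^bsub>H\<^esub> y))"
    using extension_denominator[OF _ aq] x y ab(5) by simp
  also have "\<dots> = \<phi> b \<otimes>\<^bsub>E\<^esub> \<phi> q' \<otimes>\<^bsub>E\<^esub> extension y"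
    using ab mem y by (simp add: \<phi>_mult E.m_assoc extension_denominator[OF y q'])
  also have "\<phi> b \<otimes>\<^bsub>E\<^esub> \<phi> q' = \<phi> a \<otimes>\<^bsub>E\<^esub> \<phi> (q \<otimes>\<^bsub>H\<^esub> x)"
    using ab(1,3) mem arg_cong[OF ab(4), of \<phi>] by (simp add: \<phi>_mult)
  also have "\<dots> \<otimes>\<^bsub>E\<^esub> extension y = \<phi> (a \<otimes>\<^bsub>H\<^esub> q) \<otimes>\<^bsub>E\<^esub> (extension x \<otimes>\<^bsub>E\<^esub> extension y)"
    using ab(1) mem x y by (simp add: \<phi>_mult E.m_assoc extension_denominator[OF x q, symmetric])
  finally show ?thesis using E.mult_left_cancel \<phi>_nonzero mem x y by simp
qed

sublocale extension: divring_hom H E extension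
  by unfold_locales
     (rule ring_hom_memI; simp add: extension_mult extension_add extension_extends A_closed(3) \<phi>_one)

end

section \<open>Cyclic towers\<close>

locale cyclic_tower = divring h for h :: "('a,'m) ring_scheme" (structure) +
  fixes k :: "'a set" and hs :: "nat \<Rightarrow> 'a set" and \<sigma> :: "nat \<Rightarrow> 'a \<Rightarrow> 'a" and d :: "nat \<Rightarrow> nat"
  assumes hs: "\<And>n. subdivring (hs n) h" and k_subset_hs: "\<And>n. k \<subseteq> hs n"
    and hs_Suc: "\<And>n. hs n \<subseteq> hs (Suc n)" and hs_UN: "(\<Union>n. hs n) = carrier h"
    and outer_hs: "\<And>n. outer (h\<lparr>carrier := hs n\<rparr>) k" and galois_hs: "\<And>n. galois (h\<lparr>carrier := hs n\<rparr>) k"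
    and degree_hs: "\<And>n. left_degree h k (hs n) (d n)"
    and \<sigma>_Gal: "\<And>n. \<sigma> n \<in> carrier (Gal (h\<lparr>carrier := hs n\<rparr>) k)"
    and \<sigma>_generates: "\<And>n. carrier (Gal (h\<lparr>carrier := hs n\<rparr>) k) = generate (Gal (h\<lparr>carrier := hs n\<rparr>) k) {\<sigma> n}"
    and \<sigma>_restrict: "\<And>m n x. m \<le> n \<Longrightarrow> x \<in> hs m \<Longrightarrow> \<sigma> n x = \<sigma> m x"
begin

lemma hs_mono: "m \<le> n \<Longrightarrow> hs m \<subseteq> hs n"
  using lift_Suc_mono_le[of hs] hs_Suc by blast

lemma hs_carrier [simp]: "x \<in> hs n \<Longrightarrow> x \<in> carrier h"
  using hs_UN by auto

lemma hs_divring: "divring (h\<lparr>carrier := hs n\<rparr>)"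
  by (rule subdivring_divring[OF hs])

sublocale level: skew_polynomials h "hs n" "\<sigma> n" for n
  by unfold_locales (use hs Gal_hom[OF \<sigma>_Gal] in auto)

lemmas funpow_closed = level.funpow_closed

lemma funpow_mult: "x \<in> hs n \<Longrightarrow> y \<in> hs n \<Longrightarrow> (\<sigma> n ^^ j) (x \<otimes> y) = (\<sigma> n ^^ j) x \<otimes> (\<sigma> n ^^ j) y"
  and funpow_add: "x \<in> hs n \<Longrightarrow> y \<in> hs n \<Longrightarrow> (\<sigma> n ^^ j) (x \<oplus> y) = (\<sigma> n ^^ j) x \<oplus> (\<sigma> n ^^ j) y"
  using ring_hom_mult[OF level.funpow_hom[of j n], of x y] ring_hom_add[OF level.funpow_hom[of j n], of x y] by auto

lemma funpow_fixes: "x \<in> k \<Longrightarrow> (\<sigma> n ^^ j) x = x"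
  by (induction j) (auto simp: Gal_fixes[OF \<sigma>_Gal])

lemma funpow_restrict: "m \<le> n \<Longrightarrow> x \<in> hs m \<Longrightarrow> (\<sigma> n ^^ j) x = (\<sigma> m ^^ j) x"
  by (induction j) (auto simp: \<sigma>_restrict funpow_closed)

lemma fixed_field: "{x \<in> hs n. \<sigma> n x = x} = k"
proof
  show "k \<subseteq> {x \<in> hs n. \<sigma> n x = x}" using k_subset_hs Gal_fixes[OF \<sigma>_Gal] by auto
  let ?G = "Gal (h\<lparr>carrier := hs n\<rparr>) k"
  interpret G: group ?G
    by (rule Gal_group) (use divring.axioms(1)[OF hs_divring] k_subset_hs in auto)
  show "{x \<in> hs n. \<sigma> n x = x} \<subseteq> k"
  proof
    fix x assume "x \<in> {x \<in> hs n. \<sigma> n x = x}"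
    then have x: "x \<in> hs n" "\<sigma> n x = x" by auto
    have "g x = x" if "g \<in> generate ?G {\<sigma> n}" for g
      using that
    proof (induction rule: generate.induct)
      case one then show ?case using x by simp
    next
      case (incl g) then show ?case using x by simp
    next
      case (inv g)
      then have g: "g = \<sigma> n" by simp
      have "(inv\<^bsub>?G\<^esub> g \<otimes>\<^bsub>?G\<^esub> g) x = \<one>\<^bsub>?G\<^esub> x" using G.l_inv[OF \<sigma>_Gal[of n]] g by (simp del: Gal_simps)
      then show ?case using x g by (simp add: compose_def)
    next
      case (eng g\<^sub>1 g\<^sub>2) then show ?case using x by (simp add: compose_def)
    qed
    then have "x \<in> {x \<in> carrier (h\<lparr>carrier := hs n\<rparr>). \<forall>g\<in>carrier ?G. g x = x}"
      using x(1) \<sigma>_generates[of n] by simp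
    then show "x \<in> k" using galois_hs[of n] unfolding galois_def by (rule subst[rotated])
  qed
qed

lemma cyclic_outer_basis:
  obtains B where "cyclic_outer_extension (h\<lparr>carrier := hs n\<rparr>) k (\<sigma> n) B" "card B = d n"
proof -
  obtain B where B: "finite B" "card B = d n" "B \<subseteq> hs n" "lin_indep h k B" "hs n \<subseteq> lin_span h k B"
    using degree_hs[of n] unfolding left_degree_iff by blast
  note update = ring_axioms subdivring_imp_subring[OF hs] B(1,3) k_subset_hs
  have "cyclic_outer_extension (h\<lparr>carrier := hs n\<rparr>) k (\<sigma> n) B"
  proof (intro cyclic_outer_extension.intro cyclic_outer_extension_axioms.intro hs_divring)
    show "\<sigma> n \<in> ring_iso (h\<lparr>carrier := hs n\<rparr>) (h\<lparr>carrier := hs n\<rparr>)" using \<sigma>_Gal[of n] by (simp add: mem_Gal_iff)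
    show "{x \<in> carrier (h\<lparr>carrier := hs n\<rparr>). \<sigma> n x = x} = k" using fixed_field by simp
  qed (use outer_hs B lin_indep_carrier_update[OF update] lin_span_carrier_update[OF update] in auto)
  then show thesis using that B(2) by blast
qed

lemma d_pos: "0 < d n"
  by (rule cyclic_outer_basis[of n]) (use cyclic_outer_extension.card_basis_pos in fastforce)

lemma funpow_d: "x \<in> hs n \<Longrightarrow> (\<sigma> n ^^ d n) x = x"
  by (rule cyclic_outer_basis[of n]) (use cyclic_outer_extension.funpow_card_basis in fastforce)

lemma d_dvd_period: "(\<And>x. x \<in> hs n \<Longrightarrow> (\<sigma> n ^^ m) x = x) \<Longrightarrow> d n dvd m"
  by (rule cyclic_outer_basis[of n]) (use cyclic_outer_extension.card_basis_dvd_period in fastforce)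

lemma d_dvd_Suc: "d n dvd d (Suc n)"
proof (rule d_dvd_period)
  fix x assume x: "x \<in> hs n"
  then have "(\<sigma> n ^^ d (Suc n)) x = (\<sigma> (Suc n) ^^ d (Suc n)) x" using funpow_restrict[of n "Suc n" x] by simp
  then show "(\<sigma> n ^^ d (Suc n)) x = x" using funpow_d x hs_Suc by auto
qed

lemma funpow_mod_d: "x \<in> hs n \<Longrightarrow> (\<sigma> n ^^ (j mod d n)) x = (\<sigma> n ^^ j) x"
  by (rule funpow_mod_period[of "hs n"]) (use funpow_closed[of _ n 1] funpow_d in auto)

lemma commute_k_imp_central:
  assumes x: "x \<in> k" "\<And>z. z \<in> k \<Longrightarrow> x \<otimes> z = z \<otimes> x" and y: "y \<in> carrier h"
  shows "x \<otimes> y = y \<otimes> x"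
proof -
  obtain n where n: "y \<in> hs n" using y hs_UN by auto
  have "k \<subseteq> carrier (h\<lparr>carrier := hs n\<rparr>)" using k_subset_hs by simp
  from divring.outer_iff_commute[OF hs_divring this] outer_hs[of n]
  have "\<forall>u\<in>hs n. (\<forall>z\<in>k. u \<otimes> z = z \<otimes> u) \<longrightarrow> (\<forall>y\<in>hs n. u \<otimes> y = y \<otimes> u)" by simp
  then show ?thesis using x n subsetD[OF k_subset_hs[of n]] by blast
qed

definition funpow_int :: "nat \<Rightarrow> int \<Rightarrow> 'a \<Rightarrow> 'a" where
  "funpow_int n i = \<sigma> n ^^ nat (i mod int (d n))"

lemma funpow_int_closed: "x \<in> hs n \<Longrightarrow> funpow_int n i x \<in> hs n"
  by (simp add: funpow_int_def funpow_closed)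

lemma funpow_int_of_nat: "x \<in> hs n \<Longrightarrow> funpow_int n (int j) x = (\<sigma> n ^^ j) x"
  using funpow_mod_d by (simp add: funpow_int_def nat_mod_distrib)

lemma funpow_int_dvd: "int (d n) dvd i \<Longrightarrow> funpow_int n i x = x"
  by (simp add: funpow_int_def)

lemma funpow_int_add:
  assumes x: "x \<in> hs n" shows "funpow_int n (i + j) x = funpow_int n i (funpow_int n j x)"
proof -
  define a b where "a = nat (i mod int (d n))" and "b = nat (j mod int (d n))"
  have "int a = i mod int (d n)" "int b = j mod int (d n)" using d_pos[of n] by (auto simp: a_def b_def)
  then have "(i + j) mod int (d n) = int ((a + b) mod d n)" by (simp add: zmod_int mod_add_eq)
  then have "funpow_int n (i + j) x = (\<sigma> n ^^ (a + b)) x" using funpow_mod_d[OF x] by (simp add: funpow_int_def)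
  then show ?thesis by (simp add: funpow_int_def Nat.funpow_add a_def b_def)
qed

lemma funpow_int_cong:
  assumes "x \<in> hs n" "i mod int (d n) = j mod int (d n)" shows "funpow_int (Suc n) i x = funpow_int n j x"
proof -
  define a where "a = nat (i mod int (d (Suc n)))"
  have "int a = i mod int (d (Suc n))" using d_pos[of "Suc n"] by (simp add: a_def)
  then have "int (a mod d n) = i mod int (d n)" using d_dvd_Suc[of n] by (simp add: zmod_int mod_mod_cancel)
  then have "a mod d n = nat (j mod int (d n))" using assms(2) by simp
  moreover have "funpow_int (Suc n) i x = (\<sigma> n ^^ (a mod d n)) x"
    using assms(1) by (simp add: funpow_int_def a_def funpow_restrict funpow_mod_d)
  ultimately show ?thesis by (simp add: funpow_int_def)
qed

end

section \<open>Series over a tower\<close>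

locale exponent_tower = cyclic_tower +
  fixes l :: "nat \<Rightarrow> nat" and kk :: "'a set"
  assumes l_pos: "\<And>n. 0 < l n" and l_dvd: "\<And>n. l n dvd l (Suc n)"
    and d_dvd_ratio: "\<And>n. d n dvd (l (Suc n) div l n - 1)" and d_dvd_l: "\<And>n. d n dvd l n"
    and kk: "subdivring kk h" and kk_center: "kk \<subseteq> ring_center (h\<lparr>carrier := k\<rparr>)"
begin

definition ratio :: "nat \<Rightarrow> nat" where
  "ratio n = l (Suc n) div l n"

lemma l_Suc: "l (Suc n) = l n * ratio n"
  using l_dvd by (simp add: ratio_def)

lemma ratio_pos: "0 < ratio n"
  using l_pos[of "Suc n"] by (simp add: l_Suc)

lemma kk_subset_k: "kk \<subseteq> k"
  using kk_center by (auto simp: ring_center_def)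

lemma kk_central: "x \<in> kk \<Longrightarrow> y \<in> carrier h \<Longrightarrow> x \<otimes> y = y \<otimes> x"
  using commute_k_imp_central[of x y] kk_center by (auto simp: ring_center_def)

definition exponents :: "nat \<Rightarrow> rat set" where
  "exponents n = {s. s * of_nat (l n) \<in> \<int>}"

definition \<Gamma> :: "rat set" where "\<Gamma> = (\<Union>n. exponents n)"

lemma exponents_Suc: "exponents n \<subseteq> exponents (Suc n)"
proof
  fix s assume "s \<in> exponents n"
  then have "s * of_nat (l n) * of_nat (ratio n) \<in> \<int>" by (auto simp: exponents_def)
  then show "s \<in> exponents (Suc n)" by (simp add: exponents_def l_Suc mult.assoc)
qed

lemma exponents_mono: "m \<le> n \<Longrightarrow> exponents m \<subseteq> exponents n"
  using lift_Suc_mono_le[of exponents] exponents_Suc by blast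

lemma exponents_add: "s \<in> exponents n \<Longrightarrow> t \<in> exponents n \<Longrightarrow> s + t \<in> exponents n"
  by (simp add: exponents_def distrib_right)

lemma Ints_exponents: "s \<in> \<int> \<Longrightarrow> s \<in> exponents n"
  by (simp add: exponents_def)

lemma grid_exponents: "of_nat i / of_nat (l n) \<in> exponents n"
  using l_pos[of n] by (simp add: exponents_def)

lemma common_level:
  assumes "s \<in> \<Gamma>" "t \<in> \<Gamma>" "x \<in> carrier h" "y \<in> carrier h"
  obtains n where "s \<in> exponents n" "t \<in> exponents n" "x \<in> hs n" "y \<in> hs n"
proof -
  obtain a b c e where "s \<in> exponents a" "t \<in> exponents b" "x \<in> hs c" "y \<in> hs e"
    using assms unfolding \<Gamma>_def hs_UN[symmetric] by blast
  moreover define N where "N = max (max a b) (max c e)"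
  then have "a \<le> N" "b \<le> N" "c \<le> N" "e \<le> N" by auto
  ultimately have "s \<in> exponents N" "t \<in> exponents N" "x \<in> hs N" "y \<in> hs N"
    using exponents_mono hs_mono by blast+
  then show thesis by (rule that)
qed

definition numerator :: "nat \<Rightarrow> rat \<Rightarrow> int" where
  "numerator n s = \<lfloor>s * of_nat (l n)\<rfloor>"

lemma of_int_numerator: "s \<in> exponents n \<Longrightarrow> of_int (numerator n s) = s * of_nat (l n)"
  by (auto simp: numerator_def exponents_def elim: Ints_cases)

lemma numerator_eqI: "s * of_nat (l n) = of_int i \<Longrightarrow> numerator n s = i"
  by (simp add: numerator_def)

lemma numerator_Suc: "s \<in> exponents n \<Longrightarrow> numerator (Suc n) s = numerator n s * int (ratio n)"
  by (rule numerator_eqI) (simp add: of_int_numerator l_Suc)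

lemma numerator_add: "s \<in> exponents n \<Longrightarrow> t \<in> exponents n \<Longrightarrow> numerator n (s + t) = numerator n s + numerator n t"
  by (rule numerator_eqI) (simp add: of_int_numerator distrib_right)

lemma twist_level_Suc:
  assumes "x \<in> hs n" "s \<in> exponents n"
  shows "funpow_int (Suc n) (numerator (Suc n) s) x = funpow_int n (numerator n s) x"
proof (rule funpow_int_cong[OF assms(1)])
  have "int (d n) dvd int (ratio n) - 1"
    using d_dvd_ratio[of n] ratio_pos[of n]
    by (metis Suc_leI One_nat_def int_dvd_int_iff of_nat_1 of_nat_diff ratio_def)
  then have "int (d n) dvd numerator n s * int (ratio n) - numerator n s"
    by (metis dvd_mult mult.right_neutral right_diff_distrib)
  then show "numerator (Suc n) s mod int (d n) = numerator n s mod int (d n)"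
    by (simp add: numerator_Suc assms(2) mod_eq_dvd_iff)
qed

lemma twist_level_mono:
  assumes "m \<le> n" "x \<in> hs m" "s \<in> exponents m"
  shows "funpow_int n (numerator n s) x = funpow_int m (numerator m s) x"
  using assms(1)
proof (induction n rule: dec_induct)
  case (step n)
  then have "x \<in> hs n" "s \<in> exponents n" using assms hs_mono exponents_mono by blast+
  then show ?case using step.IH twist_level_Suc by simp
qed simp

text \<open>Conjugation by \<open>T\<^sup>s\<close>, where \<open>T\<^sup>1\<^sup>/\<^sup>l\<close> with \<open>l = l n\<close> acts on \<open>hs n\<close> as \<open>\<sigma> n\<close>; outside \<open>\<Gamma>\<close> the value is
  irrelevant.\<close>

definition \<tau> :: "rat \<Rightarrow> 'a \<Rightarrow> 'a" where
  "\<tau> s x = (if \<exists>n. x \<in> hs n \<and> s \<in> exponents n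
     then (let n = (SOME n. x \<in> hs n \<and> s \<in> exponents n) in funpow_int n (numerator n s) x) else x)"

lemma \<tau>_level:
  assumes "x \<in> hs n" "s \<in> exponents n" shows "\<tau> s x = funpow_int n (numerator n s) x"
proof -
  define m where "m = (SOME m. x \<in> hs m \<and> s \<in> exponents m)"
  have m: "x \<in> hs m" "s \<in> exponents m"
    unfolding m_def using someI[of "\<lambda>m. x \<in> hs m \<and> s \<in> exponents m" n] assms by auto
  have "\<tau> s x = funpow_int m (numerator m s) x" using assms by (auto simp: \<tau>_def m_def Let_def)
  also have "\<dots> = funpow_int n (numerator n s) x"
    using twist_level_mono[of m n x s] twist_level_mono[of n m x s] assms m by (cases "m \<le> n") auto
  finally show ?thesis .
qed

lemma \<tau>_outside: "s \<notin> \<Gamma> \<Longrightarrow> \<tau> s x = x"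
  by (auto simp: \<tau>_def \<Gamma>_def)

lemma \<tau>_fixes_k: "x \<in> k \<Longrightarrow> \<tau> s x = x"
  by (simp add: \<tau>_def funpow_int_def funpow_fixes Let_def)

lemma \<tau>_level_closed: "x \<in> hs n \<Longrightarrow> s \<in> exponents n \<Longrightarrow> \<tau> s x \<in> hs n"
  using \<tau>_level funpow_int_closed by simp

lemma \<tau>_carrier:
  assumes "x \<in> carrier h" shows "\<tau> s x \<in> carrier h"
proof (cases "s \<in> \<Gamma>")
  case True
  obtain n where "s \<in> exponents n" "x \<in> hs n" using common_level[OF True True assms assms] by blast
  then show ?thesis using \<tau>_level_closed hs_carrier by blast
qed (use assms \<tau>_outside in auto)

lemma \<tau>_add_mult:
  assumes "x \<in> carrier h" "y \<in> carrier h"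
  shows "\<tau> s (x \<oplus> y) = \<tau> s x \<oplus> \<tau> s y" "\<tau> s (x \<otimes> y) = \<tau> s x \<otimes> \<tau> s y"
proof -
  have "\<tau> s (x \<oplus> y) = \<tau> s x \<oplus> \<tau> s y \<and> \<tau> s (x \<otimes> y) = \<tau> s x \<otimes> \<tau> s y"
  proof (cases "s \<in> \<Gamma>")
    case True
    obtain n where n: "s \<in> exponents n" "x \<in> hs n" "y \<in> hs n" using common_level[OF True True assms] by blast
    then show ?thesis
      using subdivring_add[OF hs] subdivring_mult[OF hs]
      by (simp add: \<tau>_level[of _ n] funpow_int_def funpow_mult funpow_add)
  qed (use \<tau>_outside in auto)
  then show "\<tau> s (x \<oplus> y) = \<tau> s x \<oplus> \<tau> s y" "\<tau> s (x \<otimes> y) = \<tau> s x \<otimes> \<tau> s y" by blast+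
qed

lemma \<tau>_Ints:
  assumes "x \<in> carrier h" shows "\<tau> (of_int i) x = x"
proof -
  obtain n where n: "x \<in> hs n" using assms hs_UN by auto
  have "numerator n (of_int i) = i * int (l n)" by (rule numerator_eqI) simp
  then have "int (d n) dvd numerator n (of_int i)" using d_dvd_l[of n] by simp
  then show ?thesis using \<tau>_level[OF n Ints_exponents] funpow_int_dvd by simp
qed

lemma \<tau>_add_exponent:
  assumes "s \<in> \<Gamma>" "t \<in> \<Gamma>" "x \<in> carrier h" shows "\<tau> (s + t) x = \<tau> s (\<tau> t x)"
proof -
  obtain n where n: "s \<in> exponents n" "t \<in> exponents n" "x \<in> hs n" using common_level[OF assms(1,2,3,3)] by blast
  then show ?thesis
    by (simp add: \<tau>_level[of _ n] exponents_add numerator_add funpow_int_add funpow_int_closed)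
qed

lemma \<tau>_grid:
  assumes "x \<in> hs n" shows "\<tau> (of_nat i / of_nat (l n)) x = (\<sigma> n ^^ i) x"
proof -
  have "numerator n (of_nat i / of_nat (l n)) = int i" using l_pos[of n] by (intro numerator_eqI) simp
  then show ?thesis using \<tau>_level[OF assms grid_exponents] funpow_int_of_nat[OF assms] by simp
qed

sublocale series_twist h "carrier h" \<Gamma> \<tau>
proof unfold_locales
  show "subdivring (carrier h) h" by (rule carrier_subdivring)
  show "\<exists>n::nat. x < of_nat n * \<epsilon>" if "0 < \<epsilon>" for x \<epsilon> :: rat
  proof -
    obtain n :: nat where "x / \<epsilon> < of_nat n" using reals_Archimedean2 by blast
    then show ?thesis using that by (auto simp: field_simps)
  qed
  show "0 \<in> \<Gamma>" using Ints_exponents[of 0 0] by (auto simp: \<Gamma>_def)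
  show "s + t \<in> \<Gamma>" if "s \<in> \<Gamma>" "t \<in> \<Gamma>" for s t
    using common_level[OF that one_closed one_closed] exponents_add by (metis UN_I UNIV_I \<Gamma>_def)
  show "- s \<in> \<Gamma>" if "s \<in> \<Gamma>" for s using that by (auto simp: \<Gamma>_def exponents_def)
  show "\<tau> 0 x = x" if "x \<in> carrier h" for x using \<tau>_Ints[OF that, of 0] by simp
qed (use \<tau>_carrier \<tau>_add_mult \<tau>_add_exponent \<tau>_fixes_k kk_subset_k subdivring_one[OF kk] in auto)

sublocale S: divring S by (rule series_divring)

abbreviation "Pol n \<equiv> skewpoly h (hs n) (\<sigma> n)"

abbreviation "Laurent \<equiv> laurent h kk"

abbreviation "Rat \<equiv> rat_funs h kk"

sublocale Laurent: laurent_series h kk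
  by unfold_locales (rule kk)

sublocale Laurent_div: divring Laurent by (rule Laurent.series_divring)

abbreviation grid :: "nat \<Rightarrow> nat \<Rightarrow> rat" where "grid n i \<equiv> of_nat i / of_nat (l n)"

text \<open>The monomial \<open>t\<^sub>n\<^sup>i\<close> is sent to the exponent \<open>i / l n\<close>, so that \<open>T = t\<^sub>n\<^sup>l\<close> with \<open>l = l n\<close> has
  exponent \<open>1\<close> for every \<open>n\<close>.\<close>

abbreviation \<iota> :: "nat \<Rightarrow> (nat \<Rightarrow> 'a) \<Rightarrow> rat \<Rightarrow> 'a" where "\<iota> n \<equiv> along h (grid n)"

abbreviation embed :: "(int \<Rightarrow> 'a) \<Rightarrow> rat \<Rightarrow> 'a" where "embed \<equiv> along h of_int"

lemma grid_inj: "inj (grid n)"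
  using l_pos[of n] by (auto simp: inj_on_def)

lemma grid_add: "grid n (i + j) = grid n i + grid n j"
  by (simp add: add_divide_distrib)

lemma grid_range: "range (grid n) \<subseteq> \<Gamma>"
  using grid_exponents by (auto simp: \<Gamma>_def)

lemma hs_subset: "hs n \<subseteq> carrier h"
  by auto

lemma \<iota>_hom: "\<iota> n \<in> ring_hom (Pol n) S"
  by (rule along_skewpoly_hom[OF hs_subset grid_inj grid_add grid_range]) (rule \<tau>_grid)

lemma \<iota>_closed: "p \<in> carrier (Pol n) \<Longrightarrow> \<iota> n p \<in> carrier S"
  by (rule ring_hom_closed[OF \<iota>_hom])

lemma Ints_\<Gamma>: "of_int i \<in> \<Gamma>"
  using Ints_exponents[of "of_int i" 0] by (auto simp: \<Gamma>_def)

lemma \<tau>_fixes_kk: "x \<in> kk \<Longrightarrow> \<tau> s x = x"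
  using \<tau>_fixes_k kk_subset_k by blast

lemma kk_subset_carrier: "kk \<subseteq> carrier h"
  by (rule subdivring_subset[OF kk])

lemma embed_central: "f \<in> carrier Laurent \<Longrightarrow> g \<in> carrier S \<Longrightarrow> embed f \<otimes>\<^bsub>S\<^esub> g = g \<otimes>\<^bsub>S\<^esub> embed f"
  by (rule along_laurent_central[OF kk kk_subset_carrier Ints_\<Gamma> \<tau>_fixes_kk kk_central \<tau>_Ints])

sublocale embed: divring_hom Laurent S embed
  by unfold_locales (rule along_laurent_hom[OF kk kk_subset_carrier Ints_\<Gamma> \<tau>_fixes_kk])

lemma stretch_closed:
  assumes p: "p \<in> carrier (Pol n)" shows "stretch h (ratio n) p \<in> carrier (Pol (Suc n))"
proof -
  obtain N where N: "\<forall>i\<ge>N. p i = \<zero>" using p by (auto simp: mem_skewpoly)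
  have "stretch h (ratio n) p i = \<zero>" if "i \<ge> N * ratio n" for i
    using N that ratio_pos[of n] div_le_mono[OF that, of "ratio n"] by (auto simp: stretch_def)
  moreover have "stretch h (ratio n) p i \<in> hs (Suc n)" for i
    using level.coeff_in_K[OF p] hs_Suc[of n] subdivring_zero[OF hs] by (auto simp: stretch_def)
  ultimately show ?thesis unfolding mem_skewpoly by blast
qed

lemma \<iota>_stretch: "\<iota> (Suc n) (stretch h (ratio n) p) = \<iota> n p"
proof (rule along_eqI[OF grid_inj])
  fix i
  show "\<iota> n p (grid (Suc n) i) = stretch h (ratio n) p i"
  proof (cases "ratio n dvd i")
    case True
    then obtain j where j: "i = ratio n * j" by auto
    then have "grid (Suc n) i = grid n j"
      using ratio_pos[of n] by (simp add: l_Suc)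
    then show ?thesis using j ratio_pos[of n] along_apply[OF grid_inj, of h n p j] by (simp add: stretch_def)
  next
    case False
    have "grid (Suc n) i \<notin> range (grid n)"
    proof
      assume "grid (Suc n) i \<in> range (grid n)"
      then obtain j where "grid (Suc n) i = grid n j" by blast
      then have "(of_nat i :: rat) = of_nat (ratio n * j)"
        using l_pos[of n] ratio_pos[of n] by (simp add: l_Suc field_simps)
      then have "i = ratio n * j" unfolding of_nat_eq_iff .
      then show False using False by simp
    qed
    then show ?thesis using False by (simp add: stretch_def)
  qed
next
  fix t :: rat assume t: "t \<notin> range (grid (Suc n))"
  have "grid n j = grid (Suc n) (ratio n * j)" for j
    using ratio_pos[of n] by (simp add: l_Suc)
  then have "range (grid n) \<subseteq> range (grid (Suc n))" by (metis image_subsetI rangeI)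
  then have "t \<notin> range (grid n)" using t by blast
  then show "\<iota> n p t = \<zero>" by simp
qed

end

section \<open>Linear disjointness\<close>

lemma (in divring) relation_over_subdivring:
  fixes v :: "'i \<Rightarrow> 'j \<Rightarrow> 'a"
  assumes K: "subdivring K R" and fin: "finite I" "finite J"
    and v: "\<And>i j. i \<in> I \<Longrightarrow> j \<in> J \<Longrightarrow> v i j \<in> carrier R"
    and nonzero: "i\<^sub>0 \<in> I" "j\<^sub>0 \<in> J" "v i\<^sub>0 j\<^sub>0 \<noteq> \<zero>"
  obtains c where "\<And>i j. i \<in> I \<Longrightarrow> j \<in> J \<Longrightarrow> c i j \<in> K" "c i\<^sub>0 j\<^sub>0 = \<one>"
    "\<And>a. (\<And>i j. i \<in> I \<Longrightarrow> a i j \<in> K) \<Longrightarrow> (\<Oplus>i\<in>I. \<Oplus>j\<in>J. a i j \<otimes> v i j) = \<zero> \<Longrightarrow> (\<Oplus>i\<in>I. \<Oplus>j\<in>J. a i j \<otimes> c i j) = \<zero>"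
proof -
  let ?V = "(\<lambda>(i, j). v i j) ` (I \<times> J)"
  have V: "finite ?V" "?V \<subseteq> carrier R" "v i\<^sub>0 j\<^sub>0 \<in> ?V" using fin v nonzero by auto
  obtain D \<phi> where D: "?V \<subseteq> D" "D \<subseteq> carrier R" "\<zero> \<in> D" "\<And>x y. x \<in> D \<Longrightarrow> y \<in> D \<Longrightarrow> x \<oplus> y \<in> D"
    and D_lmult: "\<And>c x. c \<in> K \<Longrightarrow> x \<in> D \<Longrightarrow> c \<otimes> x \<in> D"
    and \<phi>_one: "\<phi> (v i\<^sub>0 j\<^sub>0) = \<one>" and \<phi>_K: "\<And>x. x \<in> D \<Longrightarrow> \<phi> x \<in> K"
    and \<phi>_add: "\<And>x y. x \<in> D \<Longrightarrow> y \<in> D \<Longrightarrow> \<phi> (x \<oplus> y) = \<phi> x \<oplus> \<phi> y"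
    and \<phi>_lmult: "\<And>c x. c \<in> K \<Longrightarrow> x \<in> D \<Longrightarrow> \<phi> (c \<otimes> x) = c \<otimes> \<phi> x"
    using linear_functional_exists[OF K V nonzero(3)] by blast
  have v_D: "v i j \<in> D" if "i \<in> I" "j \<in> J" for i j using D(1) that by auto
  have \<phi>_carrier: "\<phi> x \<in> carrier R" if "x \<in> D" for x using \<phi>_K[OF that] subdivring_carrier[OF K] by blast
  note \<phi>_sum = additive_finsum[OF ring_axioms _ _ D(2,3,4) \<phi>_carrier \<phi>_add]
  have "(\<Oplus>i\<in>I. \<Oplus>j\<in>J. a i j \<otimes> \<phi> (v i j)) = \<zero>"
    if a: "\<And>i j. i \<in> I \<Longrightarrow> a i j \<in> K" and rel: "(\<Oplus>i\<in>I. \<Oplus>j\<in>J. a i j \<otimes> v i j) = \<zero>" for a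
  proof -
    have terms: "a i j \<otimes> v i j \<in> D" if "i \<in> I" "j \<in> J" for i j by (rule D_lmult[OF a[OF that(1)] v_D[OF that]])
    have inner: "(\<Oplus>j\<in>J. a i j \<otimes> v i j) \<in> D" if "i \<in> I" for i
      by (rule finsum_mem[OF fin(2) _ D(2,3,4)]) (use terms that in auto)
    have "(\<Oplus>i\<in>I. \<Oplus>j\<in>J. a i j \<otimes> \<phi> (v i j)) = (\<Oplus>i\<in>I. \<Oplus>j\<in>J. \<phi> (a i j \<otimes> v i j))"
      using v_D \<phi>_lmult[OF a] \<phi>_carrier[OF terms]
      by (intro finsum_cong' refl funcsetI finsum_closed) simp_all
    also have "\<dots> = (\<Oplus>i\<in>I. \<phi> (\<Oplus>j\<in>J. a i j \<otimes> v i j))"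
      using inner \<phi>_carrier terms fin(2) by (intro finsum_cong' \<phi>_sum[symmetric]) auto
    also have "\<dots> = \<phi> \<zero>" unfolding rel[symmetric] by (rule \<phi>_sum[symmetric]) (use fin(1) inner in auto)
    also have "\<dots> = \<zero>" using \<phi>_lmult[OF subdivring_zero[OF K] D(3)] \<phi>_carrier[OF D(3)] by simp
    finally show ?thesis .
  qed
  then show thesis using that[of "\<lambda>i j. \<phi> (v i j)"] v_D \<phi>_K \<phi>_one by blast
qed

lemma (in laurent_series) polynomial_relation_imp_dependent:
  assumes B: "finite B" "B \<subseteq> carrier (laurent R K)" and c: "\<And>b j. b \<in> B \<Longrightarrow> j < N \<Longrightarrow> c b j \<in> K"
    and rel: "\<And>m. (\<Oplus>b\<in>B. \<Oplus>j\<in>{..<N}. c b j \<otimes> b (m - int j)) = \<zero>"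
    and nonzero: "b\<^sub>0 \<in> B" "j\<^sub>0 < N" "c b\<^sub>0 j\<^sub>0 \<noteq> \<zero>"
  shows "\<not> lin_indep (laurent R K) (rat_funs R K) B"
proof
  assume indep: "lin_indep (laurent R K) (rat_funs R K) B"
  define C where "C b = along R int (\<lambda>j. if j < N then c b j else \<zero>)" for b
  have inj: "inj int" by (simp add: inj_on_def)
  have C: "C b \<in> rat_funs R K" if "b \<in> B" for b
    unfolding C_def by (rule polynomial_in_rat_funs[of _ N]) (use c that subdivring_zero[OF K] in auto)
  then have C_carrier: "C b \<in> carrier (laurent R K)" if "b \<in> B" for b
    using that subdivring_carrier[OF rat_funs_subdivring] by blast
  have "(\<Oplus>\<^bsub>laurent R K\<^esub>b\<in>B. C b \<otimes>\<^bsub>laurent R K\<^esub> b) = \<zero>\<^bsub>laurent R K\<^esub>"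
  proof
    fix m
    have "(\<Oplus>\<^bsub>laurent R K\<^esub>b\<in>B. C b \<otimes>\<^bsub>laurent R K\<^esub> b) m = (\<Oplus>b\<in>B. (C b \<otimes>\<^bsub>laurent R K\<^esub> b) m)"
      using B C_carrier by (intro finsum_series_apply) auto
    also have "\<dots> = (\<Oplus>b\<in>B. \<Oplus>j\<in>{..<N}. c b j \<otimes> b (m - int j))"
    proof (rule finsum_cong')
      fix b assume b: "b \<in> B"
      then have "(C b \<otimes>\<^bsub>laurent R K\<^esub> b) m = (\<Oplus>j\<in>{..<N}. (if j < N then c b j else \<zero>) \<otimes> b (m - int j))"
        unfolding C_def
        by (intro along_mult_apply[OF inj C_carrier[OF b, unfolded C_def]]) (use B in \<open>auto split: if_splits\<close>)
      also have "\<dots> = (\<Oplus>j\<in>{..<N}. c b j \<otimes> b (m - int j))"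
        using b B c coeff_carrier subdivring_carrier[OF K] by (intro finsum_cong') auto
      finally show "(C b \<otimes>\<^bsub>laurent R K\<^esub> b) m = (\<Oplus>j\<in>{..<N}. c b j \<otimes> b (m - int j))" .
    qed (use B c coeff_carrier subdivring_carrier[OF K] in auto)
    finally show "(\<Oplus>\<^bsub>laurent R K\<^esub>b\<in>B. C b \<otimes>\<^bsub>laurent R K\<^esub> b) m = \<zero>\<^bsub>laurent R K\<^esub> m"
      unfolding rel by (simp add: laurent_eq_twisted_series)
  qed
  then have "C b\<^sub>0 = \<zero>\<^bsub>laurent R K\<^esub>" using indep C nonzero(1) unfolding lin_indep_def by blast
  then have "C b\<^sub>0 (int j\<^sub>0) = \<zero>" by (simp add: laurent_eq_twisted_series)
  then show False using nonzero(2,3) inj by (simp add: C_def)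
qed

context exponent_tower
begin

lemma mult_apply_residue:
  assumes p: "p \<in> carrier (Pol n)" "\<And>i. i \<ge> N \<Longrightarrow> p i = \<zero>" and f: "f \<in> carrier Laurent" and r: "r < l n"
  shows "(\<iota> n p \<otimes>\<^bsub>S\<^esub> embed f) (of_int m + grid n r) = (\<Oplus>j\<in>{..<N}. p (r + j * l n) \<otimes> f (m - int j))"
proof -
  have inj: "inj (of_int :: int \<Rightarrow> rat)" by (simp add: inj_on_def)
  let ?A = "(\<lambda>j. r + j * l n) ` {..<N}" and ?t = "of_int m + grid n r"
  have "(\<iota> n p \<otimes>\<^bsub>S\<^esub> embed f) ?t = (\<Oplus>i\<in>?A. p i \<otimes> \<tau> (grid n i) (embed f (?t - grid n i)))"
  proof (rule along_mult_apply[OF grid_inj \<iota>_closed[OF p(1)] embed.hom_closed[OF f]])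
    fix i assume i: "p i \<noteq> \<zero>" "embed f (?t - grid n i) \<noteq> \<zero>"
    then obtain z where "?t - grid n i = of_int z" using inj by (elim along_nonzeroE)
    then have "(of_nat i :: rat) / of_nat (l n) = (of_nat r + of_int (m - z) * of_nat (l n)) / of_nat (l n)"
      using l_pos[of n] by (simp add: add_divide_distrib)
    then have "(of_nat i :: rat) = of_int (int r + (m - z) * int (l n))"
      using l_pos[of n] by simp
    then have "int i = int r + (m - z) * int (l n)" by (metis of_int_eq_iff of_int_of_nat_eq)
    then have "int (i mod l n) = int r" using r by (simp add: zmod_int)
    then have "i = r + i div l n * l n" by (metis add.commute div_mult_mod_eq nat_int)
    moreover have "i < N" using i(1) p(2) by (meson not_le)
    then have "i div l n < N" by (rule le_less_trans[OF div_le_dividend])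
    ultimately show "i \<in> ?A" by blast
  qed simp
  also have "\<dots> = (\<Oplus>j\<in>{..<N}. p (r + j * l n) \<otimes> \<tau> (grid n (r + j * l n)) (embed f (?t - grid n (r + j * l n))))"
    using l_pos[of n] p(1) embed.hom_closed[OF f] level.coeff_carrier coeff_carrier \<tau>_carrier
    by (intro finsum_reindex) (auto simp: inj_on_def)
  also have "\<dots> = (\<Oplus>j\<in>{..<N}. p (r + j * l n) \<otimes> f (m - int j))"
  proof (rule finsum_cong')
    fix j
    have "?t - grid n (r + j * l n) = of_int (m - int j)"
      using l_pos[of n] by (simp add: add_divide_distrib)
    then show "p (r + j * l n) \<otimes> \<tau> (grid n (r + j * l n)) (embed f (?t - grid n (r + j * l n)))
        = p (r + j * l n) \<otimes> f (m - int j)"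
      by (simp only: along_apply[OF inj] \<tau>_fixes_kk[OF Laurent.coeff_in_K[OF f]])
  qed (use p(1) level.coeff_carrier Laurent.coeff_carrier[OF f] in auto)
  finally show ?thesis .
qed

text \<open>Reading a relation over skew polynomials along one residue class of exponents modulo \<open>l n\<close> and
  applying a linear functional to the coefficients turns it into a relation over polynomials in
  \<open>T\<close>.\<close>

lemma relation_descends:
  assumes B: "finite B" "B \<subseteq> carrier Laurent" and q: "\<And>b. b \<in> B \<Longrightarrow> q b \<in> carrier (Pol n)"
    and rel: "(\<Oplus>\<^bsub>S\<^esub>b\<in>B. \<iota> n (q b) \<otimes>\<^bsub>S\<^esub> embed b) = \<zero>\<^bsub>S\<^esub>" and nonzero: "b\<^sub>0 \<in> B" "q b\<^sub>0 i\<^sub>0 \<noteq> \<zero>"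
  shows "\<not> lin_indep Laurent Rat B"
proof -
  obtain N where N: "\<And>b i. b \<in> B \<Longrightarrow> i \<ge> N \<Longrightarrow> q b i = \<zero>"
    using skewpoly_degree_bound[of B q, OF B(1) q] by blast
  define r where "r = i\<^sub>0 mod l n"
  define j\<^sub>0 where "j\<^sub>0 = i\<^sub>0 div l n"
  have r: "r < l n" and i\<^sub>0: "i\<^sub>0 = r + j\<^sub>0 * l n" using l_pos[of n] by (auto simp: r_def j\<^sub>0_def)
  have "i\<^sub>0 < N" using N nonzero by (meson not_le)
  then have j\<^sub>0: "j\<^sub>0 < N" unfolding j\<^sub>0_def by (rule le_less_trans[OF div_le_dividend])
  have q_carrier: "q b i \<in> carrier h" if "b \<in> B" for b i using level.coeff_carrier[OF q[OF that]] .
  have "q b\<^sub>0 (r + j\<^sub>0 * l n) \<noteq> \<zero>" using nonzero(2) i\<^sub>0 by simp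
  then obtain c where c: "\<And>b j. b \<in> B \<Longrightarrow> j < N \<Longrightarrow> c b j \<in> kk" "c b\<^sub>0 j\<^sub>0 = \<one>"
    and c_rel: "\<And>a. (\<And>b j. b \<in> B \<Longrightarrow> a b j \<in> kk) \<Longrightarrow> (\<Oplus>b\<in>B. \<Oplus>j\<in>{..<N}. a b j \<otimes> q b (r + j * l n)) = \<zero> \<Longrightarrow>
      (\<Oplus>b\<in>B. \<Oplus>j\<in>{..<N}. a b j \<otimes> c b j) = \<zero>"
    using relation_over_subdivring[where v = "\<lambda>b j. q b (r + j * l n)",
        OF kk B(1) finite_lessThan q_carrier nonzero(1) lessThan_iff[THEN iffD2, OF j\<^sub>0]]
    unfolding lessThan_iff by blast
  have b_kk: "b j \<in> kk" "b j \<in> carrier h" if "b \<in> B" for b j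
    using that B(2) Laurent.coeff_in_K subdivring_carrier[OF kk] by blast+
  have descended: "(\<Oplus>b\<in>B. \<Oplus>j\<in>{..<N}. c b j \<otimes> b (m - int j)) = \<zero>" for m
  proof -
    have "\<zero> = (\<Oplus>\<^bsub>S\<^esub>b\<in>B. \<iota> n (q b) \<otimes>\<^bsub>S\<^esub> embed b) (of_int m + grid n r)" unfolding rel by simp
    also have "\<dots> = (\<Oplus>b\<in>B. (\<iota> n (q b) \<otimes>\<^bsub>S\<^esub> embed b) (of_int m + grid n r))"
      using B \<iota>_closed[OF q] embed.hom_closed by (intro finsum_series_apply) auto
    also have "\<dots> = (\<Oplus>b\<in>B. \<Oplus>j\<in>{..<N}. b (m - int j) \<otimes> q b (r + j * l n))"
    proof (rule finsum_cong')
      fix b assume b: "b \<in> B"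
      then have "(\<iota> n (q b) \<otimes>\<^bsub>S\<^esub> embed b) (of_int m + grid n r) = (\<Oplus>j\<in>{..<N}. q b (r + j * l n) \<otimes> b (m - int j))"
        using B(2) by (intro mult_apply_residue q N r) auto
      then show "(\<iota> n (q b) \<otimes>\<^bsub>S\<^esub> embed b) (of_int m + grid n r) = (\<Oplus>j\<in>{..<N}. b (m - int j) \<otimes> q b (r + j * l n))"
        using kk_central[OF b_kk(1) q_carrier] b by simp
    qed (use b_kk q_carrier in auto)
    finally have "(\<Oplus>b\<in>B. \<Oplus>j\<in>{..<N}. b (m - int j) \<otimes> c b j) = \<zero>"
      using b_kk(1) by (intro c_rel) auto
    moreover have "(\<Oplus>b\<in>B. \<Oplus>j\<in>{..<N}. c b j \<otimes> b (m - int j)) = (\<Oplus>b\<in>B. \<Oplus>j\<in>{..<N}. b (m - int j) \<otimes> c b j)"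
      using b_kk(2) subdivring_carrier[OF kk c(1)] kk_central[OF c(1) b_kk(2)] by (intro finsum_cong') simp_all
    ultimately show ?thesis by simp
  qed
  show ?thesis
    by (rule Laurent.polynomial_relation_imp_dependent[OF B c(1) descended nonzero(1) j\<^sub>0])
       (use c(2) one_not_zero in simp_all)
qed

end

section \<open>The limit\<close>

definition outer_galois_group :: "('b,'c) ring_scheme \<Rightarrow> ('d,'e) monoid_scheme \<Rightarrow> bool" where
  "outer_galois_group H G \<longleftrightarrow> (\<exists>(L :: 'b ring) f. division_ring L \<and> f \<in> ring_hom H L \<and> inj_on f (carrier H) \<and>
     outer L (f ` carrier H) \<and> galois L (f ` carrier H) \<and> Gal L (f ` carrier H) \<cong> G)"

lemma IGP_iff_outer_galois_group:
  "IGP H \<longleftrightarrow> (\<forall>G :: nat monoid. group G \<and> finite (carrier G) \<longrightarrow> outer_galois_group H G)"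
  unfolding IGP_def outer_galois_group_def ..

lemma outer_galois_group_iso: "outer_galois_group H G \<Longrightarrow> G \<cong> G' \<Longrightarrow> outer_galois_group H G'"
  unfolding outer_galois_group_def by (blast intro: iso_trans)

lemma (in divring_hom) outer_galois_group_if_lepoll:
  assumes M: "subdivring M S" "\<phi> ` carrier R \<subseteq> M" "M \<lesssim> carrier R"
    and outer: "outer (S\<lparr>carrier := M\<rparr>) (\<phi> ` carrier R)" and galois: "galois (S\<lparr>carrier := M\<rparr>) (\<phi> ` carrier R)"
  shows "outer_galois_group R (Gal (S\<lparr>carrier := M\<rparr>) (\<phi> ` carrier R))"
proof -
  let ?M = "S\<lparr>carrier := M\<rparr>"
  interpret M: divring ?M by (rule S.subdivring_divring[OF M(1)])
  obtain j where j: "inj_on j M" "j ` M \<subseteq> carrier R" using M(3) unfolding lepoll_def by blast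
  interpret j: ring_isomorphism ?M "image_ring j ?M" j by (rule M.image_ring_isomorphism) (use j(1) in simp)
  have \<phi>: "\<phi> \<in> ring_hom R ?M" using hom M(2) by (auto simp: ring_hom_def)
  have image: "(j \<circ> \<phi>) ` carrier R = j ` \<phi> ` carrier R" and subset: "\<phi> ` carrier R \<subseteq> carrier ?M"
    using M(2) by (auto simp: image_comp)
  have "group (Gal ?M (\<phi> ` carrier R))" by (rule Gal_group[OF M.ring_axioms subset])
  then have "Gal (image_ring j ?M) (j ` \<phi> ` carrier R) \<cong> Gal ?M (\<phi> ` carrier R)"
    by (rule group.iso_sym[OF _ j.Gal_image_iso[OF subset]])
  moreover have "division_ring (image_ring j ?M)"
    using j.divring_image[OF M.divring_axioms] by (simp add: division_ring_iff_divring)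
  moreover have "j \<in> ring_hom ?M (image_ring j ?M)" using j.iso by (simp add: ring_iso_def)
  then have "j \<circ> \<phi> \<in> ring_hom R (image_ring j ?M)" by (rule ring_hom_trans[OF \<phi>])
  moreover have "inj_on (j \<circ> \<phi>) (carrier R)" by (rule comp_inj_on[OF hom_inj inj_on_subset[OF j(1) M(2)]])
  ultimately show ?thesis
    using j.outer_image[OF subset outer] j.galois_image[OF subset galois]
    unfolding outer_galois_group_def image[symmetric] by blast
qed

lemma (in divring_hom) lin_indep_if_image:
  assumes K: "K \<subseteq> carrier R" and B: "finite B" "B \<subseteq> carrier R" and indep: "lin_indep S (\<phi> ` K) (\<phi> ` B)"
  shows "lin_indep R K B"
  unfolding lin_indep_def
proof (intro ballI impI)
  fix a b assume a: "a \<in> B \<rightarrow> K" and rel: "(\<Oplus>\<^bsub>R\<^esub>b\<in>B. a b \<otimes>\<^bsub>R\<^esub> b) = \<zero>\<^bsub>R\<^esub>" and b: "b \<in> B"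
  have inj: "inj_on \<phi> B" by (rule inj_on_subset[OF hom_inj B(2)])
  have carrier: "a b \<in> carrier R" "b \<in> carrier R" if "b \<in> B" for b using that a K B by auto
  define a' where "a' y = \<phi> (a (inv_into B \<phi> y))" for y
  have "(\<Oplus>\<^bsub>S\<^esub>y\<in>\<phi> ` B. a' y \<otimes>\<^bsub>S\<^esub> y) = (\<Oplus>\<^bsub>S\<^esub>b\<in>B. \<phi> (a b \<otimes>\<^bsub>R\<^esub> b))"
    using inj carrier by (subst S.finsum_reindex) (auto simp: a'_def intro!: S.finsum_cong')
  also have "\<dots> = \<phi> (\<Oplus>\<^bsub>R\<^esub>b\<in>B. a b \<otimes>\<^bsub>R\<^esub> b)" using B(1) carrier by (intro ring_hom_finsum[OF R.ring_axioms S.ring_axioms hom, symmetric]) auto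
  finally have "(\<Oplus>\<^bsub>S\<^esub>y\<in>\<phi> ` B. a' y \<otimes>\<^bsub>S\<^esub> y) = \<zero>\<^bsub>S\<^esub>" unfolding rel by simp
  moreover have "a' \<in> \<phi> ` B \<rightarrow> \<phi> ` K" using a inj by (auto simp: a'_def)
  ultimately have "a' (\<phi> b) = \<zero>\<^bsub>S\<^esub>" using indep b unfolding lin_indep_def by blast
  then show "a b = \<zero>\<^bsub>R\<^esub>" using b inj carrier by (simp add: a'_def hom_eq_zero_iff)
qed

locale skew_limit = exponent_tower h k hs \<sigma> d l kk + H: divring H
  for h :: "('a,'m) ring_scheme" (structure) and k hs \<sigma> d l kk and H :: "('b,'c) ring_scheme" +
  fixes \<psi> :: "nat \<Rightarrow> (nat \<Rightarrow> 'a) \<Rightarrow> 'b"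
  assumes \<psi>_hom: "\<And>n. \<psi> n \<in> ring_hom (Pol n) H" and \<psi>_inj: "\<And>n. inj_on (\<psi> n) (carrier (Pol n))"
    and \<psi>_stretch: "\<And>n p. p \<in> carrier (Pol n) \<Longrightarrow> \<psi> (Suc n) (stretch h (ratio n) p) = \<psi> n p"
    and H_UN: "(\<Union>n. gen_divring H (\<psi> n ` carrier (Pol n))) = carrier H"
begin

lemma \<psi>_carrier [simp]: "p \<in> carrier (Pol n) \<Longrightarrow> \<psi> n p \<in> carrier H"
  using ring_hom_closed[OF \<psi>_hom] .

lemma lift_level:
  assumes "m \<le> n" "p \<in> carrier (Pol m)"
  shows "\<exists>q\<in>carrier (Pol n). \<psi> n q = \<psi> m p \<and> \<iota> n q = \<iota> m p"
  using assms(1)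
proof (induction n rule: dec_induct)
  case base show ?case using assms(2) by blast
next
  case (step n)
  then obtain q where "q \<in> carrier (Pol n)" "\<psi> n q = \<psi> m p" "\<iota> n q = \<iota> m p" by blast
  then show ?case using stretch_closed[of q n] \<psi>_stretch[of q n] \<iota>_stretch[of n q] by metis
qed

definition A :: "'b set" where "A = (\<Union>n. \<psi> n ` carrier (Pol n))"

definition \<phi> :: "'b \<Rightarrow> rat \<Rightarrow> 'a" where
  "\<phi> x = (SOME y. \<exists>n. \<exists>p\<in>carrier (Pol n). x = \<psi> n p \<and> y = \<iota> n p)"

lemma \<psi>_in_A: "p \<in> carrier (Pol n) \<Longrightarrow> \<psi> n p \<in> A"
  by (auto simp: A_def)

lemma \<phi>_\<psi>:
  assumes p: "p \<in> carrier (Pol n)" shows "\<phi> (\<psi> n p) = \<iota> n p"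
  unfolding \<phi>_def
proof (rule some_equality)
  show "\<exists>m. \<exists>q\<in>carrier (Pol m). \<psi> n p = \<psi> m q \<and> \<iota> n p = \<iota> m q" using p by blast
  fix y assume "\<exists>m. \<exists>q\<in>carrier (Pol m). \<psi> n p = \<psi> m q \<and> y = \<iota> m q"
  then obtain m q where q: "q \<in> carrier (Pol m)" "\<psi> n p = \<psi> m q" "y = \<iota> m q" by blast
  obtain p' where p': "p' \<in> carrier (Pol (max m n))" "\<psi> (max m n) p' = \<psi> n p" "\<iota> (max m n) p' = \<iota> n p"
    using lift_level[OF max.cobounded2 p] by blast
  obtain q' where q': "q' \<in> carrier (Pol (max m n))" "\<psi> (max m n) q' = \<psi> m q" "\<iota> (max m n) q' = \<iota> m q"
    using lift_level[OF max.cobounded1 q(1)] by blast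
  have "p' = q'" using inj_onD[OF \<psi>_inj _ p'(1) q'(1)] p'(2) q'(2) q(2) by simp
  then show "y = \<iota> n p" using p'(3) q'(3) q(3) by simp
qed

lemma A_common_level:
  assumes "finite B" "\<And>b. b \<in> B \<Longrightarrow> x b \<in> A"
  shows "\<exists>n q. \<forall>b\<in>B. q b \<in> carrier (Pol n) \<and> x b = \<psi> n (q b)"
proof -
  have "\<forall>b\<in>B. \<exists>n. x b \<in> \<psi> n ` carrier (Pol n)" using assms(2) by (auto simp: A_def)
  then obtain N where N: "\<And>b. b \<in> B \<Longrightarrow> x b \<in> \<psi> (N b) ` carrier (Pol (N b))" by metis
  have "\<exists>q\<in>carrier (Pol (Max (N ` B))). x b = \<psi> (Max (N ` B)) q" if b: "b \<in> B" for b
  proof -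
    obtain p where p: "p \<in> carrier (Pol (N b))" "x b = \<psi> (N b) p" using N[OF b] by blast
    have "N b \<le> Max (N ` B)" using assms(1) b by simp
    then show ?thesis using lift_level[OF _ p(1)] p(2) by metis
  qed
  then show ?thesis by metis
qed

lemma A_pairE:
  assumes "x \<in> A" "y \<in> A"
  obtains n p q where "p \<in> carrier (Pol n)" "q \<in> carrier (Pol n)" "x = \<psi> n p" "y = \<psi> n q"
proof -
  obtain n q where "\<forall>z\<in>{x, y}. q z \<in> carrier (Pol n) \<and> z = \<psi> n (q z)"
    using A_common_level[of "{x, y}" "\<lambda>z. z"] assms by auto
  then show thesis using that[of "q x" n "q y"] by blast
qed

lemma \<psi>_zero: "\<psi> n \<zero>\<^bsub>Pol n\<^esub> = \<zero>\<^bsub>H\<^esub>"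
proof -
  have zero: "\<zero>\<^bsub>Pol n\<^esub> \<in> carrier (Pol n)" by (rule level.skewpoly_zero_closed)
  have "\<zero>\<^bsub>Pol n\<^esub> \<oplus>\<^bsub>Pol n\<^esub> \<zero>\<^bsub>Pol n\<^esub> = \<zero>\<^bsub>Pol n\<^esub>" by (rule ext) simp
  then have "\<psi> n \<zero>\<^bsub>Pol n\<^esub> \<oplus>\<^bsub>H\<^esub> \<psi> n \<zero>\<^bsub>Pol n\<^esub> = \<psi> n \<zero>\<^bsub>Pol n\<^esub>" using ring_hom_add[OF \<psi>_hom zero zero] by simp
  then show ?thesis using H.add.r_cancel_one' zero by simp
qed

lemma \<psi>_eq_zero_iff: "p \<in> carrier (Pol n) \<Longrightarrow> \<psi> n p = \<zero>\<^bsub>H\<^esub> \<longleftrightarrow> p = \<zero>\<^bsub>Pol n\<^esub>"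
  using inj_onD[OF \<psi>_inj _ _ level.skewpoly_zero_closed] \<psi>_zero by metis

lemma A_subring: "subring A H"
proof (rule H.subringI)
  show "A \<subseteq> carrier H" by (auto simp: A_def)
  show "\<one>\<^bsub>H\<^esub> \<in> A" using \<psi>_in_A[OF level.skewpoly_one_closed] ring_hom_one[OF \<psi>_hom] by metis
  show "\<ominus>\<^bsub>H\<^esub> x \<in> A" if x: "x \<in> A" for x
  proof -
    obtain n p where p: "p \<in> carrier (Pol n)" "x = \<psi> n p" using x by (auto simp: A_def)
    let ?q = "\<lambda>i. \<ominus> p i"
    have q: "?q \<in> carrier (Pol n)"
      using p(1) subdivring_uminus[OF hs] minus_zero unfolding mem_skewpoly by metis
    have "?q \<oplus>\<^bsub>Pol n\<^esub> p = \<zero>\<^bsub>Pol n\<^esub>" using level.coeff_carrier[OF p(1)] by (intro ext) (simp add: l_neg)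
    then have "\<psi> n ?q \<oplus>\<^bsub>H\<^esub> x = \<zero>\<^bsub>H\<^esub>" using ring_hom_add[OF \<psi>_hom q p(1)] p(2) \<psi>_zero by simp
    then have "\<ominus>\<^bsub>H\<^esub> x = \<psi> n ?q" using H.minus_equality p q by simp
    then show ?thesis using \<psi>_in_A[OF q] by simp
  qed
  show "x \<otimes>\<^bsub>H\<^esub> y \<in> A" "x \<oplus>\<^bsub>H\<^esub> y \<in> A" if xy: "x \<in> A" "y \<in> A" for x y
  proof -
    obtain n p q where "p \<in> carrier (Pol n)" "q \<in> carrier (Pol n)" "x = \<psi> n p" "y = \<psi> n q"
      using A_pairE[OF xy] by blast
    then show "x \<otimes>\<^bsub>H\<^esub> y \<in> A" "x \<oplus>\<^bsub>H\<^esub> y \<in> A"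
      using ring_hom_mult[OF \<psi>_hom, of p n q] ring_hom_add[OF \<psi>_hom, of p n q]
        \<psi>_in_A[OF level.skewpoly_mult_closed] \<psi>_in_A[OF level.skewpoly_add_closed] by metis+
  qed
qed

lemma \<phi>_hom: "\<phi> \<in> ring_hom (H\<lparr>carrier := A\<rparr>) S"
proof (rule ring_hom_memI)
  show "\<phi> x \<in> carrier S" if "x \<in> carrier (H\<lparr>carrier := A\<rparr>)" for x
    using that \<iota>_closed \<phi>_\<psi> by (auto simp: A_def)
  have "\<phi> \<one>\<^bsub>H\<^esub> = \<iota> 0 \<one>\<^bsub>Pol 0\<^esub>"
    using \<phi>_\<psi>[OF level.skewpoly_one_closed] ring_hom_one[OF \<psi>_hom] by metis
  then show "\<phi> \<one>\<^bsub>H\<lparr>carrier := A\<rparr>\<^esub> = \<one>\<^bsub>S\<^esub>" using ring_hom_one[OF \<iota>_hom] by simp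
  fix x y assume "x \<in> carrier (H\<lparr>carrier := A\<rparr>)" "y \<in> carrier (H\<lparr>carrier := A\<rparr>)"
  then have "x \<in> A" "y \<in> A" by simp_all
  then obtain n p q where pq: "p \<in> carrier (Pol n)" "q \<in> carrier (Pol n)" and xy: "x = \<psi> n p" "y = \<psi> n q"
    using A_pairE by blast
  show "\<phi> (x \<otimes>\<^bsub>H\<lparr>carrier := A\<rparr>\<^esub> y) = \<phi> x \<otimes>\<^bsub>S\<^esub> \<phi> y"
    using ring_hom_mult[OF \<psi>_hom pq] ring_hom_mult[OF \<iota>_hom pq] \<phi>_\<psi>[OF level.skewpoly_mult_closed[OF pq]]
    by (simp add: xy \<phi>_\<psi> pq)
  show "\<phi> (x \<oplus>\<^bsub>H\<lparr>carrier := A\<rparr>\<^esub> y) = \<phi> x \<oplus>\<^bsub>S\<^esub> \<phi> y"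
    using ring_hom_add[OF \<psi>_hom pq] ring_hom_add[OF \<iota>_hom pq] \<phi>_\<psi>[OF level.skewpoly_add_closed[OF pq]]
    by (simp add: xy \<phi>_\<psi> pq)
qed

sublocale ore_generated H S A \<phi>
proof (intro ore_generated.intro ore_generated_axioms.intro)
  show "inj_on \<phi> A"
  proof (rule inj_onI)
    fix x y assume "x \<in> A" "y \<in> A" "\<phi> x = \<phi> y"
    then obtain n p q where pq: "p \<in> carrier (Pol n)" "q \<in> carrier (Pol n)" "x = \<psi> n p" "y = \<psi> n q"
      using A_pairE by blast
    then have "\<iota> n p = \<iota> n q" using \<open>\<phi> x = \<phi> y\<close> \<phi>_\<psi> by simp
    then show "x = y" using pq along_inject[OF grid_inj] by metis
  qed
  show "\<exists>a\<in>A. \<exists>b\<in>A. a \<noteq> \<zero>\<^bsub>H\<^esub> \<and> a \<otimes>\<^bsub>H\<^esub> x = b \<otimes>\<^bsub>H\<^esub> y" if A: "x \<in> A" "y \<in> A" and nonzero: "y \<noteq> \<zero>\<^bsub>H\<^esub>" for x y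
  proof -
    obtain n p q where pq: "p \<in> carrier (Pol n)" "q \<in> carrier (Pol n)" and xy: "x = \<psi> n p" "y = \<psi> n q"
      using A_pairE[OF A] by blast
    have "q \<noteq> \<zero>\<^bsub>Pol n\<^esub>" using nonzero xy pq \<psi>_eq_zero_iff by blast
    then obtain a b where ab: "a \<in> carrier (Pol n)" "b \<in> carrier (Pol n)" "a \<noteq> \<zero>\<^bsub>Pol n\<^esub>"
      and eq: "a \<otimes>\<^bsub>Pol n\<^esub> p = b \<otimes>\<^bsub>Pol n\<^esub> q" using level.ore_condition[OF pq] by blast
    have "\<psi> n a \<otimes>\<^bsub>H\<^esub> x = \<psi> n b \<otimes>\<^bsub>H\<^esub> y"
      using ring_hom_mult[OF \<psi>_hom ab(1) pq(1)] ring_hom_mult[OF \<psi>_hom ab(2) pq(2)] eq xy by simp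
    moreover have "\<psi> n a \<noteq> \<zero>\<^bsub>H\<^esub>" using \<psi>_eq_zero_iff ab by blast
    ultimately show ?thesis using \<psi>_in_A ab by blast
  qed
  have A: "subdivring (gen_divring H A) H"
    by (rule H.gen_divring_subdivring) (use A_subring subringE(1) in blast)
  have "gen_divring H (\<psi> n ` carrier (Pol n)) \<subseteq> gen_divring H A" for n
    using gen_divring_least[OF A] gen_divring_superset[of A H] \<psi>_in_A by blast
  then show "gen_divring H A = carrier H" using H_UN subdivring_subset[OF A] by blast
qed (rule H.divring_axioms S.divring_axioms A_subring \<phi>_hom)+

abbreviation "H' \<equiv> extension ` carrier H"

lemma H'_subdivring: "subdivring H' S"
  by (rule extension.image_subdivring[OF H.carrier_subdivring])

lemma \<iota>_in_H':
  assumes p: "p \<in> carrier (Pol n)" shows "\<iota> n p \<in> H'"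
proof (rule image_eqI)
  show "\<iota> n p = extension (\<psi> n p)" using extension_extends[OF \<psi>_in_A[OF p]] \<phi>_\<psi>[OF p] by simp
qed (rule \<psi>_carrier[OF p])

lemma Rat_subset_H': "embed ` Rat \<subseteq> H'"
  unfolding Laurent.rat_funs_eq
proof (rule embed.image_gen_divring_subset[OF H'_subdivring])
  have monom: "monom_at h c (grid n i) \<in> H'" if "c \<in> hs n" for c n i
    using \<iota>_in_H'[OF level.skewpoly_monom_closed[OF that]] along_monom[OF grid_inj] by metis
  have embed_monom: "embed (monom_at h c i) = monom_at h c (of_int i)" for c i
    by (rule along_monom) (simp add: inj_on_def)
  have "embed (monom_at h c 0) \<in> H'" if "c \<in> kk" for c
    unfolding embed_monom using monom[of c 0 0] that kk_subset_k k_subset_hs[of 0] by auto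
  moreover have "monom_at h \<one> (grid 0 (l 0)) \<in> H'" by (rule monom[OF subdivring_one[OF hs]])
  then have "embed (monom_at h \<one> 1) \<in> H'" unfolding embed_monom using l_pos[of 0] by simp
  ultimately show "embed ` ((\<lambda>c. monom_at h c 0) ` kk \<union> {monom_at h \<one> 1}) \<subseteq> H'" by blast
qed (use Laurent.monom_closed subdivring_one[OF kk] in auto)

lemma infinite_H: "infinite (carrier H)"
proof -
  have "inj (\<lambda>i. \<psi> 0 (monom_at h \<one> i))"
  proof (rule injI)
    fix i j assume "\<psi> 0 (monom_at h \<one> i) = \<psi> 0 (monom_at h \<one> j)"
    then have "monom_at h \<one> i = monom_at h \<one> j"
      using inj_onD[OF \<psi>_inj] level.skewpoly_monom_closed subdivring_one[OF hs] by metis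
    then have "monom_at h \<one> i j = monom_at h \<one> j j" by simp
    then show "i = j" using one_not_zero by (simp add: monom_at_def split: if_splits)
  qed
  moreover have "range (\<lambda>i. \<psi> 0 (monom_at h \<one> i)) \<subseteq> carrier H"
    using level.skewpoly_monom_closed subdivring_one[OF hs] by auto
  ultimately show ?thesis by (meson infinite_iff_countable_subset)
qed

lemma embed_lin_indep:
  assumes B: "finite B" "B \<subseteq> carrier Laurent" and indep: "lin_indep Laurent Rat B"
  shows "lin_indep S H' (embed ` B)"
  unfolding lin_indep_def
proof (intro ballI impI)
  fix a b' assume a: "a \<in> embed ` B \<rightarrow> H'" and rel: "(\<Oplus>\<^bsub>S\<^esub>b\<in>embed ` B. a b \<otimes>\<^bsub>S\<^esub> b) = \<zero>\<^bsub>S\<^esub>"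
    and b': "b' \<in> embed ` B"
  have embed_closed: "embed b \<in> carrier S" if "b \<in> B" for b using that B(2) by auto
  have "\<forall>b\<in>B. \<exists>x\<in>carrier H. a (embed b) = extension x" using a by blast
  then obtain x where x: "\<And>b. b \<in> B \<Longrightarrow> x b \<in> carrier H" "\<And>b. b \<in> B \<Longrightarrow> a (embed b) = extension (x b)"
    by metis
  have "\<exists>r\<in>A. r \<noteq> \<zero>\<^bsub>H\<^esub> \<and> (\<forall>b\<in>B. denominator r (x b))"
    by (rule common_denominator[OF B(1) x(1)]) (use denominator_exists x(1) in simp_all)
  then obtain r where r: "r \<in> A" "r \<noteq> \<zero>\<^bsub>H\<^esub>" "\<And>b. b \<in> B \<Longrightarrow> denominator r (x b)" by blast
  then have rx: "r \<otimes>\<^bsub>H\<^esub> x b \<in> A" if "b \<in> B" for b using that by (simp add: denominator_def)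
  obtain n q where q: "\<And>b. b \<in> B \<Longrightarrow> q b \<in> carrier (Pol n)" "\<And>b. b \<in> B \<Longrightarrow> r \<otimes>\<^bsub>H\<^esub> x b = \<psi> n (q b)"
    using A_common_level[where x = "\<lambda>b. r \<otimes>\<^bsub>H\<^esub> x b", OF B(1) rx] by metis
  have \<iota>_q: "\<iota> n (q b) = \<phi> r \<otimes>\<^bsub>S\<^esub> extension (x b)" if "b \<in> B" for b
    using extension_denominator[OF x(1) r(3)] \<phi>_\<psi>[OF q(1)] q(2) that by simp
  have "(\<Oplus>\<^bsub>S\<^esub>b\<in>B. \<iota> n (q b) \<otimes>\<^bsub>S\<^esub> embed b) = (\<Oplus>\<^bsub>S\<^esub>b\<in>B. \<phi> r \<otimes>\<^bsub>S\<^esub> (extension (x b) \<otimes>\<^bsub>S\<^esub> embed b))"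
    using x(1) r(1) embed_closed by (intro S.finsum_cong') (auto simp: \<iota>_q S.m_assoc)
  also have "\<dots> = \<phi> r \<otimes>\<^bsub>S\<^esub> (\<Oplus>\<^bsub>S\<^esub>b\<in>B. extension (x b) \<otimes>\<^bsub>S\<^esub> embed b)"
    using B(1) x(1) r(1) embed_closed by (intro S.finsum_rdistr[symmetric]) auto
  also have "(\<Oplus>\<^bsub>S\<^esub>b\<in>B. extension (x b) \<otimes>\<^bsub>S\<^esub> embed b) = (\<Oplus>\<^bsub>S\<^esub>b\<in>embed ` B. a b \<otimes>\<^bsub>S\<^esub> b)"
    using x embed_closed inj_on_subset[OF embed.hom_inj B(2)]
    by (subst S.finsum_reindex) (auto intro!: S.finsum_cong')
  also have "\<phi> r \<otimes>\<^bsub>S\<^esub> \<dots> = \<zero>\<^bsub>S\<^esub>" unfolding rel using r(1) by simp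
  finally have descended: "(\<Oplus>\<^bsub>S\<^esub>b\<in>B. \<iota> n (q b) \<otimes>\<^bsub>S\<^esub> embed b) = \<zero>\<^bsub>S\<^esub>" .
  obtain b where b: "b \<in> B" "b' = embed b" using b' by blast
  have "q b i = \<zero>" for i
    using relation_descends[OF B q(1) descended b(1)] indep by blast
  then have "q b = \<zero>\<^bsub>Pol n\<^esub>" by (intro ext) simp
  then have "r \<otimes>\<^bsub>H\<^esub> x b = \<zero>\<^bsub>H\<^esub>" using q(2)[OF b(1)] \<psi>_zero by simp
  then have "x b = \<zero>\<^bsub>H\<^esub>" using r(1,2) x(1)[OF b(1)] by simp
  then show "a b' = \<zero>\<^bsub>S\<^esub>" using x(2)[OF b(1)] b(2) by simp
qed

context
  fixes L
  assumes L: "subdivring L Laurent" "Rat \<subseteq> L" "galois (Laurent\<lparr>carrier := L\<rparr>) Rat"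
    and finite_Gal_L: "finite (carrier (Gal (Laurent\<lparr>carrier := L\<rparr>) Rat))"
begin

interpretation L: ring_isomorphism "Laurent\<lparr>carrier := L\<rparr>" "S\<lparr>carrier := embed ` L\<rparr>" embed
  by (rule embed.ring_isomorphism_subring[OF subdivring_imp_subring[OF L(1)]])

lemma Gal_embed_iso: "Gal (S\<lparr>carrier := embed ` L\<rparr>) (embed ` Rat) \<cong> Gal (Laurent\<lparr>carrier := L\<rparr>) Rat"
proof -
  have Rat: "Rat \<subseteq> carrier (Laurent\<lparr>carrier := L\<rparr>)" using L(2) by simp
  show ?thesis by (rule group.iso_sym[OF Gal_group[OF L.R.ring_axioms Rat] L.Gal_image_iso[OF Rat]])
qed

lemma central_compositum_embed: "central_compositum S (embed ` Rat) (embed ` L) H'"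
proof unfold_locales
  show "galois (S\<lparr>carrier := embed ` L\<rparr>) (embed ` Rat)"
    by (rule L.galois_image) (use L in auto)
  show "finite (carrier (Gal (S\<lparr>carrier := embed ` L\<rparr>) (embed ` Rat)))"
    using Gal_embed_iso finite_Gal_L bij_betw_finite unfolding is_iso_def iso_def by blast
  show "subdivring (embed ` Rat) S" "subdivring (embed ` L) S"
    using embed.image_subdivring Laurent.rat_funs_subdivring L(1) by blast+
  show "x \<otimes>\<^bsub>S\<^esub> y = y \<otimes>\<^bsub>S\<^esub> x" if "x \<in> embed ` L" "y \<in> carrier S" for x y
    using that embed_central subdivring_carrier[OF L(1)] by blast
  fix B assume B: "finite B" "B \<subseteq> embed ` L" "lin_indep S (embed ` Rat) B"
  then obtain C where C: "C \<subseteq> L" "inj_on embed C" "B = embed ` C" by (auto simp: subset_image_inj)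
  have C': "finite C" "C \<subseteq> carrier Laurent"
    using B(1) C finite_image_iff subdivring_subset[OF L(1)] by blast+
  have "lin_indep Laurent Rat C"
    using embed.lin_indep_if_image[OF subdivring_subset[OF Laurent.rat_funs_subdivring] C'] B(3) C(3) by simp
  then show "lin_indep S H' B" unfolding C(3) by (rule embed_lin_indep[OF C'])
qed (use L(2) H'_subdivring Rat_subset_H' in auto)

lemma outer_galois_group_Gal_L: "outer_galois_group H (Gal (Laurent\<lparr>carrier := L\<rparr>) Rat)"
proof -
  interpret central_compositum S "embed ` Rat" "embed ` L" H' by (rule central_compositum_embed)
  obtain B where B: "finite B" "B \<subseteq> embed ` L"
    and M: "subdivring (lin_span S H' B) S" "H' \<subseteq> lin_span S H' B"
      "outer (S\<lparr>carrier := lin_span S H' B\<rparr>) H'" "galois (S\<lparr>carrier := lin_span S H' B\<rparr>) H'"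
    and Gal_M: "Gal (S\<lparr>carrier := lin_span S H' B\<rparr>) H' \<cong> Gal (S\<lparr>carrier := embed ` L\<rparr>) (embed ` Rat)"
    by (rule compositum_galois)
  have "infinite H'" using infinite_H finite_image_iff[OF extension.hom_inj] by blast
  then have "lin_span S H' B \<lesssim> H'"
    by (rule lin_span_lepoll[OF S.ring_axioms _ B(1)]) (use B(2) L_carrier subdivring_subset[OF H'_subdivring] in auto)
  then have "lin_span S H' B \<lesssim> carrier H" by (rule lepoll_trans[OF _ image_lepoll])
  then have "outer_galois_group H (Gal (S\<lparr>carrier := lin_span S H' B\<rparr>) H')"
    by (rule extension.outer_galois_group_if_lepoll[OF M(1,2) _ M(3,4)])
  then show ?thesis by (rule outer_galois_group_iso[OF _ iso_trans[OF Gal_M Gal_embed_iso]])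
qed

end

lemma SIGP_imp_IGP:
  assumes "SIGP h kk" shows "IGP H"
  unfolding IGP_iff_outer_galois_group
proof (intro allI impI)
  fix G :: "nat monoid" assume G: "group G \<and> finite (carrier G)"
  then obtain L where L: "subdivring L Laurent" "Rat \<subseteq> L" "galois (Laurent\<lparr>carrier := L\<rparr>) Rat"
    and Gal: "Gal (Laurent\<lparr>carrier := L\<rparr>) Rat \<cong> G"
    using assms unfolding SIGP_def by blast
  then have "finite (carrier (Gal (Laurent\<lparr>carrier := L\<rparr>) Rat))"
    using G bij_betw_finite unfolding is_iso_def iso_def by blast
  from outer_galois_group_Gal_L[OF L this] Gal show "outer_galois_group H G"
    by (rule outer_galois_group_iso)
qed

end

theorem theorem6:
  fixes h :: "('a,'m) ring_scheme" and k kk :: "'a set" and hs :: "nat \<Rightarrow> 'a set"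
    and \<sigma> :: "nat \<Rightarrow> 'a \<Rightarrow> 'a" and d :: "nat \<Rightarrow> nat"
  assumes "division_ring h" and "subdivring k h"
    and "\<And>n. subdivring (hs n) h" and "\<And>n. k \<subseteq> hs n" and "\<And>n. hs n \<subseteq> hs (Suc n)"
    and "(\<Union>n. hs n) = carrier h"
    and "\<And>n. outer (h\<lparr>carrier := hs n\<rparr>) k" and "\<And>n. galois (h\<lparr>carrier := hs n\<rparr>) k"
    and "\<And>n. left_degree h k (hs n) (d n)"
    and "\<And>n. \<sigma> n \<in> carrier (Gal (h\<lparr>carrier := hs n\<rparr>) k)"
    and "\<And>n. carrier (Gal (h\<lparr>carrier := hs n\<rparr>) k) = generate (Gal (h\<lparr>carrier := hs n\<rparr>) k) {\<sigma> n}"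
    and "\<And>m n x. m \<le> n \<Longrightarrow> x \<in> hs m \<Longrightarrow> \<sigma> n x = \<sigma> m x"
    and "\<And>n. coprime (d (Suc n) div d n) (d n)"
    and "subdivring kk h" and "kk \<subseteq> ring_center (h\<lparr>carrier := k\<rparr>)"
  shows "(\<exists>l :: nat \<Rightarrow> nat. \<forall>n. 0 < l n \<and> l n dvd l (Suc n) \<and>
            d n dvd (l (Suc n) div l n - 1) \<and> d n dvd l n)
       \<and> (\<forall>l :: nat \<Rightarrow> nat. (\<forall>n. 0 < l n \<and> l n dvd l (Suc n) \<and>
            d n dvd (l (Suc n) div l n - 1) \<and> d n dvd l n) \<longrightarrow>
          (\<forall>(H :: ('b,'c) ring_scheme) \<psi>. is_skew_limit h hs \<sigma> l H \<psi> \<longrightarrow>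
              SIGP h kk \<longrightarrow> IGP H))"
proof -
  interpret cyclic_tower h k hs \<sigma> d
    by (intro cyclic_tower.intro cyclic_tower_axioms.intro) (fact assms[unfolded division_ring_iff_divring])+
  have "\<exists>l. \<forall>n. 0 < l n \<and> l n dvd l (Suc n) \<and> d n dvd (l (Suc n) div l n - 1) \<and> d n dvd l n"
    using compatible_exponents_exist[of d] d_pos d_dvd_Suc assms(13) by blast
  moreover have "IGP H"
    if l: "\<forall>n. 0 < l n \<and> l n dvd l (Suc n) \<and> d n dvd (l (Suc n) div l n - 1) \<and> d n dvd l n"
      and limit: "is_skew_limit h hs \<sigma> l H \<psi>" and SIGP: "SIGP h kk"
    for l and H :: "('b,'c) ring_scheme" and \<psi>
  proof -
    interpret exponent_tower h k hs \<sigma> d l kk by unfold_locales (use l assms(14,15) in auto)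
    interpret skew_limit h k hs \<sigma> d l kk H \<psi>
      using limit unfolding is_skew_limit_def division_ring_iff_divring
      by (intro skew_limit.intro skew_limit_axioms.intro exponent_tower_axioms) (auto simp: ratio_def)
    show ?thesis by (rule SIGP_imp_IGP[OF SIGP])
  qed
  ultimately show ?thesis by blast
qed

end
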